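(* Let $k\ge 3$ and $d\ge 1$ be integers, let $n=(k-1)(2^d-1)$, and set $p=\min\{k,d\}$, $q=\min\{k,d-1\}$. Then $$\dim_{\mathbb F_2}(QP_k)_n \;\ge\; c(k,d):=\sum_{t=1}^{p}\binom kt+(k-3)\binom k2\sum_{u=1}^{q}\binom ku,$$ with equality if and only if either $k=3$, or $k=4$ and $d\ge 5$, or $k=5$ and $d\ge 6$. (An empty sum, e.g. when $q=0$, is $0$.)
   Context: $P_k=\mathbb F_2[x_1,\dots,x_k]$ is the polynomial algebra with each $x_i$ of degree $1$, viewed as a graded module over the mod-2 Steenrod algebra $\mathcal A$ (acting via the Steenrod squares $Sq^i$ with the Cartan formula). $\mathcal A^+$ is the augmentation ideal of $\mathcal A$, and $QP_k=P_k/\mathcal A^+P_k=\mathbb F_2\otimes_{\mathcal A}P_k$. $(QP_k)_n$ denotes the degree-$n$ part of $QP_k$, i.e. the image in $QP_k$ of the homogeneous polynomials of degree $n$. *)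

theory Defs
  imports Complex_Main "HOL-Library.Poly_Mapping" "HOL-Library.Z2"
begin

(* Monomials in variables x_0, x_1, ... as exponent vectors; polynomials over F_2 = bit *)
type_synonym mono = "nat \<Rightarrow>\<^sub>0 nat"
type_synonym poly2 = "mono \<Rightarrow>\<^sub>0 bit"

definition scale2 :: "bit \<Rightarrow> poly2 \<Rightarrow> poly2" where
  "scale2 c p = Poly_Mapping.map (\<lambda>x. c * x) p"

definition mdeg :: "mono \<Rightarrow> nat" where
  "mdeg m = (\<Sum>j\<in>Poly_Mapping.keys m. Poly_Mapping.lookup m j)"

(* Sq^i on a monomial, via Sq^i(x^a) = binom(a,i) x^(a+i) and the Cartan formula *)
definition Sq_mono :: "nat \<Rightarrow> mono \<Rightarrow> poly2" where
  "Sq_mono i m =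
     (\<Sum>e\<in>{e. Poly_Mapping.keys e \<subseteq> Poly_Mapping.keys m \<and> (\<forall>j. Poly_Mapping.lookup e j \<le> Poly_Mapping.lookup m j) \<and> mdeg e = i}.
        Poly_Mapping.single (m + e)
          (\<Prod>j\<in>Poly_Mapping.keys m. of_nat (Poly_Mapping.lookup m j choose Poly_Mapping.lookup e j)))"

definition Sq :: "nat \<Rightarrow> poly2 \<Rightarrow> poly2" where
  "Sq i p = (\<Sum>m\<in>Poly_Mapping.keys p. scale2 (Poly_Mapping.lookup p m) (Sq_mono i m))"

definition Pk :: "nat \<Rightarrow> poly2 set" where
  "Pk k = {p. \<forall>m\<in>Poly_Mapping.keys p. Poly_Mapping.keys m \<subseteq> {..<k}}"

definition Pk_deg :: "nat \<Rightarrow> nat \<Rightarrow> poly2 set" where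
  "Pk_deg k n = {p \<in> Pk k. \<forall>m\<in>Poly_Mapping.keys p. mdeg m = n}"

(* A^+ P_k: A^+ is generated as an algebra by the Sq^i, i > 0, so A^+ P_k is
   the F_2-span of all Sq^i f with i > 0 and f \<in> P_k *)
definition hit :: "nat \<Rightarrow> poly2 set" where
  "hit k = module.span scale2 {Sq i f | i f. 0 < i \<and> f \<in> Pk k}"

definition QP_dim :: "nat \<Rightarrow> nat \<Rightarrow> nat" where
  "QP_dim k n = vector_space.dim scale2 (Pk_deg k n)
               - vector_space.dim scale2 (Pk_deg k n \<inter> hit k)"

definition cKD :: "nat \<Rightarrow> nat \<Rightarrow> nat" where
  "cKD k d = (\<Sum>t=1..min k d. k choose t)
            + (k - 3) * (k choose 2) * (\<Sum>u=1..min k (d - 1). k choose u)"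

end

theory Submission
  imports Defs "HOL-Library.FuncSet" "HOL-Library.Multiset" "HOL-Computational_Algebra.Polynomial"
begin

text \<open>
  Write X(i) for the product of all variables but x(i), and let K(i) send y to X(i) y^2. For k = 3, 4, 5
  every monomial of degree (k-1)(2^d-1) with fewer than k-1 odd exponents is hit, so the K(i) act on
  classes, commute, and satisfy K(i)K(i)K(j) = K(j)K(j)K(i). A word in them therefore only depends
  on its length and on its set J of letters. Applying Sq 1 to products X^(2^s-1) g^(2^s) shows that,
  modulo words with more letters, a word with letters J factors through setting the sum of the
  variables in J to zero, that is, through the case of k-1 variables in degree k-1. This bounds
  the dimension by (2^k-1)(1 + (k-3) binom(k,2)).

  For the lower bound, the coefficient of a spike after a linear substitution is a functional that
  vanishes on hit polynomials. Restricting to the hyperplane belonging to a set I gives functionals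
  whose values on words with letters J are triangular with respect to inclusion of J in I. The
  inequality is strict as soon as there is a further spike (d = 1 and k > 3, or k > 5), or, for
  1 < d <= k and k > 3, because a set of d letters already contributes a functional of the second
  kind.
\<close>

text \<open>Everything hinges on when \<open>vprod S * y ^ 2\<close> is hit. As y^2 is a top square
  of y, moving the square across with the Cartan formula succeeds unless deg y + card S is a sum of
  card S powers of two. In degree k - 1 with k = 4, 5 the obstruction is real: x^3 and x^3 y are
  spikes, and spikes are never hit. So for k = 4, 5 words can only be peeled off down to degree k -
  1, whereas for k = 3 they reach degree 0. This also explains c(k,d). A word of length d applied to
  1 has at most d letters, which gives the first sum. A word of length d - 1 applied to a monomial
  of degree k - 1 has at most d - 1 letters. The product of k - 1 variables is K(i) 1 and belongs to
  the first kind; with h = k - 1 there remain (h - 2) binom(h + 1, 2) monomials in h variables,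
  which gives the second sum. For d > k the bounds on the number of letters are void, and d - 1
  \<ge> k letters are what the reduction to k - 1 variables consumes.\<close>

abbreviation lkp where "lkp \<equiv> Poly_Mapping.lookup"
abbreviation supp where "supp \<equiv> Poly_Mapping.keys"
abbreviation mon :: "mono \<Rightarrow> poly2" where "mon m \<equiv> Poly_Mapping.single m 1"

section \<open>Polynomials over the field with two elements\<close>

definition var :: "nat \<Rightarrow> poly2" where "var i = mon (Poly_Mapping.single i 1)"

lemma bit_add_self [simp]: "(c :: bit) + c = 0"
  by (cases c) auto

lemma poly2_add_self [simp]: "(f :: poly2) + f = 0"
  by (rule poly_mapping_eqI) (simp only: lookup_add lookup_zero bit_add_self)

lemma poly2_two [simp]: "(2 :: poly2) = 0"
  by (simp only: one_add_one[symmetric] poly2_add_self)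

lemma poly2_add_self_left [simp]: "(f :: poly2) + (f + g) = g"
  by (simp flip: add.assoc)

lemma poly2_minus: "(f :: poly2) - g = f + g"
  by (rule poly_mapping_eqI) (simp add: lookup_minus lookup_add)

lemma scale2_conv_mult: "scale2 c p = Poly_Mapping.single 0 c * p"
  unfolding scale2_def by (rule mult_map_scale_conv_mult)

lemma scale2_simps [simp]: "scale2 0 p = 0" "scale2 1 p = p"
  by (simp_all only: scale2_conv_mult single_zero single_one mult_zero_left mult_1)

interpretation v2: vector_space scale2
proof
  fix a b :: bit and x y :: poly2
  show "scale2 a (x + y) = scale2 a x + scale2 a y" by (cases a) auto
  show "scale2 (a + b) x = scale2 a x + scale2 b x" by (cases a; cases b) auto
  show "scale2 a (scale2 b x) = scale2 (a * b) x" by (cases a; cases b) auto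
  show "scale2 1 x = x" by auto
qed

lemma subspace2I:
  assumes "0 \<in> S" "\<And>x y. x \<in> S \<Longrightarrow> y \<in> S \<Longrightarrow> x + y \<in> S"
  shows "v2.subspace S"
  unfolding v2.subspace_def
proof (intro conjI ballI allI)
  fix c x assume "x \<in> S" then show "scale2 c x \<in> S" using assms(1) by (cases c) auto
qed (use assms in auto)

lemma poly2_as_sum: "(f :: poly2) = (\<Sum>m\<in>supp f. mon m)"
proof (rule poly_mapping_eqI)
  fix m
  have "lkp (\<Sum>m\<in>supp f. mon m) m = (\<Sum>m'\<in>supp f. if m' = m then 1 else 0)"
    by (auto simp: lookup_sum lookup_single when_def intro!: sum.cong)
  also have "\<dots> = lkp f m"
    by (auto simp: sum.delta in_keys_iff) 
  finally show "lkp f m = lkp (\<Sum>m\<in>supp f. mon m) m" by simp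
qed

lemma poly2_induct [case_names zero mon add]:
  assumes "P 0" "\<And>m. P (mon m)" "\<And>f g. P f \<Longrightarrow> P g \<Longrightarrow> P (f + g)"
  shows "P (f :: poly2)"
proof -
  have "P (\<Sum>m\<in>F. mon m)" if "finite F" for F
    using that by induction (auto intro: assms)
  then show ?thesis using poly2_as_sum[of f] by (metis finite_keys)
qed

lemma mon_mult: "mon a * mon b = mon (a + b)"
  by (simp add: mult_single)

lemma mon_zero: "mon 0 = 1"
  by simp

lemma mon_sum: "finite F \<Longrightarrow> mon (\<Sum>i\<in>F. g i) = (\<Prod>i\<in>F. mon (g i))"
  by (induction F rule: finite_induct) (auto simp: mon_mult[symmetric])

lemma var_pow: "var i ^ n = mon (Poly_Mapping.single i n)"
  by (induction n) (auto simp: var_def mon_mult simp flip: single_add)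

lemma mono_as_sum: "(m :: mono) = (\<Sum>i\<in>supp m. Poly_Mapping.single i (lkp m i))"
proof (rule poly_mapping_eqI)
  fix j
  have "lkp (\<Sum>i\<in>supp m. Poly_Mapping.single i (lkp m i)) j = (\<Sum>i\<in>supp m. if i = j then lkp m i else 0)"
    by (auto simp: lookup_sum lookup_single when_def intro!: sum.cong)
  also have "\<dots> = lkp m j"
    by (auto simp: sum.delta in_keys_iff)
  finally show "lkp m j = lkp (\<Sum>i\<in>supp m. Poly_Mapping.single i (lkp m i)) j" by simp
qed

section \<open>Evaluation homomorphisms\<close>

definition evm :: "(nat \<Rightarrow> 'r::comm_ring_1) \<Rightarrow> mono \<Rightarrow> 'r" where
  "evm A m = (\<Prod>i\<in>supp m. A i ^ lkp m i)"

text \<open>The target ring is arbitrary so that one construction yields both the total square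
  (target \<open>poly2 poly\<close>) and substitutions (target \<open>poly2\<close>). Coefficients
  are dropped because a nonzero \<open>bit\<close> is 1; additivity therefore depends on 2 = 0 in
  the target.\<close>

definition ev :: "(nat \<Rightarrow> 'r::comm_ring_1) \<Rightarrow> poly2 \<Rightarrow> 'r" where
  "ev A f = (\<Sum>m\<in>supp f. evm A m)"

lemma mon_eq_evm: "mon m = evm var m"
proof -
  have "mon m = mon (\<Sum>i\<in>supp m. Poly_Mapping.single i (lkp m i))"
    by (subst mono_as_sum) simp
  then show ?thesis by (simp add: mon_sum evm_def var_pow)
qed

lemma evm_superset: "finite F \<Longrightarrow> supp m \<subseteq> F \<Longrightarrow> evm A m = (\<Prod>i\<in>F. A i ^ lkp m i)"
  unfolding evm_def by (rule prod.mono_neutral_left) (auto simp: in_keys_iff)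

lemma evm_zero [simp]: "evm A 0 = 1"
  by (simp add: evm_def)

lemma evm_add: "evm A (m + m') = evm A m * evm A m'"
proof -
  let ?F = "supp m \<union> supp m'"
  have "supp (m + m') \<subseteq> ?F" by (rule keys_add)
  then show ?thesis
    by (simp add: evm_superset[of ?F] lookup_add power_add prod.distrib)
qed

lemma ev_zero [simp]: "ev A 0 = 0"
  by (simp add: ev_def)

lemma ev_mon [simp]: "ev A (mon m) = evm A m"
  by (simp add: ev_def)

lemma ev_one [simp]: "ev A 1 = 1"
  by (metis ev_mon evm_zero mon_zero)

lemma ev_var [simp]: "ev A (var i) = A i"
  by (simp add: var_def evm_def)

lemma char2_add_self: "(2 :: 'r::comm_ring_1) = 0 \<Longrightarrow> (x::'r) + x = 0"
  by (simp flip: mult_2)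

lemma ev_add:
  assumes "(2 :: 'r::comm_ring_1) = 0"
  shows "ev (A :: nat \<Rightarrow> 'r) (f + g) = ev A f + ev A g"
proof -
  \<comment> \<open>\<open>b\<close> embeds F_2 into the target; it is additive because the target
    has characteristic two.\<close>
  define b where "b c = (if c = (0::bit) then 0 else (1::'r))" for c
  have b: "b (c + d) = b c + b d" for c d
    by (cases c; cases d) (auto simp: b_def char2_add_self[OF assms] simp del: one_add_one)
  have *: "ev A h = (\<Sum>m\<in>F. b (lkp h m) * evm A m)" if "finite F" "supp h \<subseteq> F" for F h
    unfolding ev_def using that
    by (intro sum.mono_neutral_cong_left) (auto simp: in_keys_iff b_def)
  let ?F = "supp f \<union> supp g"
  have "supp (f + g) \<subseteq> ?F" by (rule keys_add)
  then show ?thesis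
    by (simp only: *[of ?F] lookup_add b sum.distrib distrib_right finite_UnI finite_keys Un_upper1 Un_upper2)
qed

lemma ev_mult:
  assumes "(2 :: 'r::comm_ring_1) = 0"
  shows "ev (A :: nat \<Rightarrow> 'r) (f * g) = ev A f * ev A g"
proof (induction f rule: poly2_induct)
  case (mon m)
  show ?case
    by (induction g rule: poly2_induct)
      (auto simp: mon_mult evm_add ring_distribs ev_add[OF assms])
qed (auto simp: ev_add[OF assms] ring_distribs)

lemma ev_sum:
  assumes "(2 :: 'r::comm_ring_1) = 0"
  shows "ev (A :: nat \<Rightarrow> 'r) (\<Sum>i\<in>F. g i) = (\<Sum>i\<in>F. ev A (g i))"
  by (induction F rule: infinite_finite_induct) (auto simp: ev_add[OF assms])

lemma ev_prod:
  assumes "(2 :: 'r::comm_ring_1) = 0"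
  shows "ev (A :: nat \<Rightarrow> 'r) (\<Prod>i\<in>F. g i) = (\<Prod>i\<in>F. ev A (g i))"
  by (induction F rule: infinite_finite_induct) (auto simp: ev_mult[OF assms])

lemma ev_pow:
  assumes "(2 :: 'r::comm_ring_1) = 0"
  shows "ev (A :: nat \<Rightarrow> 'r) (f ^ n) = ev A f ^ n"
  by (induction n) (auto simp: ev_mult[OF assms])

lemma hom_evm:
  assumes "h 1 = 1" "\<And>f g. h (f * g) = h f * h g"
  shows "h (mon m) = evm (\<lambda>i. h (var i)) m"
proof -
  have p: "h (x ^ n) = h x ^ n" for x n by (induction n) (auto simp: assms)
  have "h (\<Prod>i\<in>F. g i) = (\<Prod>i\<in>F. h (g i))" for F :: "nat set" and g
    by (induction F rule: infinite_finite_induct) (auto simp: assms)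
  then show ?thesis unfolding mon_eq_evm evm_def by (simp add: p)
qed

text \<open>Serves to check identities between composite maps, such as \<open>total_Sq\<close> after
  \<open>ev\<close>, on the variables alone.\<close>

lemma hom_unique:
  assumes "h 0 = 0" "h 1 = 1" "\<And>f g. h (f * g) = h f * h g" "\<And>f g. h (f + g) = h f + h g"
  assumes "h' 0 = 0" "h' 1 = 1" "\<And>f g. h' (f * g) = h' f * h' g" "\<And>f g. h' (f + g) = h' f + h' g"
  assumes "\<And>i. h (var i) = h' (var i)"
  shows "h f = (h' f :: 'r::comm_ring_1)"
proof (induction f rule: poly2_induct)
  case (mon m)
  show ?case using hom_evm[of h m] hom_evm[of h' m] assms by simp
qed (auto simp: assms)

lemma ev_var_id [simp]: "ev var f = f"
  by (rule hom_unique[of "ev var" "\<lambda>f. f"]) (auto simp: ev_add ev_mult)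

lemma ev_ev:
  assumes "(2 :: 'r::comm_ring_1) = 0"
  shows "ev (A :: nat \<Rightarrow> 'r) (ev B f) = ev (\<lambda>i. ev A (B i)) f"
  by (rule hom_unique[of "\<lambda>f. ev A (ev B f)"]) (auto simp: ev_add ev_mult assms)

lemma poly2_square_add: "((f::poly2) + g) ^ 2 = f ^ 2 + g ^ 2"
  by (simp add: power2_eq_square algebra_simps)

lemma poly2_square_sum: "(\<Sum>i\<in>F. (g i :: poly2)) ^ 2 = (\<Sum>i\<in>F. g i ^ 2)"
  by (induction F rule: infinite_finite_induct) (auto simp: poly2_square_add)

section \<open>The total Steenrod square\<close>

text \<open>The power of the indeterminate t records the index of the square: a variable x goes to x
  + x^2 t, and multiplicativity is the Cartan formula.\<close>

definition total_Sq :: "poly2 \<Rightarrow> poly2 poly" where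
  "total_Sq = ev (\<lambda>i. [:var i, var i ^ 2:])"

lemma poly2_poly_two [simp]: "(2 :: poly2 poly) = 0"
  by (simp only: one_add_one[symmetric]) (simp add: one_pCons del: one_add_one)

lemma total_Sq_add: "total_Sq (f + g) = total_Sq f + total_Sq g"
  and total_Sq_mult: "total_Sq (f * g) = total_Sq f * total_Sq g"
  and total_Sq_zero [simp]: "total_Sq 0 = 0" and total_Sq_one [simp]: "total_Sq 1 = 1"
  and total_Sq_var [simp]: "total_Sq (var i) = [:var i, var i ^ 2:]"
  by (auto simp: total_Sq_def ev_add ev_mult poly2_poly_two)

lemma total_Sq_pow: "total_Sq (f ^ n) = total_Sq f ^ n"
  and total_Sq_sum: "total_Sq (\<Sum>i\<in>F. g i) = (\<Sum>i\<in>F. total_Sq (g i))"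
  and total_Sq_prod: "total_Sq (\<Prod>i\<in>F. g i) = (\<Prod>i\<in>F. total_Sq (g i))"
  by (auto simp: total_Sq_def ev_pow ev_sum ev_prod poly2_poly_two)

lemma mdeg_superset: "finite F \<Longrightarrow> supp m \<subseteq> F \<Longrightarrow> mdeg m = (\<Sum>i\<in>F. lkp m i)"
  unfolding mdeg_def by (rule sum.mono_neutral_left) (auto simp: in_keys_iff)

lemma mdeg_add: "mdeg (m + m') = mdeg m + mdeg m'"
proof -
  let ?F = "supp m \<union> supp m'"
  have "supp (m + m') \<subseteq> ?F" by (rule keys_add)
  then show ?thesis
    by (simp add: mdeg_superset[of ?F] lookup_add sum.distrib)
qed

lemma mdeg_single [simp]: "mdeg (Poly_Mapping.single i n) = n"
  by (simp add: mdeg_def)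

lemma mdeg_zero [simp]: "mdeg 0 = 0"
  by (simp add: mdeg_def)

lemma var_pow_linear_total_Sq:
  "[:var i, var i ^ 2:] ^ n =
     (\<Sum>b\<le>n. monom (mon (Poly_Mapping.single i (n + b)) * of_nat (n choose b)) b)"
proof -
  have e: "[:var i, var i ^ 2:] = monom (var i ^ 2) 1 + [:var i:]"
    by (simp add: monom_Suc monom_0)
  have "[:var i, var i ^ 2:] ^ n =
     (\<Sum>b\<le>n. of_nat (n choose b) * monom (var i ^ 2) 1 ^ b * [:var i:] ^ (n - b))"
    unfolding e by (rule binomial_ring)
  also have "\<dots> = (\<Sum>b\<le>n. monom (mon (Poly_Mapping.single i (n + b)) * of_nat (n choose b)) b)"
  proof (rule sum.cong[OF refl])
    fix b assume "b \<in> {..n}"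
    then have b: "b \<le> n" by simp
    have v0: "var i ^ (2 * b) * var i ^ (n - b) = var i ^ (n + b)"
      using b by (simp add: add.commute flip: power_add)
    have v: "(var i ^ 2) ^ b * var i ^ (n - b) = mon (Poly_Mapping.single i (n + b))"
      by (metis v0 power_mult var_pow)
    have "of_nat (n choose b) * monom (var i ^ 2) 1 ^ b * [:var i:] ^ (n - b)
        = monom (of_nat (n choose b) * ((var i ^ 2) ^ b * var i ^ (n - b))) b"
      by (simp only: monom_power monom_0[symmetric] of_nat_monom mult_monom power_one_right
          mult_1 add_0 add_0_right mult.assoc mult_zero_left)
    then show "of_nat (n choose b) * monom (var i ^ 2) 1 ^ b * [:var i:] ^ (n - b)
        = monom (mon (Poly_Mapping.single i (n + b)) * of_nat (n choose b)) b"
      unfolding v by (simp only: mult.commute)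
  qed
  finally show ?thesis .
qed


text \<open>Choosing one term of the binomial expansion in each variable amounts to choosing the
  exponent vector \<open>e\<close> in \<open>Sq_mono\<close>. This ties the explicit sums of the
  definition to a ring homomorphism.\<close>

lemma coeff_total_Sq_mon: "coeff (total_Sq (mon m)) i = Sq_mono i m"
proof -
  let ?S = "supp m"
  let ?c = "\<lambda>j b. mon (Poly_Mapping.single j (lkp m j + b)) * of_nat (lkp m j choose b)"
  let ?P = "PiE ?S (\<lambda>j. {..lkp m j})"
  let ?h = "\<lambda>g. \<Sum>j\<in>?S. Poly_Mapping.single j (g j)"
  have h: "lkp (?h g) l = (if l \<in> ?S then g l else 0)" for g :: "nat \<Rightarrow> nat" and l
    by (simp add: lookup_sum lookup_single when_def sum.delta)
  let ?E = "{e. supp e \<subseteq> supp m \<and> (\<forall>j. lkp e j \<le> lkp m j) \<and> mdeg e = i}"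
  have fP: "finite ?P" by (intro finite_PiE) auto
  have prod_monom: "(\<Prod>j\<in>F. monom (c j) (g j)) = monom (prod c F) (sum g F)"
    for F :: "nat set" and c :: "nat \<Rightarrow> poly2" and g
    by (induction F rule: infinite_finite_induct) (auto simp: mult_monom monom_0 one_pCons)
  have "total_Sq (mon m) = (\<Prod>j\<in>?S. \<Sum>b\<in>{..lkp m j}. monom (?c j b) b)"
    by (simp add: total_Sq_def evm_def var_pow_linear_total_Sq)
  also have "\<dots> = (\<Sum>g\<in>?P. \<Prod>j\<in>?S. monom (?c j (g j)) (g j))"
    by (rule prod_sum_PiE) auto
  also have "\<dots> = (\<Sum>g\<in>?P. monom (\<Prod>j\<in>?S. ?c j (g j)) (\<Sum>j\<in>?S. g j))"
    by (simp only: prod_monom)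
  finally have "coeff (total_Sq (mon m)) i =
      (\<Sum>g\<in>?P. if (\<Sum>j\<in>?S. g j) = i then \<Prod>j\<in>?S. ?c j (g j) else 0)"
    by (simp add: coeff_sum)
  also have "\<dots> = (\<Sum>g\<in>{g\<in>?P. (\<Sum>j\<in>?S. g j) = i}. \<Prod>j\<in>?S. ?c j (g j))"
    using fP by (intro sum.inter_filter[symmetric]) auto
  also have "\<dots> = (\<Sum>e\<in>?E. \<Prod>j\<in>?S. ?c j (lkp e j))"
  proof (rule sum.reindex_bij_witness)
    let ?f = "\<lambda>e. restrict (lkp e) ?S"
    show "?f (?h g) = g" if "g \<in> {g\<in>?P. (\<Sum>j\<in>?S. g j) = i}" for g
      using that by (auto simp: h fun_eq_iff PiE_def extensional_def restrict_def)
    show "?h g \<in> ?E" if "g \<in> {g\<in>?P. (\<Sum>j\<in>?S. g j) = i}" for g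
    proof -
      have sub: "supp (?h g) \<subseteq> ?S"
        by (metis (mono_tags, lifting) h in_keys_iff subsetI)
      moreover have "mdeg (?h g) = i"
        using that by (simp add: mdeg_superset[OF _ sub] h)
      moreover have "lkp (?h g) l \<le> lkp m l" for l
        using that unfolding h by (auto simp: PiE_def)
      ultimately show ?thesis by blast
    qed
    show "?h (?f e) = e" if "e \<in> ?E" for e
      using that by (intro poly_mapping_eqI) (auto simp: h in_keys_iff)
    show "?f e \<in> {g\<in>?P. (\<Sum>j\<in>?S. g j) = i}" if "e \<in> ?E" for e
      using that by (auto simp: mdeg_superset[of ?S e])
  qed (auto intro!: prod.cong simp: h)
  also have "\<dots> = Sq_mono i m"
    unfolding Sq_mono_def
  proof (rule sum.cong[OF refl])
    fix e assume e: "e \<in> ?E"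
    have "m + e = (\<Sum>j\<in>?S. Poly_Mapping.single j (lkp m j + lkp e j))"
      using e by (intro poly_mapping_eqI)
        (auto simp: lookup_add lookup_sum lookup_single when_def sum.delta in_keys_iff)
    then have "(\<Prod>j\<in>?S. ?c j (lkp e j)) = mon (m + e) * of_nat (\<Prod>j\<in>?S. lkp m j choose lkp e j)"
      by (simp add: prod.distrib mon_sum)
    also have "\<dots> = Poly_Mapping.single (m + e) (\<Prod>j\<in>?S. of_nat (lkp m j choose lkp e j))"
      by (simp only: of_nat_prod[symmetric] single_of_nat[symmetric] mult_single mult_1 add_0_right)
    finally show "(\<Prod>j\<in>?S. ?c j (lkp e j))
        = Poly_Mapping.single (m + e) (\<Prod>j\<in>?S. of_nat (lkp m j choose lkp e j))" .
  qed
  finally show ?thesis .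
qed

lemma Sq_eq_coeff_total_Sq: "Sq i f = coeff (total_Sq f) i"
proof -
  have "Sq i f = (\<Sum>m\<in>supp f. Sq_mono i m)"
    unfolding Sq_def
  proof (rule sum.cong[OF refl])
    fix m assume "m \<in> supp f"
    then have "lkp f m = 1" by (simp add: in_keys_iff)
    then show "scale2 (lkp f m) (Sq_mono i m) = Sq_mono i m" by simp
  qed
  also have "\<dots> = coeff (\<Sum>m\<in>supp f. total_Sq (mon m)) i"
    by (simp add: coeff_sum coeff_total_Sq_mon)
  also have "\<dots> = coeff (total_Sq f) i"
    using poly2_as_sum[of f] by (metis total_Sq_sum)
  finally show ?thesis .
qed

lemma Sq_add: "Sq i (f + g) = Sq i f + Sq i g"
  by (simp add: Sq_eq_coeff_total_Sq total_Sq_add)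

lemma Sq_zero [simp]: "Sq i 0 = 0"
  by (simp add: Sq_eq_coeff_total_Sq)

lemma Sq_mon: "Sq i (mon m) = Sq_mono i m"
  by (simp add: Sq_eq_coeff_total_Sq coeff_total_Sq_mon)

lemma Sq_0 [simp]: "Sq 0 f = f"
proof -
  have "coeff (total_Sq f) 0 = f"
    by (rule hom_unique[of "\<lambda>f. coeff (total_Sq f) 0" "\<lambda>f. f"])
      (simp_all add: total_Sq_add total_Sq_mult coeff_mult_0)
  then show ?thesis by (simp add: Sq_eq_coeff_total_Sq)
qed

lemma Sq_1_mult: "Sq 1 (f * g) = Sq 1 f * g + f * Sq 1 g"
proof -
  have "Sq 1 (f * g) = Sq 0 f * Sq 1 g + Sq 1 f * Sq 0 g"
    by (simp only: Sq_eq_coeff_total_Sq total_Sq_mult) (simp add: coeff_mult)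
  then show ?thesis by simp
qed

lemma Sq_1_var: "Sq 1 (var i) = var i ^ 2"
  by (simp add: Sq_eq_coeff_total_Sq)

lemma Sq_1_square: "Sq 1 (f ^ 2) = 0"
  by (simp only: power2_eq_square Sq_1_mult mult.commute[of f "Sq 1 f"] poly2_add_self)

text \<open>Frobenius in characteristic two: the cross terms cancel in pairs, so the coefficients
  are squared and spread to the even positions.\<close>

lemma coeff_square:
  fixes p :: "poly2 poly"
  shows "coeff (p ^ 2) n = (if even n then coeff p (n div 2) ^ 2 else 0)"
proof (induction p arbitrary: n)
  case (pCons a p)
  have two: "(q :: poly2 poly) + q = 0" for q by (simp flip: mult_2)
  have "pCons a p ^ 2 = smult a (pCons a p) + pCons 0 (p * pCons a p)"
    by (simp add: power2_eq_square)
  also have "p * pCons a p = smult a p + pCons 0 (p ^ 2)"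
    by (simp add: power2_eq_square)
  also have "smult a (pCons a p) + pCons 0 (smult a p + pCons 0 (p ^ 2))
      = pCons (a ^ 2) (smult a p + smult a p + pCons 0 (p ^ 2))"
    by (simp add: power2_eq_square add.assoc)
  finally have e: "pCons a p ^ 2 = pCons (a ^ 2) (pCons 0 (p ^ 2))"
    by (simp only: two add_0)
  show ?case
  proof (cases n)
    case (Suc n')
    then show ?thesis unfolding e
      by (cases n') (auto simp: pCons.IH coeff_pCons)
  qed (simp add: e)
qed (simp add: power2_eq_square)

lemma Sq_square: "Sq n (f ^ 2) = (if even n then Sq (n div 2) f ^ 2 else 0)"
  by (simp only: Sq_eq_coeff_total_Sq total_Sq_pow coeff_square)

section \<open>Homogeneous polynomials\<close>

lemma Pk_deg_iff: "f \<in> Pk_deg k n \<longleftrightarrow> (\<forall>m\<in>supp f. supp m \<subseteq> {..<k} \<and> mdeg m = n)"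
  by (auto simp: Pk_deg_def Pk_def)

lemma Pk_deg_zero [simp]: "0 \<in> Pk_deg k n"
  by (simp add: Pk_deg_iff)

lemma Pk_deg_add: "f \<in> Pk_deg k n \<Longrightarrow> g \<in> Pk_deg k n \<Longrightarrow> f + g \<in> Pk_deg k n"
  using keys_add[of f g] by (auto simp: Pk_deg_iff)

lemma Pk_deg_sum: "(\<And>i. i \<in> F \<Longrightarrow> g i \<in> Pk_deg k n) \<Longrightarrow> (\<Sum>i\<in>F. g i) \<in> Pk_deg k n"
  by (induction F rule: infinite_finite_induct) (auto intro: Pk_deg_add)

lemma subspace_Pk_deg: "v2.subspace (Pk_deg k n)"
  by (rule subspace2I) (auto intro: Pk_deg_add)

lemma Pk_deg_mon_iff [simp]: "mon m \<in> Pk_deg k n \<longleftrightarrow> supp m \<subseteq> {..<k} \<and> mdeg m = n"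
  by (simp add: Pk_deg_iff)

lemma Pk_deg_one [simp]: "1 \<in> Pk_deg k 0"
  by (simp add: Pk_deg_iff)

lemma Pk_deg_var [simp]: "i < k \<Longrightarrow> var i \<in> Pk_deg k 1"
  by (simp add: var_def)

lemma Pk_deg_mult:
  assumes "f \<in> Pk_deg k a" "g \<in> Pk_deg k b"
  shows "f * g \<in> Pk_deg k (a + b)"
  unfolding Pk_deg_iff
proof
  fix m assume "m \<in> supp (f * g)"
  then obtain p q where "m = p + q" "p \<in> supp f" "q \<in> supp g"
    using keys_mult[of f g] by blast
  then show "supp m \<subseteq> {..<k} \<and> mdeg m = a + b"
    using assms keys_add[of p q] by (fastforce simp: Pk_deg_iff mdeg_add)
qed

lemma Pk_deg_pow: "f \<in> Pk_deg k a \<Longrightarrow> f ^ n \<in> Pk_deg k (n * a)"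
  by (induction n) (auto intro: Pk_deg_mult)

lemma Pk_deg_induct [consumes 1, case_names zero mon add]:
  assumes "f \<in> Pk_deg k n" "P 0"
    and "\<And>m. mon m \<in> Pk_deg k n \<Longrightarrow> P (mon m)"
    and "\<And>f g. f \<in> Pk_deg k n \<Longrightarrow> g \<in> Pk_deg k n \<Longrightarrow> P f \<Longrightarrow> P g \<Longrightarrow> P (f + g)"
  shows "P f"
proof -
  have "P (\<Sum>m\<in>F. mon m)" if "finite F" "\<forall>m\<in>F. mon m \<in> Pk_deg k n" for F
    using that by induction (auto intro!: assms Pk_deg_sum simp del: Pk_deg_mon_iff)
  moreover have "\<forall>m\<in>supp f. mon m \<in> Pk_deg k n"
    using assms(1) by (auto simp: Pk_deg_iff)
  ultimately show ?thesis using poly2_as_sum[of f] by (metis finite_keys)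
qed

lemma Pk_deg_Sq:
  assumes "f \<in> Pk_deg k n"
  shows "Sq i f \<in> Pk_deg k (n + i)"
  using assms
proof (induction rule: Pk_deg_induct)
  case (mon m)
  have "Poly_Mapping.single (m + e) c \<in> Pk_deg k (n + i)"
    if "supp e \<subseteq> supp m" "mdeg e = i" for e c
    using that mon keys_add[of m e] by (auto simp: Pk_deg_iff mdeg_add split: if_splits)
  then show ?case
    unfolding Sq_mon Sq_mono_def by (intro Pk_deg_sum) blast
qed (auto simp: Sq_add intro: Pk_deg_add)

text \<open>An exponent vector \<open>e\<close> below \<open>m\<close> in every variable with the
  same total degree equals \<open>m\<close>, so a single summand survives, with all binomial
  coefficients 1.\<close>

lemma Sq_top:
  assumes "f \<in> Pk_deg k n"
  shows "Sq n f = f ^ 2"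
  using assms
proof (induction rule: Pk_deg_induct)
  case (mon m)
  have "{e. supp e \<subseteq> supp m \<and> (\<forall>j. lkp e j \<le> lkp m j) \<and> mdeg e = n} = {m}" (is "?E = _")
  proof -
    have "e = m" if "e \<in> ?E" for e
    proof (rule poly_mapping_eqI, rule ccontr)
      fix l assume l: "lkp e l \<noteq> lkp m l"
      then have "l \<in> supp m" using that by (metis (mono_tags, lifting) in_keys_iff le_zero_eq mem_Collect_eq)
      then have "(\<Sum>j\<in>supp m. lkp e j) < (\<Sum>j\<in>supp m. lkp m j)"
        using that l by (intro sum_strict_mono_ex1) (auto simp: le_less)
      moreover have "mdeg e = (\<Sum>j\<in>supp m. lkp e j)" "mdeg m = (\<Sum>j\<in>supp m. lkp m j)"
        using that by (auto intro!: mdeg_superset)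
      ultimately show False using that mon by simp
    qed
    then show ?thesis using mon by auto
  qed
  then show ?case
    by (simp add: Sq_mon Sq_mono_def power2_eq_square mon_mult)
qed (auto simp: Sq_add poly2_square_add)

section \<open>Hit polynomials in a fixed degree\<close>

text \<open>
  Spanned by homogeneous generators only, so that no homogeneous components of elements of hit
  have to be extracted. Only the inclusion into hit is needed.
\<close>

definition hit_deg :: "nat \<Rightarrow> nat \<Rightarrow> poly2 set" where
  "hit_deg k n = v2.span {Sq i g | i g n'. 0 < i \<and> g \<in> Pk_deg k n' \<and> n' + i = n}"

lemma hit_deg_Sq: "0 < i \<Longrightarrow> g \<in> Pk_deg k n' \<Longrightarrow> n' + i = n \<Longrightarrow> Sq i g \<in> hit_deg k n"
  unfolding hit_deg_def by (rule v2.span_base) blast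

lemma hit_deg_zero [simp]: "0 \<in> hit_deg k n"
  unfolding hit_deg_def by (rule v2.span_zero)

lemma hit_deg_add: "f \<in> hit_deg k n \<Longrightarrow> g \<in> hit_deg k n \<Longrightarrow> f + g \<in> hit_deg k n"
  unfolding hit_deg_def by (rule v2.span_add)

lemma hit_deg_sum: "(\<And>i. i \<in> F \<Longrightarrow> g i \<in> hit_deg k n) \<Longrightarrow> (\<Sum>i\<in>F. g i) \<in> hit_deg k n"
  by (induction F rule: infinite_finite_induct) (auto intro: hit_deg_add)

text \<open>In characteristic two \<open>f + g \<in> hit_deg k n\<close> expresses that f and g are
  congruent modulo hit polynomials. Congruences are written in this form throughout; this is their
  transitivity.\<close>

lemma hit_deg_trans: "f + g \<in> hit_deg k n \<Longrightarrow> g + h \<in> hit_deg k n \<Longrightarrow> f + h \<in> hit_deg k n"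
  using hit_deg_add[of "f + g" k n "g + h"] by (simp add: add.assoc)

lemma hit_deg_cancel: "f + g \<in> hit_deg k n \<Longrightarrow> g \<in> hit_deg k n \<Longrightarrow> f \<in> hit_deg k n"
  using hit_deg_add[of "f + g" k n g] by (simp add: add.assoc)

lemma hit_deg_subset: "hit_deg k n \<subseteq> Pk_deg k n \<inter> hit k"
proof -
  have "hit_deg k n \<subseteq> Pk_deg k n"
    unfolding hit_deg_def by (rule v2.span_minimal[OF _ subspace_Pk_deg]) (auto intro: Pk_deg_Sq)
  moreover have "hit_deg k n \<subseteq> hit k"
    unfolding hit_deg_def hit_def by (rule v2.span_mono) (auto simp: Pk_deg_def)
  ultimately show ?thesis by blast
qed

section \<open>Products of variables and a criterion for being hit\<close>

definition vprod :: "nat set \<Rightarrow> poly2" where "vprod S = (\<Prod>i\<in>S. var i)"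

lemma Pk_deg_prod:
  "(\<And>i. i \<in> S \<Longrightarrow> f i \<in> Pk_deg k (d i)) \<Longrightarrow> finite S \<Longrightarrow> (\<Prod>i\<in>S. f i) \<in> Pk_deg k (\<Sum>i\<in>S. d i)"
  by (induction S rule: infinite_finite_induct) (auto intro: Pk_deg_mult)

lemma Pk_deg_vprod: "S \<subseteq> {..<k} \<Longrightarrow> vprod S \<in> Pk_deg k (card S)"
  using Pk_deg_prod[of S var k "\<lambda>_. 1"] finite_subset[of S "{..<k}"] Pk_deg_var[of _ k]
  by (auto simp: vprod_def subset_iff)

lemma vprod_remove: "finite S \<Longrightarrow> i \<in> S \<Longrightarrow> vprod S = var i * vprod (S - {i})"
  unfolding vprod_def by (rule prod.remove)

text \<open>The total square of x^(2^a) has only two terms, so each factor either stays or doubles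
  its exponent. Products of this shape are therefore closed under the Cartan expansion.\<close>

definition vprod_pow2 :: "(nat \<Rightarrow> nat) \<Rightarrow> nat set \<Rightarrow> poly2" where
  "vprod_pow2 a S = (\<Prod>i\<in>S. var i ^ (2 ^ a i))"

lemma vprod_pow2_0: "vprod_pow2 (\<lambda>_. 0) S = vprod S"
  by (simp add: vprod_pow2_def vprod_def)

lemma Pk_deg_vprod_pow2: "S \<subseteq> {..<k} \<Longrightarrow> vprod_pow2 a S \<in> Pk_deg k (\<Sum>i\<in>S. 2 ^ a i)"
  unfolding vprod_pow2_def using Pk_deg_pow[OF Pk_deg_var] finite_subset[of S "{..<k}"]
  by (intro Pk_deg_prod) auto

lemma poly2_poly_square_add: "((p :: poly2 poly) + q) ^ 2 = p ^ 2 + q ^ 2"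
  by (simp add: power2_sum)

lemma total_Sq_var_pow: "total_Sq (var i ^ (2 ^ a)) = [:var i ^ 2 ^ a:] + monom (var i ^ 2 ^ Suc a) (2 ^ a)"
proof (induction a)
  case 0
  show ?case by (simp add: monom_Suc monom_0)
next
  case (Suc a)
  have "total_Sq (var i ^ (2 ^ Suc a)) = (total_Sq (var i ^ 2 ^ a)) ^ 2"
    by (simp add: power_mult mult.commute[of 2] flip: total_Sq_pow)
  also have "\<dots> = [:var i ^ 2 ^ Suc a:] + monom (var i ^ 2 ^ Suc (Suc a)) (2 ^ Suc a)"
    unfolding Suc poly2_poly_square_add
    by (simp add: poly_const_pow monom_power power_mult mult.commute flip: power_mult)
  finally show ?case .
qed

lemma total_Sq_vprod_pow2:
  assumes "finite S"
  shows "total_Sq (vprod_pow2 a S) =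
    (\<Sum>T\<in>Pow S. monom (vprod_pow2 (\<lambda>i. if i \<in> T then Suc (a i) else a i) S) (\<Sum>i\<in>T. 2 ^ a i))"
proof -
  have pm: "(\<Prod>j\<in>F. monom (c j) (g j)) = monom (prod c F) (sum g F)"
    for F :: "nat set" and c :: "nat \<Rightarrow> poly2" and g
    by (induction F rule: infinite_finite_induct) (auto simp: mult_monom monom_0 one_pCons)
  have "total_Sq (vprod_pow2 a S) = (\<Prod>i\<in>S. monom (var i ^ 2 ^ Suc (a i)) (2 ^ a i) + monom (var i ^ 2 ^ a i) 0)"
    by (simp add: vprod_pow2_def total_Sq_prod total_Sq_var_pow monom_0 add.commute)
  also have "\<dots> = (\<Sum>T\<in>Pow S. (\<Prod>i\<in>T. monom (var i ^ 2 ^ Suc (a i)) (2 ^ a i)) *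
      (\<Prod>i\<in>S - T. monom (var i ^ 2 ^ a i) 0))"
    using assms by (rule prod_add)
  also have "\<dots> = (\<Sum>T\<in>Pow S. monom (vprod_pow2 (\<lambda>i. if i \<in> T then Suc (a i) else a i) S) (\<Sum>i\<in>T. 2 ^ a i))"
  proof (rule sum.cong[OF refl])
    fix T assume "T \<in> Pow S"
    then have "vprod_pow2 (\<lambda>i. if i \<in> T then Suc (a i) else a i) S =
        (\<Prod>i\<in>T. var i ^ 2 ^ Suc (a i)) * (\<Prod>i\<in>S - T. var i ^ 2 ^ a i)"
      using prod.subset_diff[of T S "\<lambda>i. var i ^ 2 ^ (if i \<in> T then Suc (a i) else a i)"] assms
      by (auto simp: vprod_pow2_def mult.commute intro!: arg_cong2[where f = "(*)"] prod.cong)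
    then show "(\<Prod>i\<in>T. monom (var i ^ 2 ^ Suc (a i)) (2 ^ a i)) *
      (\<Prod>i\<in>S - T. monom (var i ^ 2 ^ a i) 0) =
      monom (vprod_pow2 (\<lambda>i. if i \<in> T then Suc (a i) else a i) S) (\<Sum>i\<in>T. 2 ^ a i)"
      by (simp only: pm mult_monom) simp
  qed
  finally show ?thesis .
qed

lemma Sq_vprod_pow2_mult:
  assumes "finite S"
  shows "Sq f (vprod_pow2 a S * v) = (\<Sum>T\<in>Pow S. if (\<Sum>i\<in>T. 2 ^ a i) \<le> f
     then vprod_pow2 (\<lambda>i. if i \<in> T then Suc (a i) else a i) S * Sq (f - (\<Sum>i\<in>T. 2 ^ a i)) v else 0)"
  by (simp add: Sq_eq_coeff_total_Sq total_Sq_mult total_Sq_vprod_pow2[OF assms] sum_distrib_right coeff_sum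
      coeff_monom_mult not_less cong: if_cong)
   (intro sum.cong refl, auto)

text \<open>
  The Cartan formula for Sq f (vprod_pow2 a S * v) trades u Sq f v for terms of the same shape
  with f smaller and the same value of f + deg u. The process could only end in a non-hit term
  at f = 0, when that value is a sum of card S powers of two.
\<close>

lemma vprod_pow2_mult_Sq_hit:
  assumes "S \<subseteq> {..<k}" "v \<in> Pk_deg k e"
    and "\<And>b. f + (\<Sum>i\<in>S. 2 ^ a i) \<noteq> (\<Sum>i\<in>S. 2 ^ b i)"
  shows "vprod_pow2 a S * Sq f v \<in> hit_deg k ((\<Sum>i\<in>S. 2 ^ a i) + e + f)"
  using assms(3)
proof (induction f arbitrary: a rule: less_induct)
  case (less f)
  have fin: "finite S" using assms(1) finite_subset by blast
  \<comment> \<open>For \<open>f = 0\<close> the exponents \<open>a\<close> themselves would be the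
    excluded representation.\<close>
  have f0: "f > 0" using less.prems[of a] by (cases f) auto
  let ?a = "\<lambda>T i. if i \<in> T then Suc (a i) else a i"
  let ?t = "\<lambda>T. if (\<Sum>i\<in>T. 2 ^ a i) \<le> f then vprod_pow2 (?a T) S * Sq (f - (\<Sum>i\<in>T. 2 ^ a i)) v else 0"
  let ?n = "(\<Sum>i\<in>S. 2 ^ a i) + e + f"
  have "?t T \<in> hit_deg k ?n" if T: "T \<in> Pow S - {{}}" for T
  proof (cases "(\<Sum>i\<in>T. 2 ^ a i) \<le> f")
    case True
    let ?s = "\<Sum>i\<in>T. (2::nat) ^ a i"
    have "finite T" "T \<noteq> {}" "T \<subseteq> S" using T fin finite_subset by auto
    then have pos: "?s > 0" by (intro sum_pos) auto
    \<comment> \<open>Doubling the factors in \<open>T\<close> raises the degree of the product by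
      exactly what \<open>f\<close> loses, so the excluded number stays the same in the
      recursion.\<close>
    have sa: "(\<Sum>i\<in>S. 2 ^ ?a T i) = (\<Sum>i\<in>S. (2::nat) ^ a i) + ?s"
    proof -
      have "(\<Sum>i\<in>S. (2::nat) ^ ?a T i) = (\<Sum>i\<in>S. 2 ^ a i + (if i \<in> T then 2 ^ a i else 0))"
        by (rule sum.cong) auto
      also have "\<dots> = (\<Sum>i\<in>S. 2 ^ a i) + (\<Sum>i\<in>S \<inter> T. 2 ^ a i)"
        using fin by (simp add: sum.distrib sum.inter_restrict)
      finally show ?thesis using \<open>T \<subseteq> S\<close> by (simp add: Int_absorb1)
    qed
    have "vprod_pow2 (?a T) S * Sq (f - ?s) v \<in> hit_deg k ((\<Sum>i\<in>S. 2 ^ ?a T i) + e + (f - ?s))"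
    proof (rule less.IH)
      show "f - ?s < f" using f0 pos by simp
      show "f - ?s + (\<Sum>i\<in>S. 2 ^ ?a T i) \<noteq> (\<Sum>i\<in>S. 2 ^ b i)" for b
        using less.prems[of b] True unfolding sa by simp
    qed
    then show ?thesis using True unfolding sa by (simp add: ac_simps)
  qed simp
  then have "(\<Sum>T\<in>Pow S - {{}}. ?t T) \<in> hit_deg k ?n" by (rule hit_deg_sum)
  moreover have "Sq f (vprod_pow2 a S * v) \<in> hit_deg k ?n"
    by (rule hit_deg_Sq[OF f0 Pk_deg_mult[OF Pk_deg_vprod_pow2[OF assms(1)] assms(2)]]) simp
  moreover have "Sq f (vprod_pow2 a S * v) = vprod_pow2 a S * Sq f v + (\<Sum>T\<in>Pow S - {{}}. ?t T)"
    unfolding Sq_vprod_pow2_mult[OF fin] using fin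
    by (subst sum.remove[of _ "{}"]) auto
  ultimately show ?case
    using hit_deg_add[of "Sq f (vprod_pow2 a S * v)" k ?n "(\<Sum>T\<in>Pow S - {{}}. ?t T)"]
    by (simp add: add.assoc)
qed

text \<open>\<open>y\<close> ranges over arbitrary polynomials because the property is also applied
  to terms of a Cartan expansion, where \<open>y\<close> contains a Steenrod square.\<close>

definition low_weight_hit :: "nat \<Rightarrow> nat \<Rightarrow> bool" where
  "low_weight_hit k n \<longleftrightarrow> (\<forall>S y e. S \<subseteq> {..<k} \<and> card S < k - 1 \<and> y \<in> Pk_deg k e \<and> card S + 2 * e = n
     \<longrightarrow> vprod S * y ^ 2 \<in> hit_deg k n)"

text \<open>\<open>y ^ 2\<close> is the top square \<open>Sq e y\<close>, so the preceding criterion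
  applies with all initial exponents 2^0.\<close>

lemma vprod_square_hit:
  assumes "S \<subseteq> {..<k}" "y \<in> Pk_deg k e" "card S + 2 * e = n"
    and "\<And>b. e + card S \<noteq> (\<Sum>i\<in>S. 2 ^ b i)"
  shows "vprod S * y ^ 2 \<in> hit_deg k n"
  using vprod_pow2_mult_Sq_hit[OF assms(1,2), of e "\<lambda>_. 0"] assms(3,4)
  by (simp add: vprod_pow2_0 Sq_top[OF assms(2)] mult_2 add.assoc)

definition ndeg :: "nat \<Rightarrow> nat \<Rightarrow> nat" where "ndeg k j = (k - 1) * (2 ^ j - 1)"

lemma ndeg_0 [simp]: "ndeg k 0 = 0"
  by (simp add: ndeg_def)

lemma two_power_Suc_minus_one: "(2::nat) ^ Suc j - 1 = Suc ((2 ^ j - 1) * 2)"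
proof -
  have "(1::nat) \<le> 2 ^ j" by simp
  then show ?thesis unfolding power_Suc by linarith
qed

lemma ndeg_Suc: "ndeg k (Suc j) = (k - 1) + 2 * ndeg k j"
  unfolding ndeg_def two_power_Suc_minus_one by (simp add: algebra_simps)

lemma not_power_of_two: "odd (n::nat) \<Longrightarrow> n > 1 \<Longrightarrow> n \<noteq> 2 ^ b"
  by (cases b) auto

text \<open>The left side is odd for positive \<open>j\<close>, so one summand is 1 and the other is
  2^j - 2, which is twice an odd number and a power of two only for small \<open>j\<close>.\<close>

lemma odd_not_sum_of_two_powers: 
  assumes "(2::nat) ^ j - 1 = 2 ^ a + 2 ^ b" shows "j \<le> 2"
proof (rule ccontr)
  assume "\<not> j \<le> 2"
  then obtain i where j: "j = Suc (Suc (Suc i))" by (metis add_2_eq_Suc less_imp_Suc_add not_le_imp_less add_Suc_right)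
  have *: False if "(2::nat) ^ j - 1 = 1 + 2 ^ b" for b
  proof (cases b)
    case (Suc b')
    then have "(2::nat) ^ b' = 2 ^ (Suc (Suc i)) - 1" using that j by simp
    moreover have "odd ((2::nat) ^ (Suc (Suc i)) - 1)" "(2::nat) ^ (Suc (Suc i)) - 1 > 1"
      unfolding two_power_Suc_minus_one by auto
    ultimately show False using not_power_of_two by metis
  next
    case 0
    have "(1::nat) \<le> 2 ^ i" by simp
    then show False using that unfolding j 0 power_Suc power_0 by linarith
  qed
  have "odd ((2::nat) ^ j - 1)" using j by simp
  then have "a = 0 \<or> b = 0" using assms by (metis even_add even_power even_numeral neq0_conv)
  then show False using *[of b] *[of a] assms by (auto simp: add.commute)
qed

text \<open>Parity leaves card S = 0, or 1 for k = 4, or 2 for k = 5. An empty sum cannot equal the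
  positive \<open>e\<close>. In the other two cases e + card S is 3 * 2^(j-1) - 1 and 2^(j+1) - 1:
  for j \<ge> 2 these are not sums of one, respectively two, powers of two, while for j = 1 they are
  2 and 3 = 1 + 2.\<close>

lemma low_weight_hit_ndeg:
  assumes "k \<in> {3, 4, 5}" "j \<ge> 1" "k = 3 \<or> j \<ge> 2"
  shows "low_weight_hit k (ndeg k j)"
  unfolding low_weight_hit_def
proof (intro allI impI)
  fix S y e
  assume A: "S \<subseteq> {..<k} \<and> card S < k - 1 \<and> y \<in> Pk_deg k e \<and> card S + 2 * e = ndeg k j"
  have fin: "finite S" using A finite_subset by blast
  obtain i where j: "j = Suc i" using assms(2) by (cases j) auto
  have n: "card S + 2 * e = (k - 1) + 2 * ((k - 1) * (2 ^ i - 1))"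
    using A unfolding j ndeg_Suc by (simp add: ndeg_def)
  have "e + card S \<noteq> (\<Sum>i\<in>S. 2 ^ b i)" for b
  proof -
    consider "card S = 0" | "k = 4" "card S = 1" | "k = 5" "card S = 2"
    proof -
      have "even (card S + (k - 1))" using n by presburger
      then show thesis using A assms(1) that
        by (cases "card S = 0"; cases "card S = 1"; cases "card S = 2"; cases "card S = 3"; force)
    qed
    then show ?thesis
    proof cases
      case 1
      then show ?thesis using fin n assms(1) by auto
    next
      case 2
      obtain i' where i: "i = Suc i'" using assms(3) j 2 by (cases i) auto
      obtain x where x: "(2::nat) ^ i' = Suc x" by (metis not0_implies_Suc power_not_zero zero_neq_numeral)
      have "e + card S = 6 * 2 ^ i' - 1" using n 2 unfolding i power_Suc x by simp
      moreover have "odd ((6::nat) * 2 ^ i' - 1)" "(6::nat) * 2 ^ i' - 1 > 1"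
        unfolding x by auto
      moreover obtain s where "S = {s}" using 2 card_1_singletonE by blast
      ultimately show ?thesis using not_power_of_two by simp
    next
      case 3
      obtain s t where S: "S = {s, t}" "s \<noteq> t" using 3 card_2_iff by metis
      obtain x where x: "(2::nat) ^ i = Suc x" by (metis not0_implies_Suc power_not_zero zero_neq_numeral)
      have "e + card S = 2 ^ Suc (Suc i) - 1" using n 3 unfolding power_Suc x by simp
      moreover have "i \<ge> 1" using assms(3) j 3 by simp
      ultimately show ?thesis
        using odd_not_sum_of_two_powers[of "Suc (Suc i)" "b s" "b t"] S by auto
    qed
  qed
  then show "vprod S * y ^ 2 \<in> hit_deg k (ndeg k j)"
    using A by (intro vprod_square_hit) auto
qed

section \<open>Kameko operators\<close>

text \<open>Kameko's classical map multiplies y^2 by all k variables. Leaving one out adapts it to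
  the recursion n \<mapsto> k - 1 + 2 n satisfied by \<open>ndeg\<close>.\<close>

definition kameko_up :: "nat \<Rightarrow> nat \<Rightarrow> poly2 \<Rightarrow> poly2" where
  "kameko_up k i y = vprod ({..<k} - {i}) * y ^ 2"

lemma kameko_up_add: "kameko_up k i (f + g) = kameko_up k i f + kameko_up k i g"
  by (simp add: kameko_up_def poly2_square_add ring_distribs)

lemma kameko_up_zero [simp]: "kameko_up k i 0 = 0"
  by (simp add: kameko_up_def)

lemma Pk_deg_kameko_up: "i < k \<Longrightarrow> y \<in> Pk_deg k n \<Longrightarrow> kameko_up k i y \<in> Pk_deg k ((k - 1) + 2 * n)"
  unfolding kameko_up_def using Pk_deg_vprod[of "{..<k} - {i}" k]
  by (intro Pk_deg_mult Pk_deg_pow) auto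

text \<open>Expand Sq (2c) on X(i) g^2, where \<open>T\<close> is the set of factors that get
  doubled. Odd squares of g^2 vanish, so \<open>T\<close> has even size 2b. The empty
  \<open>T\<close> gives K(i) (Sq c g); every other \<open>T\<close> turns its variables into
  squares and leaves fewer than k - 1 odd exponents, hence is hit by assumption.\<close>

lemma kameko_up_hit_deg:
  assumes "low_weight_hit k ((k - 1) + 2 * n)" "i < k" "f \<in> hit_deg k n"
  shows "kameko_up k i f \<in> hit_deg k ((k - 1) + 2 * n)"
proof -
  let ?n = "(k - 1) + 2 * n" and ?S = "{..<k} - {i}"
  have cS: "card ?S = k - 1" using assms(2) by simp
  have gen: "kameko_up k i (Sq c g) \<in> hit_deg k ?n" if c: "0 < c" and g: "g \<in> Pk_deg k n'" and n: "n' + c = n" for c g n'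
  proof -
    let ?a = "\<lambda>T i. if i \<in> T then Suc 0 else 0"
    let ?t = "\<lambda>T. if card T \<le> 2 * c then vprod_pow2 (?a T) ?S * Sq (2 * c - card T) (g ^ 2) else 0"
    have "?t T \<in> hit_deg k ?n" if T: "T \<in> Pow ?S - {{}}" for T
    proof (cases "card T \<le> 2 * c \<and> even (card T)")
      case True
      obtain b where b: "card T = 2 * b" "b \<le> c" using True by (auto elim!: evenE)
      have fT: "finite T" using T finite_subset[of T ?S] by auto
      have u: "vprod_pow2 (?a T) ?S = vprod (?S - T) * vprod T ^ 2"
      proof -
        have "vprod_pow2 (?a T) ?S = (\<Prod>i\<in>?S - T. var i ^ 2 ^ ?a T i) * (\<Prod>i\<in>T. var i ^ 2 ^ ?a T i)"
          unfolding vprod_pow2_def using T by (intro prod.subset_diff) auto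
        then show ?thesis by (simp add: vprod_def prod_power_distrib)
      qed
      have cT: "card (?S - T) = k - 1 - 2 * b" "2 * b \<le> k - 1" "b > 0"
        using card_Diff_subset[of T ?S] card_mono[of ?S T] T fT b cS card_gt_0_iff[of T] by auto
      have "vprod (?S - T) * (vprod T * Sq (c - b) g) ^ 2 \<in> hit_deg k ?n"
      proof -
        have "vprod T * Sq (c - b) g \<in> Pk_deg k (2 * b + (n' + (c - b)))"
          using Pk_deg_vprod[of T k] T b Pk_deg_Sq[OF g, of "c - b"] by (intro Pk_deg_mult) auto
        moreover have "card (?S - T) + 2 * (2 * b + (n' + (c - b))) = ?n"
          using cT b n by auto
        moreover have "card (?S - T) < k - 1" "?S - T \<subseteq> {..<k}" using cT by auto
        ultimately show ?thesis
          using assms(1) unfolding low_weight_hit_def by blast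
      qed
      moreover have "Sq (2 * c - card T) (g ^ 2) = Sq (c - b) g ^ 2"
        using b by (simp add: Sq_square flip: diff_mult_distrib2)
      ultimately show ?thesis using True by (simp add: u power_mult_distrib mult.assoc)
    qed (auto simp: Sq_square)
    then have "(\<Sum>T\<in>Pow ?S - {{}}. ?t T) \<in> hit_deg k ?n" by (rule hit_deg_sum)
    moreover have "Sq (2 * c) (vprod_pow2 (\<lambda>_. 0) ?S * g ^ 2) \<in> hit_deg k ?n"
    proof (rule hit_deg_Sq)
      show "vprod_pow2 (\<lambda>_. 0) ?S * g ^ 2 \<in> Pk_deg k ((k - 1) + 2 * n')"
        using Pk_deg_kameko_up[OF assms(2) g] by (simp add: vprod_pow2_0 kameko_up_def)
    qed (use c n in auto)
    moreover have "Sq (2 * c) (vprod_pow2 (\<lambda>_. 0) ?S * g ^ 2) = kameko_up k i (Sq c g) + (\<Sum>T\<in>Pow ?S - {{}}. ?t T)"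
    proof -
      have "vprod_pow2 (?a {}) ?S = vprod ?S" using vprod_pow2_0 by simp
      then show ?thesis
        by (subst Sq_vprod_pow2_mult, simp, subst sum.remove[of _ "{}"])
          (auto simp: kameko_up_def Sq_square cong: if_cong)
    qed
    ultimately show ?thesis
      using hit_deg_add[of "Sq (2 * c) (vprod_pow2 (\<lambda>_. 0) ?S * g ^ 2)" k ?n "(\<Sum>T\<in>Pow ?S - {{}}. ?t T)"]
      by (simp add: add.assoc)
  qed
  have "f \<in> v2.span {Sq i g | i g n'. 0 < i \<and> g \<in> Pk_deg k n' \<and> n' + i = n}"
    using assms(3) by (simp add: hit_deg_def)
  then show ?thesis
  proof (induction rule: v2.span_induct_alt)
    case (step c x y)
    have "kameko_up k i x \<in> hit_deg k ((k - 1) + 2 * n)" using step.hyps gen by blast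
    then show ?case using step.IH by (cases c) (auto simp: kameko_up_add intro: hit_deg_add)
  qed simp
qed

lemma Sq_1_vprod: "finite S \<Longrightarrow> Sq 1 (vprod S) = vprod S * (\<Sum>l\<in>S. var l)"
proof (induction S rule: finite_induct)
  case empty
  then show ?case by (simp add: vprod_def Sq_eq_coeff_total_Sq)
next
  case (insert x S)
  then have "vprod (insert x S) = var x * vprod S" by (simp add: vprod_def)
  then show ?case using insert
    by (simp only: Sq_1_mult Sq_1_var insert.IH) (simp add: algebra_simps power2_eq_square)
qed

lemma power_two_power_Suc:
  fixes p :: "'a::monoid_mult"
  shows "p ^ (2 ^ Suc s - 1) = p * (p ^ (2 ^ s - 1)) ^ 2" and "p ^ 2 ^ Suc s = (p ^ 2 ^ s) ^ 2"
proof -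
  show "p ^ (2 ^ Suc s - 1) = p * (p ^ (2 ^ s - 1)) ^ 2"
    unfolding two_power_Suc_minus_one by (simp only: power_Suc power_mult)
  show "p ^ 2 ^ Suc s = (p ^ 2 ^ s) ^ 2"
    by (simp add: mult.commute[of 2] flip: power_mult)
qed

lemma kameko_up_funpow: "(kameko_up k i ^^ s) y = vprod ({..<k} - {i}) ^ (2 ^ s - 1) * y ^ (2 ^ s)"
proof (induction s)
  case (Suc s)
  have "(kameko_up k i ^^ Suc s) y = vprod ({..<k} - {i}) * (vprod ({..<k} - {i}) ^ (2 ^ s - 1) * y ^ (2 ^ s)) ^ 2"
    by (simp only: funpow.simps o_apply Suc kameko_up_def)
  also have "\<dots> = vprod ({..<k} - {i}) ^ (2 ^ Suc s - 1) * y ^ (2 ^ Suc s)"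
    by (simp only: power_two_power_Suc power_mult_distrib mult.assoc)
  finally show ?case .
qed simp

text \<open>
  With X the product of all variables, this sum is Sq 1 applied to X^(2^s-1) g^(2^s).
\<close>

lemma sum_kameko_up_funpow_hit:
  assumes "g \<in> Pk_deg k n" "s \<ge> 1"
  shows "(\<Sum>l<k. (kameko_up k l ^^ s) (var l * g)) \<in> hit_deg k (k * (2 ^ s - 1) + 2 ^ s * n + 1)"
proof -
  obtain s' where s: "s = Suc s'" using assms(2) by (cases s) auto
  let ?P = "vprod {..<k}"
  let ?h = "?P ^ (2 ^ s' - 1) * g ^ 2 ^ s'"
  \<comment> \<open>As \<open>s\<close> is positive this is \<open>?P\<close> times a square, and
    \<open>Sq 1\<close> is a derivation that kills squares.\<close>
  have h: "?P ^ (2 ^ s - 1) * g ^ 2 ^ s = ?P * ?h ^ 2"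
    by (simp only: s power_two_power_Suc power_mult_distrib mult.assoc)
  have "(kameko_up k l ^^ s) (var l * g) = ?P ^ (2 ^ s - 1) * g ^ 2 ^ s * var l" if "l < k" for l
  proof -
    have "(2::nat) ^ s = Suc (2 ^ s - 1)" by simp
    then have "var l ^ 2 ^ s = var l ^ (2 ^ s - 1) * var l" by (metis power_Suc2)
    then show ?thesis
      using that vprod_remove[of "{..<k}" l]
      by (simp add: kameko_up_funpow power_mult_distrib algebra_simps)
  qed
  then have "(\<Sum>l<k. (kameko_up k l ^^ s) (var l * g)) = ?P ^ (2 ^ s - 1) * g ^ 2 ^ s * (\<Sum>l<k. var l)"
    by (simp add: sum_distrib_left)
  also have "\<dots> = Sq 1 (?P * ?h ^ 2)"
    unfolding h by (simp only: Sq_1_mult Sq_1_square Sq_1_vprod finite_lessThan) (simp add: algebra_simps)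
  also have "\<dots> = Sq 1 (?P ^ (2 ^ s - 1) * g ^ 2 ^ s)"
    by (simp only: h)
  also have "\<dots> \<in> hit_deg k (k * (2 ^ s - 1) + 2 ^ s * n + 1)"
  proof (rule hit_deg_Sq)
    show "?P ^ (2 ^ s - 1) * g ^ 2 ^ s \<in> Pk_deg k (k * (2 ^ s - 1) + 2 ^ s * n)"
      using Pk_deg_mult[OF Pk_deg_pow[OF Pk_deg_vprod[of "{..<k}" k], of "2 ^ s - 1"] Pk_deg_pow[OF assms(1), of "2 ^ s"]]
      by (simp add: mult.commute)
  qed auto
  finally show ?thesis .
qed


lemma vprod_two_removed:
  assumes "i < k" "j < k" "i \<noteq> j"
  shows "vprod ({..<k} - {j}) = var i * vprod ({..<k} - {i, j})"
proof -
  have "{..<k} - {j} - {i} = {..<k} - {i, j}" by blast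
  then show ?thesis using vprod_remove[of "{..<k} - {j}" i] assms by simp
qed

lemma kameko_up_mult_vprod_two_removed:
  assumes "i < k" "j < k" "i \<noteq> j"
  shows "var i * (vprod ({..<k} - {i, j}) * y ^ 2) = kameko_up k j y"
  by (simp add: kameko_up_def vprod_two_removed[OF assms] mult.assoc)

lemma sum_minus_two:
  fixes f :: "nat \<Rightarrow> poly2"
  assumes "i < k" "j < k" "i \<noteq> j"
  shows "(\<Sum>l<k. f l) = f i + f j + (\<Sum>l\<in>{..<k} - {i, j}. f l)"
proof -
  have "{..<k} - {i} - {j} = {..<k} - {i, j}" by blast
  then show ?thesis
    using sum.remove[of "{..<k}" i f] sum.remove[of "{..<k} - {i}" j f] assms by (simp add: add.assoc)
qed

section \<open>Words in the Kameko operators and their relations\<close>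

fun kameko_word :: "nat \<Rightarrow> nat list \<Rightarrow> poly2 \<Rightarrow> poly2" where
  "kameko_word k [] y = y"
| "kameko_word k (i # w) y = kameko_up k i (kameko_word k w y)"

lemma kameko_word_append: "kameko_word k (v @ w) y = kameko_word k v (kameko_word k w y)"
  by (induction v) auto

lemma kameko_word_add: "kameko_word k w (f + g) = kameko_word k w f + kameko_word k w g"
  by (induction w) (auto simp: kameko_up_add)

lemma kameko_word_zero [simp]: "kameko_word k w 0 = 0"
  by (induction w) auto

lemma kameko_word_sum: "kameko_word k w (\<Sum>l\<in>F. g l) = (\<Sum>l\<in>F. kameko_word k w (g l))"
  by (induction F rule: infinite_finite_induct) (auto simp: kameko_word_add)

lemma kameko_word_replicate: "kameko_word k (replicate s i) y = (kameko_up k i ^^ s) y"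
  by (induction s) auto

lemma Pk_deg_kameko_up_ndeg: "i < k \<Longrightarrow> y \<in> Pk_deg k (ndeg k j) \<Longrightarrow> kameko_up k i y \<in> Pk_deg k (ndeg k (Suc j))"
  unfolding ndeg_Suc by (rule Pk_deg_kameko_up)

lemma Pk_deg_kameko_word:
  "set w \<subseteq> {..<k} \<Longrightarrow> y \<in> Pk_deg k (ndeg k j) \<Longrightarrow> kameko_word k w y \<in> Pk_deg k (ndeg k (j + length w))"
  by (induction w) (auto intro: Pk_deg_kameko_up_ndeg)

text \<open>\<open>j0\<close> is the level, that is the index of \<open>ndeg\<close>, from which on
  the operators act on classes: 0 for k = 3 and 1 for k = 4, 5. The assumption concerns levels above
  \<open>j0\<close> because it is used at the target of an operator.\<close>

locale kameko =
  fixes k j0 :: nat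
  assumes k3: "k \<ge> 3" and low: "j > j0 \<Longrightarrow> low_weight_hit k (ndeg k j)"
begin

lemma kameko_up_hit: "j \<ge> j0 \<Longrightarrow> i < k \<Longrightarrow> f \<in> hit_deg k (ndeg k j) \<Longrightarrow> kameko_up k i f \<in> hit_deg k (ndeg k (Suc j))"
  unfolding ndeg_Suc by (rule kameko_up_hit_deg) (use low[of "Suc j"] in \<open>auto simp: ndeg_Suc\<close>)

lemma kameko_word_hit:
  "j \<ge> j0 \<Longrightarrow> set w \<subseteq> {..<k} \<Longrightarrow> f \<in> hit_deg k (ndeg k j) \<Longrightarrow> kameko_word k w f \<in> hit_deg k (ndeg k (j + length w))"
  by (induction w) (auto intro: kameko_up_hit)

lemma kameko_up_funpow_hit:
  "j \<ge> j0 \<Longrightarrow> i < k \<Longrightarrow> f \<in> hit_deg k (ndeg k j) \<Longrightarrow> (kameko_up k i ^^ s) f \<in> hit_deg k (ndeg k (j + s))"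
  by (induction s) (auto intro: kameko_up_hit)

lemma sum_kameko_up_hit:
  assumes "g \<in> Pk_deg k n" "Suc n = ndeg k j" "s \<ge> 1"
  shows "(\<Sum>l<k. (kameko_up k l ^^ s) (var l * g)) \<in> hit_deg k (ndeg k (j + s))"
proof -
  obtain a where a: "(2::nat) ^ s = Suc a" by (metis not0_implies_Suc power_not_zero zero_neq_numeral)
  obtain b where b: "(2::nat) ^ j = Suc b" by (metis not0_implies_Suc power_not_zero zero_neq_numeral)
  obtain h where h: "k = Suc h" using k3 by (cases k) auto
  have "Suc n = h * b" using assms(2) by (simp add: ndeg_def h b)
  then have "(Suc a) * (n + 1) = Suc a * (h * b)" by simp
  then have "k * (2 ^ s - 1) + 2 ^ s * n + 1 = ndeg k (j + s)"
    unfolding ndeg_def power_add a b h by (simp add: algebra_simps)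
  then show ?thesis using sum_kameko_up_funpow_hit[OF assms(1,3)] by simp
qed

text \<open>
  The instance s = 1 makes the operators commute; s = 2 gives iij = jji, which moves
  multiplicities between letters. Both come from the preceding relation with g the product of
  the other variables times y^2.
\<close>

lemma kameko_up_funpow_commute:
  assumes "j \<ge> j0" "y \<in> Pk_deg k (ndeg k j)" "i < k" "l < k" "i \<noteq> l" "s \<ge> 1"
  shows "(kameko_up k i ^^ s) (kameko_up k l y) + (kameko_up k l ^^ s) (kameko_up k i y) \<in> hit_deg k (ndeg k (Suc j + s))"
proof -
  let ?W = "{..<k} - {i, l}"
  let ?g = "vprod ?W * y ^ 2"
  have cW: "card ?W = k - 2" using assms by (simp add: card_Diff_subset)
  have g: "?g \<in> Pk_deg k ((k - 2) + 2 * ndeg k j)"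
    using Pk_deg_vprod[of ?W k] assms(2) cW by (intro Pk_deg_mult Pk_deg_pow) auto
  have "(\<Sum>l<k. (kameko_up k l ^^ s) (var l * ?g)) \<in> hit_deg k (ndeg k (Suc j + s))"
    by (rule sum_kameko_up_hit[OF g _ assms(6)]) (use k3 in \<open>simp add: ndeg_Suc\<close>)
  \<comment> \<open>A third variable \<open>m\<close> already divides \<open>?g\<close>, so it
    becomes a square factor and only k - 3 odd exponents remain.\<close>
  moreover have "(kameko_up k m ^^ s) (var m * ?g) \<in> hit_deg k (ndeg k (Suc j + s))" if m: "m \<in> ?W" for m
  proof (rule kameko_up_funpow_hit)
    have e: "var m * ?g = vprod (?W - {m}) * (var m * y) ^ 2"
      using vprod_remove[of ?W m] m by (simp add: power2_eq_square algebra_simps)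
    have "card (?W - {m}) = k - 3" using cW m by simp
    moreover have "var m * y \<in> Pk_deg k (1 + ndeg k j)"
      using m assms(2) by (intro Pk_deg_mult) (auto simp del: One_nat_def)
    ultimately show "var m * ?g \<in> hit_deg k (ndeg k (Suc j))"
      unfolding e using low[of "Suc j"] assms(1) k3 unfolding low_weight_hit_def ndeg_Suc
      by (intro low[of "Suc j", unfolded low_weight_hit_def ndeg_Suc, rule_format]) auto
  qed (use m assms in auto)
  ultimately show ?thesis
    unfolding sum_minus_two[OF assms(3-5)] kameko_up_mult_vprod_two_removed[OF assms(3-5), of y]
      kameko_up_mult_vprod_two_removed[of l k i y, OF assms(4,3) assms(5)[symmetric], unfolded insert_commute[of l]]
    by (rule hit_deg_cancel[OF _ hit_deg_sum])
qed

lemma kameko_word_swap: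
  assumes "j \<ge> j0" "y \<in> Pk_deg k (ndeg k j)" "i < k" "l < k" "set w \<subseteq> {..<k}"
  shows "kameko_word k (i # l # w) y + kameko_word k (l # i # w) y \<in> hit_deg k (ndeg k (j + length w + 2))"
proof (cases "i = l")
  case False
  then show ?thesis
    using kameko_up_funpow_commute[of "j + length w" "kameko_word k w y" i l 1] Pk_deg_kameko_word[of w k y j] assms by simp
qed simp

lemma kameko_word_move:
  assumes "j \<ge> j0" "y \<in> Pk_deg k (ndeg k j)" "set (p @ a # q) \<subseteq> {..<k}"
  shows "kameko_word k (p @ a # q) y + kameko_word k (a # p @ q) y \<in> hit_deg k (ndeg k (j + length p + length q + 1))"
  using assms(3)
proof (induction p)
  case (Cons b p)
  have "kameko_up k b (kameko_word k (p @ a # q) y + kameko_word k (a # p @ q) y)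
      \<in> hit_deg k (ndeg k (Suc (j + length p + length q + 1)))"
    using Cons assms(1) by (intro kameko_up_hit) auto
  moreover have "kameko_word k (b # a # (p @ q)) y + kameko_word k (a # b # (p @ q)) y
      \<in> hit_deg k (ndeg k (j + length (p @ q) + 2))"
    using Cons.prems assms by (intro kameko_word_swap) auto
  ultimately show ?case
    by - (rule hit_deg_trans[of _ "kameko_word k (b # a # (p @ q)) y"], simp_all add: kameko_up_add add.assoc)
qed simp

lemma kameko_word_mset:
  assumes "j \<ge> j0" "y \<in> Pk_deg k (ndeg k j)" "set w \<subseteq> {..<k}" "mset w = mset v"
  shows "kameko_word k w y + kameko_word k v y \<in> hit_deg k (ndeg k (j + length w))"
  using assms(3,4)
proof (induction w arbitrary: v)
  case (Cons a w)
  have "a \<in> set v" using Cons.prems(2) by (metis list.set_intros(1) set_mset_mset)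
  then obtain p q where v: "v = p @ a # q" by (meson split_list)
  have m: "mset w = mset (p @ q)" using Cons.prems(2) v by simp
  have lw: "length w = length p + length q" using m by (metis length_append size_mset)
  have sv: "set v \<subseteq> {..<k}" using Cons.prems by (metis set_mset_mset)
  have "kameko_up k a (kameko_word k w y + kameko_word k (p @ q) y) \<in> hit_deg k (ndeg k (Suc (j + length w)))"
    using Cons m assms(1) by (intro kameko_up_hit) auto
  moreover have "kameko_word k v y + kameko_word k (a # p @ q) y \<in> hit_deg k (ndeg k (j + length p + length q + 1))"
    unfolding v using sv v assms by (intro kameko_word_move) auto
  ultimately have "kameko_word k (a # w) y + kameko_word k (a # p @ q) y \<in> hit_deg k (ndeg k (j + length (a # w)))"
    and "kameko_word k (a # p @ q) y + kameko_word k v y \<in> hit_deg k (ndeg k (j + length (a # w)))"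
    by (simp_all add: kameko_up_add lw add.assoc add.commute[of "kameko_up k a (kameko_word k (p @ q) y)" "kameko_word k v y"])
  then show ?case by (rule hit_deg_trans)
qed simp

text \<open>If the multiplicities differ, some letter \<open>a\<close> is more frequent in
  \<open>w\<close> than in \<open>v\<close> and some \<open>b\<close> less frequent. Since both
  words contain the same letters, \<open>a\<close> occurs at least twice in \<open>w\<close> and
  \<open>b\<close> at least once. Replacing a a b by b b a moves one copy from \<open>a\<close> to
  \<open>b\<close> and brings the multisets closer.\<close>

lemma kameko_word_equiv:
  assumes "j \<ge> j0" "y \<in> Pk_deg k (ndeg k j)"
  shows "set w \<subseteq> {..<k} \<Longrightarrow> set w = set v \<Longrightarrow> length w = length v \<Longrightarrow>
    kameko_word k w y + kameko_word k v y \<in> hit_deg k (ndeg k (j + length w))"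
proof (induction "size (mset w - mset v)" arbitrary: w rule: less_induct)
  case less
  show ?case
  proof (cases "mset w = mset v")
    case True
    then show ?thesis using kameko_word_mset assms less.prems(1) by blast
  next
    case False
    have sz: "size (mset w) = size (mset v)" using less.prems(3) by simp
    have "\<not> mset w \<subseteq># mset v" "\<not> mset v \<subseteq># mset w"
      using False sz by (metis mset_subset_size nat_less_le subset_mset.le_imp_less_or_eq)+
    then obtain a b where a: "count (mset w) a > count (mset v) a" and b: "count (mset w) b < count (mset v) b"
      unfolding subseteq_mset_def by (meson not_le_imp_less)
    have ab: "a \<noteq> b" using a b by auto
    have cnt: "count (mset xs) c > 0 \<longleftrightarrow> c \<in> set xs" for xs and c :: nat
      by (simp add: count_greater_zero_iff)
    have "a \<in> set w" using cnt[of w a] a by linarith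
    then have "count (mset v) a > 0" using cnt less.prems(2) by simp
    then have ca: "count (mset w) a \<ge> 2" using a by linarith
    have "b \<in> set v" using cnt[of v b] b by linarith
    then have "count (mset w) b > 0" using cnt less.prems(2) by simp
    then have cb: "count (mset w) b \<ge> 1" by linarith
    have "{#a, a, b#} \<subseteq># mset w"
      unfolding subseteq_mset_def using ca cb ab by auto
    then obtain N where N: "mset w = {#a, a, b#} + N" using mset_subset_eq_exists_conv by blast
    obtain u where u: "mset u = N" using ex_mset by blast
    have su: "set u \<subseteq> {..<k}" "a < k" "b < k" and lu: "length w = length u + 3"
    proof -
      have "set_mset (mset w) = {a, b} \<union> set_mset (mset u)" unfolding N u by simp
      then have "set w = {a, b} \<union> set u" by (simp only: set_mset_mset)
      then show "set u \<subseteq> {..<k}" "a < k" "b < k" using less.prems(1) by auto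
      have "size (mset w) = size N + 3" using N by simp
      then show "length w = length u + 3" using u by (metis size_mset)
    qed
    have e1: "kameko_word k w y + kameko_word k (a # a # b # u) y \<in> hit_deg k (ndeg k (j + length w))"
      using assms less.prems(1) N u by (intro kameko_word_mset) auto
    have e2: "kameko_word k (a # a # b # u) y + kameko_word k (b # b # a # u) y \<in> hit_deg k (ndeg k (j + length w))"
      using kameko_up_funpow_commute[of "j + length u" "kameko_word k u y" a b 2] Pk_deg_kameko_word[of u k y j] assms su ab
      by (simp add: lu numeral_2_eq_2 numeral_3_eq_3)
    let ?w = "b # b # a # u"
    have "kameko_word k ?w y + kameko_word k v y \<in> hit_deg k (ndeg k (j + length ?w))"
    proof (rule less.hyps)
      have mw: "mset ?w = (mset w - {#a#}) + {#b#}" using N u by simp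
      then have "mset ?w - mset v = (mset w - mset v) - {#a#}"
        using b a by (intro multiset_eqI) (auto simp: Suc_le_eq)
      moreover have "a \<in># mset w - mset v" using a by (simp add: in_diff_count)
      ultimately show "size (mset ?w - mset v) < size (mset w - mset v)"
        by (metis size_Diff1_less)
      have "set_mset (mset ?w) = set_mset (mset w)" unfolding N u[symmetric] by auto
      then have "set ?w = set w" by (simp only: set_mset_mset)
      then show "set ?w \<subseteq> {..<k}" "set ?w = set v" using less.prems by auto
      show "length ?w = length v" using lu less.prems(3) by simp
    qed
    then have "kameko_word k ?w y + kameko_word k v y \<in> hit_deg k (ndeg k (j + length w))" by (simp add: lu numeral_3_eq_3)
    then show ?thesis using e1 e2 hit_deg_trans by blast
  qed
qed

end

section \<open>Dimension counts modulo hit polynomials\<close>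

lemma finite_monos: "finite {m :: mono. supp m \<subseteq> {..<k} \<and> mdeg m = n}" (is "finite ?M")
proof -
  let ?r = "\<lambda>m. restrict (lkp m) {..<k}"
  have "?r ` ?M \<subseteq> PiE {..<k} (\<lambda>_. {..n})"
  proof clarify
    fix m :: mono assume m: "supp m \<subseteq> {..<k}" "n = mdeg m"
    have "lkp m i \<le> mdeg m" if "i < k" for i
      using mdeg_superset[OF _ m(1)] member_le_sum[of i "{..<k}" "lkp m"] that by simp
    then show "?r m \<in> PiE {..<k} (\<lambda>_. {..mdeg m})" by auto
  qed
  then have "finite (?r ` ?M)" by (rule finite_subset) (auto intro: finite_PiE)
  moreover have "inj_on ?r ?M"
  proof (rule inj_onI, rule poly_mapping_eqI)
    fix m m' :: mono and i
    assume a: "m \<in> ?M" "m' \<in> ?M" "?r m = ?r m'"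
    show "lkp m i = lkp m' i"
    proof (cases "i < k")
      case True
      then show ?thesis using fun_cong[OF a(3), of i] by simp
    next
      case False
      then have "i \<notin> supp m" "i \<notin> supp m'" using a by auto
      then show ?thesis by (simp add: in_keys_iff)
    qed
  qed
  ultimately show ?thesis by (rule finite_imageD)
qed

text \<open>The ambient space has infinite dimension, so \<open>dim\<close> bounds an independent
  set only once a finite spanning set is known; here these are the monomials of degree
  \<open>n\<close>.\<close>

lemma finite_independent_Pk_deg:
  assumes "v2.independent B" "B \<subseteq> Pk_deg k n"
  shows "finite B \<and> card B \<le> v2.dim (Pk_deg k n)"
proof -
  let ?M = "mon ` {m. supp m \<subseteq> {..<k} \<and> mdeg m = n}"
  have fin: "finite C" if C: "v2.independent C" "C \<subseteq> Pk_deg k n" for C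
  proof -
    have "f \<in> v2.span ?M" if "f \<in> Pk_deg k n" for f
      using that by (induction rule: Pk_deg_induct) (auto intro: v2.span_zero v2.span_add v2.span_base)
    then have "C \<subseteq> v2.span ?M" using C by blast
    then show ?thesis using v2.independent_span_bound[OF _ C(1), of ?M] finite_monos by auto
  qed
  obtain C where C: "C \<subseteq> Pk_deg k n" "v2.independent C" "Pk_deg k n \<subseteq> v2.span C" "card C = v2.dim (Pk_deg k n)"
    by (rule v2.basis_exists)
  have "B \<subseteq> v2.span C" using assms C by blast
  then show ?thesis using v2.independent_span_bound[OF fin[OF C(2,1)] assms(1)] C(4) by auto
qed

text \<open>A basis of the hit part together with \<open>E\<close> spans the whole degree, which
  bounds the difference of the two dimensions.\<close>

lemma QP_dim_le:
  assumes "Pk_deg k n \<subseteq> v2.span (hit_deg k n \<union> E)" "finite E"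
  shows "QP_dim k n \<le> card E"
proof -
  let ?H = "Pk_deg k n \<inter> hit k"
  obtain B where B: "B \<subseteq> ?H" "v2.independent B" "?H \<subseteq> v2.span B" "card B = v2.dim ?H"
    by (rule v2.basis_exists)
  have fB: "finite B" using finite_independent_Pk_deg[OF B(2)] B(1) by auto
  have "hit_deg k n \<union> E \<subseteq> v2.span (B \<union> E)"
    using hit_deg_subset[of k n] B(3) v2.span_mono[of B "B \<union> E"] v2.span_superset[of "B \<union> E"] by blast
  then have "v2.span (hit_deg k n \<union> E) \<subseteq> v2.span (B \<union> E)"
    by (rule v2.span_minimal) (rule v2.subspace_span)
  then have "Pk_deg k n \<subseteq> v2.span (B \<union> E)" using assms(1) by blast
  then have "v2.dim (Pk_deg k n) \<le> card (B \<union> E)" using fB assms(2) by (intro v2.dim_le_card) auto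
  also have "\<dots> \<le> v2.dim ?H + card E" using card_Un_le[of B E] B(4) by simp
  finally show ?thesis unfolding QP_dim_def by simp
qed

lemma span_Un_image:
  assumes "finite A" "x \<in> v2.span (B \<union> e ` A)"
  shows "\<exists>T \<subseteq> A. x + (\<Sum>a\<in>T. e a) \<in> v2.span B"
  using assms
proof (induction A arbitrary: x rule: finite_induct)
  case (insert a A)
  then have "x \<in> v2.span (insert (e a) (B \<union> e ` A))" by simp
  then obtain c where "x - scale2 c (e a) \<in> v2.span (B \<union> e ` A)"
    using v2.span_breakdown_eq by blast
  then consider "x \<in> v2.span (B \<union> e ` A)" | "x + e a \<in> v2.span (B \<union> e ` A)"
    by (cases c) (auto simp: poly2_minus)
  then show ?case
  proof cases
    case 1
    from insert.IH[OF 1] obtain T where "T \<subseteq> A" "x + (\<Sum>a\<in>T. e a) \<in> v2.span B" by blast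
    then show ?thesis by (intro exI[of _ T]) auto
  next
    case 2
    from insert.IH[OF 2] obtain T where T: "T \<subseteq> A" "x + e a + (\<Sum>a\<in>T. e a) \<in> v2.span B" by blast
    moreover have "(\<Sum>a\<in>insert a T. e a) = e a + (\<Sum>a\<in>T. e a)"
      using T(1) insert.hyps finite_subset by (intro sum.insert) auto
    ultimately show ?thesis by (intro exI[of _ "insert a T"]) (auto simp: add.assoc)
  qed
qed auto

text \<open>Over the field with two elements linear combinations are subset sums.\<close>

lemma QP_dim_ge:
  assumes "finite A" "\<And>a. a \<in> A \<Longrightarrow> e a \<in> Pk_deg k n"
    and ind: "\<And>T. T \<subseteq> A \<Longrightarrow> T \<noteq> {} \<Longrightarrow> (\<Sum>a\<in>T. e a) \<notin> hit k"
  shows "card A \<le> QP_dim k n"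
proof -
  let ?H = "Pk_deg k n \<inter> hit k"
  obtain B where B: "B \<subseteq> ?H" "v2.independent B" "?H \<subseteq> v2.span B" "card B = v2.dim ?H"
    by (rule v2.basis_exists)
  have fB: "finite B" using finite_independent_Pk_deg[OF B(2)] B(1) by auto
  have spB: "v2.span B \<subseteq> hit k"
    using B(1) by (intro v2.span_minimal) (auto simp: hit_def v2.subspace_span)
  \<comment> \<open>The cardinality is carried along with independence because \<open>e\<close> is
    not assumed to be injective or to avoid \<open>B\<close>.\<close>
  have "v2.independent (B \<union> e ` A') \<and> card (B \<union> e ` A') = card B + card A'" if "A' \<subseteq> A" for A'
    using finite_subset[OF that assms(1)] that
  proof (induction A' rule: finite_induct)
    case (insert a A')
    have nsp: "e a \<notin> v2.span (B \<union> e ` A')"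
    proof
      assume "e a \<in> v2.span (B \<union> e ` A')"
      then obtain T where T: "T \<subseteq> A'" "e a + (\<Sum>a\<in>T. e a) \<in> v2.span B"
        using span_Un_image[OF insert.hyps(1)] by blast
      moreover have "(\<Sum>a\<in>insert a T. e a) = e a + (\<Sum>a\<in>T. e a)"
        using T(1) insert.hyps finite_subset by (intro sum.insert) auto
      ultimately show False using ind[of "insert a T"] spB insert.prems by auto
    qed
    have n: "e a \<notin> B \<union> e ` A'" using nsp v2.span_base[of "e a" "B \<union> e ` A'"] by argo
    have IH: "v2.independent (B \<union> e ` A')" "card (B \<union> e ` A') = card B + card A'"
      using insert.IH insert.prems by simp_all
    have i: "B \<union> e ` insert a A' = insert (e a) (B \<union> e ` A')" by simp
    have "v2.independent (insert (e a) (B \<union> e ` A'))"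
      using nsp IH(1) by (rule v2.independent_insertI)
    moreover have "card (insert (e a) (B \<union> e ` A')) = card B + card (insert a A')"
      using n fB insert.hyps IH(2) by simp
    ultimately show ?case unfolding i by blast
  qed (use B in auto)
  from this[OF order_refl] have "v2.independent (B \<union> e ` A)" "card (B \<union> e ` A) = card B + card A" by auto
  moreover have "B \<union> e ` A \<subseteq> Pk_deg k n" using B(1) assms(2) by auto
  ultimately have "card B + card A \<le> v2.dim (Pk_deg k n)"
    using finite_independent_Pk_deg by metis
  then show ?thesis unfolding QP_dim_def B(4) by simp
qed

lemma card_nonempty_subsets:
  assumes "finite S"
  shows "card {J. J \<subseteq> S \<and> J \<noteq> {} \<and> card J \<le> t} = (\<Sum>u=1..t. card S choose u)"
proof -
  have "{J. J \<subseteq> S \<and> J \<noteq> {} \<and> card J \<le> t} = (\<Union>u\<in>{1..t}. {J. J \<subseteq> S \<and> card J = u})"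
    using assms finite_subset[of _ S] by (auto simp: Suc_le_eq card_gt_0_iff)
  then have "card {J. J \<subseteq> S \<and> J \<noteq> {} \<and> card J \<le> t} = (\<Sum>u=1..t. card {J. J \<subseteq> S \<and> card J = u})"
    using assms finite_subset[of _ "Pow S"] by (simp only:) (subst card_UN_disjoint, auto)
  then show ?thesis using assms by (simp add: n_subsets)
qed

section \<open>Square-free parts of monomials\<close>

lemma vprod_eq_mon: "finite S \<Longrightarrow> vprod S = mon (\<Sum>i\<in>S. Poly_Mapping.single i 1)"
  by (simp add: vprod_def var_def mon_sum)

lemma mono_decomp:
  assumes "mon m \<in> Pk_deg k n"
  obtains S h e where "S \<subseteq> supp m" "supp h \<subseteq> supp m" "mon m = vprod S * mon h ^ 2"
    "mon h \<in> Pk_deg k e" "card S + 2 * e = n" "S \<subseteq> {..<k}"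
proof -
  define S where "S = {i \<in> supp m. odd (lkp m i)}"
  define h where "h = (\<Sum>i\<in>supp m. Poly_Mapping.single i (lkp m i div 2))"
  have S: "S \<subseteq> supp m" "finite S" by (auto simp: S_def)
  have lh: "lkp h i = lkp m i div 2" for i
    by (simp add: h_def lookup_sum lookup_single when_def sum.delta in_keys_iff)
  then have h: "supp h \<subseteq> supp m" by (auto simp: in_keys_iff)
  have meq: "m = (\<Sum>i\<in>S. Poly_Mapping.single i 1) + (h + h)"
  proof (rule poly_mapping_eqI)
    fix i
    have "lkp (\<Sum>i\<in>S. Poly_Mapping.single i 1) i = lkp m i mod 2"
      using S by (auto simp: lookup_sum lookup_single when_def sum.delta S_def in_keys_iff mod_2_eq_odd)
    then show "lkp m i = lkp ((\<Sum>i\<in>S. Poly_Mapping.single i 1) + (h + h)) i"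
      unfolding lookup_add lh by presburger
  qed
  have mm: "mon m = vprod S * mon h ^ 2"
    by (subst meq) (simp only: vprod_eq_mon[OF S(2)] power2_eq_square mon_mult)
  have "mdeg (\<Sum>i\<in>S. Poly_Mapping.single i 1) = card S"
  proof -
    have "mdeg (\<Sum>i\<in>F. Poly_Mapping.single i 1) = card F" if "finite F" for F :: "nat set"
      using that by induction (auto simp: mdeg_add)
    then show ?thesis using S by blast
  qed
  moreover have "mdeg m = mdeg ((\<Sum>i\<in>S. Poly_Mapping.single i 1) + (h + h))"
    using meq by (rule arg_cong)
  ultimately have "card S + 2 * mdeg h = n"
    using assms by (simp only: mdeg_add Pk_deg_mon_iff) simp
  moreover have "mon h \<in> Pk_deg k (mdeg h)" "S \<subseteq> {..<k}" using assms h S by auto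
  ultimately show ?thesis using that S h mm by blast
qed

lemma kameko_word_span:
  assumes "x \<in> v2.span A" shows "kameko_word k w x \<in> v2.span (kameko_word k w ` A)"
  using assms
proof (induction rule: v2.span_induct_alt)
  case (step c x y)
  then show ?case by (cases c) (auto simp: kameko_word_add intro!: v2.span_add intro: v2.span_base)
qed (simp add: v2.span_zero)

text \<open>A fixed representative of the words of length \<open>r\<close> with letter set
  \<open>J\<close>. Padding with \<open>Min J\<close> is an arbitrary choice, harmless by
  \<open>kameko_word_equiv\<close>.\<close>

definition canonical_word :: "nat \<Rightarrow> nat set \<Rightarrow> nat list" where
  "canonical_word r J = sorted_list_of_set J @ replicate (r - card J) (Min J)"

lemma canonical_word:
  assumes "finite J" "J \<noteq> {}" "card J \<le> r"
  shows "set (canonical_word r J) = J" "length (canonical_word r J) = r"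
  using assms by (auto simp: canonical_word_def intro: Min_in)

lemma hit_deg_sum_cong:
  assumes "(\<Sum>l\<in>L. a l) \<in> hit_deg k n" "\<And>l. l \<in> L \<Longrightarrow> a l + b l \<in> hit_deg k n"
  shows "(\<Sum>l\<in>L. b l) \<in> hit_deg k n"
proof -
  have "(\<Sum>l\<in>L. b l) + (\<Sum>l\<in>L. a l) \<in> hit_deg k n"
    using hit_deg_sum[of L "\<lambda>l. a l + b l"] assms(2) by (simp add: sum.distrib add.commute)
  then show ?thesis using assms(1) by (rule hit_deg_cancel)
qed

section \<open>Spanning by words and reduction to fewer variables\<close>

context kameko
begin

abbreviation "kameko_set r J y \<equiv> kameko_word k (canonical_word r J) y"

lemma kameko_word_canonical:
  assumes "j \<ge> j0" "y \<in> Pk_deg k (ndeg k j)" "set w \<subseteq> {..<k}" "w \<noteq> []"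
  shows "kameko_word k w y + kameko_set (length w) (set w) y \<in> hit_deg k (ndeg k (j + length w))"
  using assms canonical_word[of "set w" "length w"] by (intro kameko_word_equiv) (auto simp: card_length)

text \<open>By parity of the degree a monomial cannot have exactly k odd exponents. With fewer than
  k - 1 it is hit; with k - 1 it is an operator applied to a monomial one level below, where the
  induction hypothesis applies.\<close>

lemma span_words:
  assumes "j \<ge> j0" "f \<in> Pk_deg k (ndeg k (j + r))"
  shows "f \<in> v2.span (hit_deg k (ndeg k (j + r)) \<union>
    {kameko_word k w y | w y. set w \<subseteq> {..<k} \<and> length w = r \<and> y \<in> Pk_deg k (ndeg k j)})"
  using assms(2)
proof (induction r arbitrary: f)
  case 0
  then show ?case by (intro v2.span_base) (auto intro!: exI[of _ "[]"])
next
  case (Suc r)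
  let ?W = "\<lambda>r. {kameko_word k w y | w y. set w \<subseteq> {..<k} \<and> length w = r \<and> y \<in> Pk_deg k (ndeg k j)}"
  let ?n = "ndeg k (Suc (j + r))"
  have "f \<in> Pk_deg k ?n" using Suc.prems by simp
  then have "f \<in> v2.span (hit_deg k ?n \<union> ?W (Suc r))"
  proof (induction rule: Pk_deg_induct)
    case (mon m)
    then obtain S h e where S: "mon m = vprod S * mon h ^ 2" "mon h \<in> Pk_deg k e" "card S + 2 * e = ?n" "S \<subseteq> {..<k}"
      by (rule mono_decomp) 
    have "card S \<le> k" using S(4) card_mono[of "{..<k}" S] by simp
    moreover have "even (card S + (k - 1))"
    proof -
      have "card S + 2 * e = (k - 1) + 2 * ndeg k (j + r)" using S(3) by (simp add: ndeg_Suc)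
      then show ?thesis by presburger
    qed
    moreover have "odd (k + (k - 1))" using k3 by (cases k) auto
    ultimately have "card S \<noteq> k" "card S \<le> k" by auto
    then consider "card S < k - 1" | "card S = k - 1" by linarith
    then show ?case
    proof cases
      case 1
      then have "mon m \<in> hit_deg k ?n"
        using low[of "Suc (j + r)"] assms(1) S unfolding low_weight_hit_def by auto
      then show ?thesis by (intro v2.span_base) auto
    next
      case 2
      have "card ({..<k} - S) = 1" using 2 S(4) k3 by (simp add: card_Diff_subset finite_subset)
      then obtain i where i: "{..<k} - S = {i}" by (auto simp: card_1_singleton_iff)
      then have Si: "S = {..<k} - {i}" "i < k" using S(4) by auto
      have e: "e = ndeg k (j + r)" using S(3) 2 by (simp add: ndeg_Suc)
      have "mon h \<in> v2.span (hit_deg k (ndeg k (j + r)) \<union> ?W r)"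
        using Suc.IH S(2) e by simp
      then have "kameko_word k [i] (mon h) \<in> v2.span (kameko_word k [i] ` (hit_deg k (ndeg k (j + r)) \<union> ?W r))"
        by (rule kameko_word_span)
      moreover have "kameko_word k [i] ` (hit_deg k (ndeg k (j + r)) \<union> ?W r) \<subseteq> hit_deg k ?n \<union> ?W (Suc r)"
      proof (rule image_subsetI)
        fix x assume x: "x \<in> hit_deg k (ndeg k (j + r)) \<union> ?W r"
        show "kameko_word k [i] x \<in> hit_deg k ?n \<union> ?W (Suc r)"
        proof (cases "x \<in> hit_deg k (ndeg k (j + r))")
          case True
          then show ?thesis using kameko_up_hit[of "j + r" i x] Si(2) assms(1) by simp
        next
          case False
          then obtain w y where w: "x = kameko_word k w y" "set w \<subseteq> {..<k}" "length w = r" "y \<in> Pk_deg k (ndeg k j)"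
            using x by auto
          then have "kameko_word k [i] x = kameko_word k (i # w) y" by simp
          then show ?thesis using w Si(2) by (intro UnI2 CollectI exI[of _ "i # w"] exI[of _ y]) auto
        qed
      qed
      ultimately have "kameko_word k [i] (mon h) \<in> v2.span (hit_deg k ?n \<union> ?W (Suc r))"
        using v2.span_mono by blast
      then show ?thesis using S(1) Si(1) by (simp add: kameko_up_def)
    qed
  qed (auto intro: v2.span_zero v2.span_add)
  then show ?case by simp
qed

lemma span_cwords:
  assumes "j \<ge> j0" "r \<ge> 1" 
  shows "Pk_deg k (ndeg k (j + r)) \<subseteq> v2.span (hit_deg k (ndeg k (j + r)) \<union>
    {kameko_set r J y | J y. J \<subseteq> {..<k} \<and> J \<noteq> {} \<and> card J \<le> r \<and> y \<in> Pk_deg k (ndeg k j)})"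
    (is "_ \<subseteq> v2.span (?H \<union> ?C)")
proof -
  have "kameko_word k w y \<in> v2.span (?H \<union> ?C)" if w: "set w \<subseteq> {..<k}" "length w = r" "y \<in> Pk_deg k (ndeg k j)" for w y
  proof -
    have w0: "w \<noteq> []" using w assms by auto
    have "kameko_word k w y + kameko_set r (set w) y \<in> ?H" using kameko_word_canonical[OF assms(1) w(3,1) w0] w(2) by simp
    moreover have "kameko_set r (set w) y \<in> ?C" using w w0 card_length[of w] by auto
    ultimately have "(kameko_word k w y + kameko_set r (set w) y) + kameko_set r (set w) y \<in> v2.span (?H \<union> ?C)"
      by (intro v2.span_add v2.span_base) auto
    then show ?thesis by (simp add: add.assoc)
  qed
  then have "?H \<union> {kameko_word k w y | w y. set w \<subseteq> {..<k} \<and> length w = r \<and> y \<in> Pk_deg k (ndeg k j)} \<subseteq> v2.span (?H \<union> ?C)"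
    using v2.span_superset[of "?H \<union> ?C"] by auto
  then show ?thesis
    using span_words[OF assms(1)] v2.span_minimal[OF _ v2.subspace_span] by blast
qed

text \<open>For empty \<open>U\<close> this is the relation for r-th powers of the operators, whose
  words have the single letter \<open>l\<close>. Otherwise a word of length r - 1 with letters
  \<open>U\<close> is applied to the relation with exponent 1, so that the letter set becomes
  \<open>insert l U\<close>; card U < r provides the room for \<open>l\<close>.\<close>

lemma sum_kameko_set_insert_hit:
  assumes "j \<ge> j0" "z \<in> Pk_deg k n" "Suc n = ndeg k j" "U \<subseteq> {..<k}" "card U < r"
  shows "(\<Sum>l<k. kameko_set r (insert l U) (var l * z)) \<in> hit_deg k (ndeg k (j + r))"
proof -
  have vz: "var l * z \<in> Pk_deg k (ndeg k j)" if "l < k" for l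
    using Pk_deg_mult[OF Pk_deg_var[OF that] assms(2)] assms(3) by simp
  have fU: "finite U" using assms(4) finite_subset by blast
  show ?thesis
  proof (cases "U = {}")
    case True
    have "(\<Sum>l<k. (kameko_up k l ^^ r) (var l * z)) \<in> hit_deg k (ndeg k (j + r))"
      using assms by (intro sum_kameko_up_hit) auto
    then show ?thesis
    proof (rule hit_deg_sum_cong)
      fix l assume "l \<in> {..<k}"
      then show "(kameko_up k l ^^ r) (var l * z) + kameko_set r (insert l U) (var l * z) \<in> hit_deg k (ndeg k (j + r))"
        using kameko_word_canonical[of j "var l * z" "replicate r l"] vz assms(1,5) True
        by (auto simp: kameko_word_replicate)
    qed
  next
    case False
    obtain r' where r: "r = Suc r'" "card U \<le> r'" using assms(5) by (cases r) auto
    let ?u = "canonical_word r' U"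
    have u: "set ?u = U" "length ?u = r'" using canonical_word[OF fU False r(2)] by auto
    have "(\<Sum>l<k. (kameko_up k l ^^ 1) (var l * z)) \<in> hit_deg k (ndeg k (j + 1))"
      using assms by (intro sum_kameko_up_hit) auto
    then have "kameko_word k ?u (\<Sum>l<k. kameko_up k l (var l * z)) \<in> hit_deg k (ndeg k (Suc j + length ?u))"
      using assms(1,4) u by (intro kameko_word_hit) auto
    then have "(\<Sum>l<k. kameko_word k (?u @ [l]) (var l * z)) \<in> hit_deg k (ndeg k (j + r))"
      by (simp add: kameko_word_sum kameko_word_append u r)
    then show ?thesis
    proof (rule hit_deg_sum_cong)
      fix l assume "l \<in> {..<k}"
      then show "kameko_word k (?u @ [l]) (var l * z) + kameko_set r (insert l U) (var l * z) \<in> hit_deg k (ndeg k (j + r))"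
        using kameko_word_canonical[of j "var l * z" "?u @ [l]"] vz assms(1,4) u r by auto
    qed
  qed
qed

lemma sum_Pow_insert:
  fixes g :: "nat set \<Rightarrow> poly2"
  assumes "l < k"
  shows "(\<Sum>U\<in>Pow {..<k}. g (insert l U)) = 0"
proof -
  let ?S = "{..<k} - {l}"
  have S: "{..<k} = insert l ?S" using assms by auto
  have "(\<Sum>U\<in>Pow {..<k}. g (insert l U)) = (\<Sum>U\<in>Pow ?S. g (insert l U)) + (\<Sum>U\<in>insert l ` Pow ?S. g (insert l U))"
    by (subst S, subst Pow_insert, rule sum.union_disjoint) auto
  also have "(\<Sum>U\<in>insert l ` Pow ?S. g (insert l U)) = (\<Sum>U\<in>Pow ?S. g (insert l U))"
    by (subst sum.reindex) (auto simp: inj_on_def)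
  finally show ?thesis by simp
qed

text \<open>
  For U = {..<k} and r = k the preceding argument has no room. But the relations for all U
  together cancel in pairs U, insert l U, so the missing one is the sum of the others.
\<close>

lemma sum_kameko_set_insert_hit_all:
  assumes "j \<ge> j0" "z \<in> Pk_deg k n" "Suc n = ndeg k j" "U \<subseteq> {..<k}" "k \<le> r"
  shows "(\<Sum>l<k. kameko_set r (insert l U) (var l * z)) \<in> hit_deg k (ndeg k (j + r))"
proof (cases "U = {..<k}")
  case False
  then have "card U < k" using assms(4) psubset_card_mono[of "{..<k}" U] by auto
  then show ?thesis using sum_kameko_set_insert_hit[OF assms(1-4)] assms(5) by simp
next
  case True
  let ?E = "\<lambda>U. \<Sum>l<k. kameko_set r (insert l U) (var l * z)"
  have "(\<Sum>U\<in>Pow {..<k}. ?E U) = 0"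
    by (subst sum.swap) (auto intro!: sum.neutral sum_Pow_insert)
  then have eq: "?E {..<k} + (\<Sum>U\<in>Pow {..<k} - {{..<k}}. ?E U) = 0"
    by (subst (asm) sum.remove[of _ "{..<k}"]) auto
  have "(\<Sum>U\<in>Pow {..<k} - {{..<k}}. ?E U) \<in> hit_deg k (ndeg k (j + r))"
  proof (rule hit_deg_sum)
    fix U assume U: "U \<in> Pow {..<k} - {{..<k}}"
    then have "card U < k" using psubset_card_mono[of "{..<k}" U] by auto
    then show "?E U \<in> hit_deg k (ndeg k (j + r))" using U assms by (intro sum_kameko_set_insert_hit) auto
  qed
  then have "?E {..<k} \<in> hit_deg k (ndeg k (j + r))"
    by (rule hit_deg_cancel[rotated]) (simp only: eq hit_deg_zero)
  then show ?thesis unfolding True .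
qed

text \<open>
  The relation for J trades the variable Min J for the other variables of J, up to terms
  belonging to the larger sets insert l J.
\<close>

lemma kameko_set_reduce:
  assumes "j0 \<le> j" "1 \<le> j" "k \<le> r"
    and base: "\<And>J m. J \<subseteq> {..<k} \<Longrightarrow> J \<noteq> {} \<Longrightarrow> mon m \<in> Pk_deg k (ndeg k j) \<Longrightarrow> Min J \<notin> supp m \<Longrightarrow>
      mon m \<in> v2.span (hit_deg k (ndeg k j) \<union> B J)"
    and "J \<subseteq> {..<k}" "J \<noteq> {}" "y \<in> Pk_deg k (ndeg k j)"
  shows "kameko_set r J y \<in> v2.span (hit_deg k (ndeg k (j + r)) \<union> (\<Union>J\<in>{J. J \<subseteq> {..<k} \<and> J \<noteq> {}}. kameko_set r J ` B J))"
    (is "_ \<in> ?S")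
  using assms(5-7)
\<comment> \<open>The terms belonging to larger letter sets are absorbed by this outer
  induction.\<close>
proof (induction "k - card J" arbitrary: J y rule: less_induct)
  case less
  have fJ: "finite J" using less.prems finite_subset by blast
  have cJ: "card J \<le> r" using less.prems(1) card_mono[of "{..<k}" J] assms(3) by simp
  let ?i = "Min J"
  have iJ: "?i \<in> J" using fJ less.prems by simp
  note cw = canonical_word[OF fJ less.prems(2) cJ]
  from less.prems(3) show ?case
  proof (induction rule: Pk_deg_induct)
    case (mon m)
    then show ?case
    \<comment> \<open>Trading \<open>Min J\<close> for another variable of \<open>J\<close> lowers
      this exponent; at 0 the monomial lives in k - 1 variables and \<open>base\<close>
      applies.\<close>
    proof (induction "lkp m ?i" arbitrary: m rule: less_induct)
      case less': less
      show ?case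
      proof (cases "?i \<in> supp m")
        case False
        have "kameko_set r J (mon m) \<in> v2.span (kameko_word k (canonical_word r J) ` (hit_deg k (ndeg k j) \<union> B J))"
          by (rule kameko_word_span[OF base[OF less.prems(1,2) less'.prems False]])
        moreover have "kameko_word k (canonical_word r J) ` (hit_deg k (ndeg k j) \<union> B J) \<subseteq> hit_deg k (ndeg k (j + r)) \<union>
            (\<Union>J\<in>{J. J \<subseteq> {..<k} \<and> J \<noteq> {}}. kameko_set r J ` B J)"
          using kameko_word_hit[of j "canonical_word r J"] cw assms(1) less.prems(1,2) by auto
        ultimately show ?thesis using v2.span_mono by blast
      next
        case True
        define m' where "m' = m - Poly_Mapping.single ?i 1"
        have m: "m = Poly_Mapping.single ?i 1 + m'"
          using True by (intro poly_mapping_eqI)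
            (auto simp: m'_def lookup_add lookup_minus lookup_single when_def in_keys_iff)
        have m'k: "supp m' \<subseteq> {..<k}"
          using less'.prems unfolding m by (auto simp: in_keys_iff lookup_add subset_iff)
        have deg: "Suc (mdeg m') = ndeg k j" using less'.prems unfolding m by (simp add: mdeg_add)
        let ?z = "mon m'"
        have z: "?z \<in> Pk_deg k (mdeg m')" using m'k by simp
        have vz: "var l * ?z \<in> Pk_deg k (ndeg k j)" if "l < k" for l
          using Pk_deg_mult[OF Pk_deg_var[OF that] z] deg by simp
        have "(\<Sum>l<k. kameko_set r (insert l J) (var l * ?z)) \<in> ?S"
          using sum_kameko_set_insert_hit_all[OF assms(1) z deg less.prems(1) assms(3)] by (intro v2.span_base) auto
        moreover have "kameko_set r (insert l J) (var l * ?z) \<in> ?S" if l: "l \<in> {..<k} - {?i}" for l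
        proof (cases "l \<in> J")
          case False
          have "card (insert l J) \<le> k" using l less.prems(1) card_mono[of "{..<k}" "insert l J"] by auto
          then show ?thesis
            using less.hyps[of "insert l J" "var l * ?z"] vz l False fJ less.prems(1) by auto
        next
          case True
          have e: "var l * ?z = mon (Poly_Mapping.single l 1 + m')" by (simp add: var_def mon_mult)
          have "kameko_set r J (mon (Poly_Mapping.single l 1 + m')) \<in> ?S"
          proof (rule less'.hyps)
            show "lkp (Poly_Mapping.single l 1 + m') ?i < lkp m ?i"
              unfolding m using l by (simp add: lookup_add lookup_single)
            show "mon (Poly_Mapping.single l 1 + m') \<in> Pk_deg k (ndeg k j)"
              using vz[of l] l unfolding e by simp
          qed
          then show ?thesis using True unfolding e by (simp add: insert_absorb)
        qed
        then have "(\<Sum>l\<in>{..<k} - {?i}. kameko_set r (insert l J) (var l * ?z)) \<in> ?S"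
          by (rule v2.span_sum)
        moreover have "(\<Sum>l<k. kameko_set r (insert l J) (var l * ?z)) = kameko_set r J (mon m) +
            (\<Sum>l\<in>{..<k} - {?i}. kameko_set r (insert l J) (var l * ?z))"
        proof -
          have "var ?i * ?z = mon m" by (simp add: m var_def mon_mult)
          then show ?thesis using iJ less.prems(1)
            by (subst sum.remove[of _ ?i]) (auto simp: insert_absorb)
        qed
        ultimately show ?thesis
          using v2.span_add[of "\<Sum>l<k. kameko_set r (insert l J) (var l * ?z)" _ "\<Sum>l\<in>{..<k} - {?i}. kameko_set r (insert l J) (var l * ?z)"]
          by (simp add: add.assoc)
      qed
    qed
  qed (auto simp: kameko_word_add intro: v2.span_zero v2.span_add)
qed

end

section \<open>Degree h in h variables\<close>

text \<open>
  Index (S, a) stands for the product of the variables in S times the square of the variable a.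
  For a outside S the choice a = Min is omitted because of the relation Sq 1 of the product
  over insert a S.
\<close>

definition low_index :: "nat set \<Rightarrow> (nat set \<times> nat) set" where
  "low_index H = {(S, a). S \<subseteq> H \<and> a \<in> H \<and> card S = card H - 2 \<and> (a \<in> S \<or> a \<noteq> Min (insert a S))}"

definition low_mono :: "nat set \<times> nat \<Rightarrow> poly2" where
  "low_mono p = var (snd p) ^ 2 * vprod (fst p)"

lemma finite_low_index: "finite H \<Longrightarrow> finite (low_index H)"
  by (rule finite_subset[of _ "Pow H \<times> H"]) (auto simp: low_index_def)

text \<open>Pairs with \<open>a\<close> in \<open>S\<close> number binom(h, h - 2) (h - 2). The
  others correspond to a set V = insert a S of size h - 1 with a distinguished non-minimal element,
  hence number binom(h, h - 1) (h - 2). Pascal's rule adds the two binomials.\<close>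

lemma card_low_index:
  assumes "finite H" "card H = h" "h \<ge> 2"
  shows "card (low_index H) = (h - 2) * (Suc h choose 2)"
proof -
  let ?A = "SIGMA S:{S. S \<subseteq> H \<and> card S = h - 2}. S"
  let ?B = "SIGMA V:{V. V \<subseteq> H \<and> card V = h - 1}. V - {Min V}"
  let ?f = "\<lambda>(V, a). (V - {a :: nat}, a)"
  have fin: "finite S" if "S \<subseteq> H" for S using that assms(1) finite_subset by blast
  have low_index: "low_index H = ?A \<union> ?f ` ?B"
  proof (intro equalityI subsetI)
    fix p assume "p \<in> low_index H"
    then obtain S a where p: "p = (S, a)" "S \<subseteq> H" "a \<in> H" "card S = h - 2" "a \<in> S \<or> a \<noteq> Min (insert a S)"
      using assms by (auto simp: low_index_def)
    show "p \<in> ?A \<union> ?f ` ?B"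
    proof (cases "a \<in> S")
      case False
      then have "card (insert a S) = h - 1" using p fin[of S] assms(3) by simp
      then have "(insert a S, a) \<in> ?B" using p False by auto
      moreover have "p = ?f (insert a S, a)" using p False by simp
      ultimately show ?thesis by blast
    qed (use p in auto)
  next
    fix p assume p: "p \<in> ?A \<union> ?f ` ?B"
    show "p \<in> low_index H"
    proof (cases "p \<in> ?A")
      case False
      then obtain V a where V: "p = (V - {a}, a)" "V \<subseteq> H" "card V = h - 1" "a \<in> V" "a \<noteq> Min V"
        using p by auto
      then have "card (V - {a}) = h - 2" by simp
      then show ?thesis using V assms by (auto simp: low_index_def insert_absorb)
    qed (use assms in \<open>auto simp: low_index_def\<close>)
  qed
  have "card (low_index H) = card ?A + card (?f ` ?B)"
    unfolding low_index using assms(1) by (intro card_Un_disjoint finite_imageI finite_SigmaI) (auto intro: fin finite_subset[of _ "Pow H"])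
  also have "card (?f ` ?B) = card ?B"
    by (rule card_image) (auto simp: inj_on_def)
  also have "card ?A = (h choose (h - 2)) * (h - 2)"
    using assms fin by (subst card_SigmaI) (auto simp: n_subsets finite_subset[of _ "Pow H"])
  also have "card ?B = (h choose (h - 1)) * (h - 2)"
  proof -
    have "card (V - {Min V}) = h - 2" if "V \<subseteq> H" "card V = h - 1" for V
    proof -
      have "V \<noteq> {}" using that assms(3) by auto
      then show ?thesis using that fin[OF that(1)] by (simp add: card_Diff_singleton)
    qed
    then show ?thesis
      using assms fin by (subst card_SigmaI) (auto simp: n_subsets finite_subset[of _ "Pow H"])
  qed
  also have "(h choose (h - 2)) * (h - 2) + (h choose (h - 1)) * (h - 2) = (h - 2) * (Suc h choose 2)"
    using assms(3) binomial_symmetric[of 2 h] binomial_symmetric[of 1 h]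
    by (simp add: numeral_2_eq_2 algebra_simps)
  finally show ?thesis .
qed

lemma mono_degree_one:
  assumes "mon h \<in> Pk_deg k 1" "supp h \<subseteq> H"
  obtains a where "a \<in> H" "mon h = var a"
proof -
  have "h \<noteq> 0" using assms(1) by auto
  then obtain a where a: "a \<in> supp h" by (metis all_not_in_conv keys_eq_empty)
  define h' where "h' = h - Poly_Mapping.single a 1"
  have h: "h = Poly_Mapping.single a 1 + h'"
    using a by (intro poly_mapping_eqI)
      (auto simp: h'_def lookup_add lookup_minus lookup_single when_def in_keys_iff)
  have "mdeg h' = 0" using assms(1) unfolding h by (simp add: mdeg_add)
  then have "h' = 0"
    unfolding mdeg_def by (intro poly_mapping_eqI) (auto simp: in_keys_iff)
  then show ?thesis using that[of a] a assms(2) h by (auto simp: var_def)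
qed

lemma mono_degree_zero:
  assumes "mon h \<in> Pk_deg k 0"
  shows "mon h = 1"
proof -
  have "mdeg h = 0" using assms by simp
  then have "h = 0"
    unfolding mdeg_def by (intro poly_mapping_eqI) (auto simp: in_keys_iff)
  then show ?thesis by simp
qed

text \<open>For 3 or 4 variables the square part has degree 0, which gives the product of all
  variables, or degree 1, or the monomial is a full square and hence a top Steenrod square. In
  degree 1 an index with \<open>a = Min\<close> is expressed through the other indices with the same
  \<open>insert a S\<close>, all of which are admissible.\<close>

lemma span_low_index:
  assumes "H \<subseteq> {..<k}" "card H \<in> {3, 4}" "mon m \<in> Pk_deg k (card H)" "supp m \<subseteq> H"
  shows "mon m \<in> v2.span (hit_deg k (card H) \<union> insert (vprod H) (low_mono ` low_index H))" (is "_ \<in> ?S")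
proof -
  have fH: "finite H" using assms(1) finite_subset by blast
  obtain S h e where S: "S \<subseteq> supp m" "supp h \<subseteq> supp m" "mon m = vprod S * mon h ^ 2"
    "mon h \<in> Pk_deg k e" "card S + 2 * e = card H" "S \<subseteq> {..<k}"
    by (rule mono_decomp[OF assms(3)])
  have SH: "S \<subseteq> H" using S(1) assms(4) by blast
  have fS: "finite S" using SH fH by (rule finite_subset)
  consider "e = 0" | "e = 1" | "card S = 0" "e > 0"
    using S(5) assms(2) by fastforce
  then show ?thesis
  proof cases
    case 1
    then have "S = H" using S(5) SH fS fH card_subset_eq by auto
    then show ?thesis using 1 S mono_degree_zero[of h k] by (intro v2.span_base) auto
  next
    case 2
    obtain a where a: "a \<in> H" "mon h = var a"
      using mono_degree_one[of h k H] S(2,4) assms(4) 2 by auto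
    have m: "mon m = low_mono (S, a)" using S(3) a by (simp add: low_mono_def mult.commute)
    have cS: "card S = card H - 2" using S(5) 2 by simp
    show ?thesis
    proof (cases "(S, a) \<in> low_index H")
      case True
      then show ?thesis unfolding m by (intro v2.span_base) auto
    next
      case False
      let ?V = "insert a S"
      have aS: "a \<notin> S" "a = Min ?V" using False SH fS a cS by (auto simp: low_index_def)
      have fV: "finite ?V" "?V \<subseteq> H" using SH fS a by auto
      have "Sq 1 (vprod ?V) = (\<Sum>l\<in>?V. low_mono (?V - {l}, l))"
        unfolding Sq_1_vprod[OF fV(1)] sum_distrib_left
      proof (rule sum.cong[OF refl])
        fix l assume "l \<in> ?V"
        then show "vprod ?V * var l = low_mono (?V - {l}, l)"
          using vprod_remove[OF fV(1)] by (simp add: low_mono_def power2_eq_square algebra_simps)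
      qed
      also have "\<dots> = mon m + (\<Sum>l\<in>S. low_mono (?V - {l}, l))"
        using SH fS aS(1) by (simp add: m)
      finally have eq: "mon m = Sq 1 (vprod ?V) + (\<Sum>l\<in>S. low_mono (?V - {l}, l))" by (simp add: add.assoc)
      have "Sq 1 (vprod ?V) \<in> ?S"
      proof (intro v2.span_base UnI1 hit_deg_Sq)
        show "vprod ?V \<in> Pk_deg k (card ?V)" using fV assms(1) by (intro Pk_deg_vprod) auto
        show "card ?V + 1 = card H" using S(5) 2 aS SH fS by simp
      qed simp
      moreover have "(\<Sum>l\<in>S. low_mono (?V - {l}, l)) \<in> ?S"
      proof (rule v2.span_sum)
        fix l assume l: "l \<in> S"
        have 1: "insert l (?V - {l}) = ?V" using l by blast
        have 2: "card (?V - {l}) = card S" using l fS aS(1) by (simp add: card_Diff_singleton)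
        have 3: "l \<noteq> Min (insert l (?V - {l}))" unfolding 1 using l aS by metis
        have 4: "?V - {l} \<subseteq> H" "l \<in> H" using l fV(2) by auto
        have "(?V - {l}, l) \<in> low_index H"
          unfolding low_index_def mem_Collect_eq prod.case using 2 3 4 cS by (intro conjI disjI2) auto
        then show "low_mono (?V - {l}, l) \<in> ?S" by (intro v2.span_base) auto
      qed
      ultimately show ?thesis unfolding eq by (rule v2.span_add)
    qed
  next
    case 3
    then have "S = {}" using SH fS by simp
    then have "mon m = Sq e (mon h)" using S(3) Sq_top[OF S(4)] by (simp add: vprod_def)
    moreover have "Sq e (mon h) \<in> hit_deg k (card H)"
      using 3 S by (intro hit_deg_Sq[OF _ S(4)]) auto
    ultimately show ?thesis by (intro v2.span_base) auto
  qed
qed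

section \<open>Upper bounds\<close>

text \<open>The words start from degree k - 1, so they have length d - 1, and the hypothesis d > k
  supplies the at least k letters that \<open>kameko_set_reduce\<close> asks for. Each nonempty
  letter set then contributes at most the generators in k - 1 variables.\<close>

lemma QP_dim_upper:
  assumes "k \<in> {4, 5}" "d > k"
  shows "QP_dim k (ndeg k d) \<le> (\<Sum>u=1..k. k choose u) * (1 + (k - 3) * (k choose 2))"
proof -
  interpret kameko k 1
    by unfold_locales (use assms low_weight_hit_ndeg in auto)
  let ?r = "d - 1"
  let ?H = "\<lambda>J. {..<k} - {Min J}"
  let ?B = "\<lambda>J. insert (vprod (?H J)) (low_mono ` low_index (?H J))"
  let ?Js = "{J. J \<subseteq> {..<k} \<and> J \<noteq> {}}"
  let ?E = "\<Union>J\<in>?Js. kameko_set ?r J ` ?B J"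
  have cH: "card (?H J) = k - 1" if "J \<in> ?Js" for J
  proof -
    have "Min J \<in> J" using that finite_subset[of J "{..<k}"] by auto
    then show ?thesis using that by auto
  qed
  have n1: "ndeg k 1 = k - 1" by (simp add: ndeg_def)
  have jr: "1 + ?r = d" using assms by simp
  have "kameko_set ?r J y \<in> v2.span (hit_deg k (ndeg k (1 + ?r)) \<union> ?E)"
    if "J \<subseteq> {..<k}" "J \<noteq> {}" "y \<in> Pk_deg k (ndeg k 1)" for J y
  proof (rule kameko_set_reduce[OF _ _ _ _ that])
    fix J m assume J: "J \<subseteq> {..<k}" "J \<noteq> {}" "mon m \<in> Pk_deg k (ndeg k 1)" "Min J \<notin> supp m"
    then have s: "supp m \<subseteq> {..<k} - {Min J}" by auto
    from J show "mon m \<in> v2.span (hit_deg k (ndeg k 1) \<union> ?B J)"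
      using span_low_index[of "?H J" k m] cH[of J] assms(1) s unfolding n1 by auto
  qed (use assms in auto)
  then have "hit_deg k (ndeg k (1 + ?r)) \<union>
    {kameko_set ?r J y | J y. J \<subseteq> {..<k} \<and> J \<noteq> {} \<and> card J \<le> ?r \<and> y \<in> Pk_deg k (ndeg k 1)}
    \<subseteq> v2.span (hit_deg k (ndeg k (1 + ?r)) \<union> ?E)"
    using v2.span_superset[of "hit_deg k (ndeg k (1 + ?r)) \<union> ?E"] by auto
  then have "v2.span (hit_deg k (ndeg k (1 + ?r)) \<union>
    {kameko_set ?r J y | J y. J \<subseteq> {..<k} \<and> J \<noteq> {} \<and> card J \<le> ?r \<and> y \<in> Pk_deg k (ndeg k 1)})
    \<subseteq> v2.span (hit_deg k (ndeg k (1 + ?r)) \<union> ?E)"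
    by (rule v2.span_minimal) (rule v2.subspace_span)
  moreover have "Pk_deg k (ndeg k (1 + ?r)) \<subseteq> v2.span (hit_deg k (ndeg k (1 + ?r)) \<union>
    {kameko_set ?r J y | J y. J \<subseteq> {..<k} \<and> J \<noteq> {} \<and> card J \<le> ?r \<and> y \<in> Pk_deg k (ndeg k 1)})"
    using assms by (intro span_cwords) auto
  ultimately have "Pk_deg k (ndeg k d) \<subseteq> v2.span (hit_deg k (ndeg k d) \<union> ?E)"
    unfolding jr by (rule order_trans[rotated])
  moreover have fE: "finite ?E" using finite_low_index by auto
  ultimately have "QP_dim k (ndeg k d) \<le> card ?E" by (rule QP_dim_le)
  also have "\<dots> \<le> (\<Sum>J\<in>?Js. card (kameko_set ?r J ` ?B J))"
    by (rule card_UN_le) auto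
  also have "\<dots> \<le> (\<Sum>J\<in>?Js. 1 + (k - 3) * (k choose 2))"
  proof (rule sum_mono)
    fix J assume J: "J \<in> ?Js"
    have "card (kameko_set ?r J ` ?B J) \<le> card (?B J)" by (rule card_image_le) (auto simp: finite_low_index)
    also have "\<dots> \<le> Suc (card (low_mono ` low_index (?H J)))" by (rule card_insert_le_m1) auto
    also have "\<dots> \<le> Suc (card (low_index (?H J)))" by (simp add: card_image_le finite_low_index)
    also have "card (low_index (?H J)) = (k - 3) * (k choose 2)"
      using card_low_index[of "?H J" "k - 1"] cH[OF J] assms(1) by auto
    finally show "card (kameko_set ?r J ` ?B J) \<le> 1 + (k - 3) * (k choose 2)" by simp
  qed
  also have "\<dots> = card ?Js * (1 + (k - 3) * (k choose 2))" by simp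
  also have "card ?Js = (\<Sum>u=1..k. k choose u)"
  proof -
    have "?Js = {J. J \<subseteq> {..<k} \<and> J \<noteq> {} \<and> card J \<le> k}"
      using card_mono[of "{..<k}"] by auto
    then show ?thesis using card_nonempty_subsets[of "{..<k}" k] by simp
  qed
  finally show ?thesis .
qed

text \<open>For k = 3 the words start from degree 0, where 1 is the only nonzero polynomial. So
  there is one generator for each letter set that fits into a word of length
  \<open>d\<close>.\<close>

lemma QP_dim_upper_3:
  assumes "d \<ge> 1"
  shows "QP_dim 3 (ndeg 3 d) \<le> (\<Sum>t=1..min 3 d. 3 choose t)"
proof -
  interpret kameko 3 0
    by unfold_locales (use low_weight_hit_ndeg in auto)
  let ?Js = "{J. J \<subseteq> {..<3::nat} \<and> J \<noteq> {} \<and> card J \<le> min 3 d}"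
  let ?E = "(\<lambda>J. kameko_set d J 1) ` ?Js"
  have fJ: "finite ?Js" by (rule finite_subset[of _ "Pow {..<3}"]) auto
  have one: "y = 0 \<or> y = 1" if "y \<in> Pk_deg 3 0" for y
    using that by (induction rule: Pk_deg_induct) (use mono_degree_zero in auto)
  have "hit_deg 3 (ndeg 3 (0 + d)) \<union>
    {kameko_set d J y | J y. J \<subseteq> {..<3} \<and> J \<noteq> {} \<and> card J \<le> d \<and> y \<in> Pk_deg 3 (ndeg 3 0)}
    \<subseteq> v2.span (hit_deg 3 (ndeg 3 (0 + d)) \<union> ?E)"
  proof (intro subsetI)
    fix x assume x: "x \<in> hit_deg 3 (ndeg 3 (0 + d)) \<union>
      {kameko_set d J y | J y. J \<subseteq> {..<3} \<and> J \<noteq> {} \<and> card J \<le> d \<and> y \<in> Pk_deg 3 (ndeg 3 0)}"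
    show "x \<in> v2.span (hit_deg 3 (ndeg 3 (0 + d)) \<union> ?E)"
    proof (cases "x \<in> hit_deg 3 (ndeg 3 (0 + d))")
      case False
      then obtain J y where J: "x = kameko_set d J y" "J \<subseteq> {..<3}" "J \<noteq> {}" "card J \<le> d" "y \<in> Pk_deg 3 0"
        using x by auto
      have "card J \<le> 3" using card_mono[OF _ J(2)] by simp
      then show ?thesis using one[OF J(5)] J by (auto intro: v2.span_base v2.span_zero)
    qed (intro v2.span_base UnI1)
  qed
  then have "v2.span (hit_deg 3 (ndeg 3 (0 + d)) \<union>
    {kameko_set d J y | J y. J \<subseteq> {..<3} \<and> J \<noteq> {} \<and> card J \<le> d \<and> y \<in> Pk_deg 3 (ndeg 3 0)})
    \<subseteq> v2.span (hit_deg 3 (ndeg 3 (0 + d)) \<union> ?E)"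
    by (rule v2.span_minimal) (rule v2.subspace_span)
  then have "Pk_deg 3 (ndeg 3 d) \<subseteq> v2.span (hit_deg 3 (ndeg 3 d) \<union> ?E)"
    using span_cwords[of 0 d] assms by simp
  then have "QP_dim 3 (ndeg 3 d) \<le> card ?E" using fJ by (intro QP_dim_le) auto
  also have "\<dots> \<le> card ?Js" using fJ by (rule card_image_le)
  also have "\<dots> = (\<Sum>t=1..min 3 d. 3 choose t)" using card_nonempty_subsets[of "{..<3::nat}" "min 3 d"] by simp
  finally show ?thesis .
qed

section \<open>Functionals vanishing on hit polynomials\<close>

lemma even_choose_double: "even ((2 * a) choose (2 * c + 1))"
proof -
  have "(2 * c + 1) * ((2 * a) choose (2 * c + 1)) = 2 * a * ((2 * a - 1) choose (2 * c))"
    using times_binomial_minus1_eq[of "2 * c + 1" "2 * a"] by simp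
  then have "even ((2 * c + 1) * ((2 * a) choose (2 * c + 1)))" by simp
  then show ?thesis by simp
qed

lemma choose_double_parity: "even ((2 * a) choose (2 * c)) = even (a choose c)"
proof (induction a arbitrary: c)
  case 0
  then show ?case by (cases c) auto
next
  case (Suc a)
  show ?case
  proof (cases c)
    case (Suc c')
    have "(2 * Suc a) choose (2 * c) = ((2 * a) choose (2 * c')) + 2 * ((2 * a) choose (2 * c' + 1)) + ((2 * a) choose (2 * Suc c'))"
      by (simp add: Suc)
    then show ?thesis using Suc.IH[of c'] Suc.IH[of "Suc c'"] even_choose_double[of a c'] by (simp add: Suc)
  qed auto
qed

text \<open>An instance of Lucas' theorem: \<open>a\<close> and \<open>c\<close> have complementary
  binary digits, so a digit 1 of \<open>c\<close> meets a digit 0 of \<open>a\<close>. The induction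
  strips the last digit.\<close>

lemma even_choose_spike: "a + c = 2 ^ b - 1 \<Longrightarrow> c > 0 \<Longrightarrow> even (a choose c)"
proof (induction b arbitrary: a c)
  case (Suc b)
  show ?case
  proof (cases "even a")
    case True
    then obtain a' where a: "a = 2 * a'" by (rule evenE)
    have "odd c" using Suc.prems(1) True by (metis even_add even_power one_le_numeral odd_even_add two_power_Suc_minus_one even_Suc even_mult_iff dvd_refl)
    then obtain c' where "c = 2 * c' + 1" by (rule oddE)
    then show ?thesis using even_choose_double a by simp
  next
    case False
    then obtain a' where a: "a = 2 * a' + 1" by (rule oddE)
    have e: "a + c = Suc ((2 ^ b - 1) * 2)" using Suc.prems(1) unfolding two_power_Suc_minus_one .
    then have "even c" using False by presburger
    then obtain c' where c: "c = 2 * c'" by (rule evenE)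
    then obtain c'' where c'': "c' = Suc c''" using Suc.prems(2) by (cases c') auto
    have "even (a' choose c')" using e Suc.prems(2) unfolding a c by (intro Suc.IH) auto
    then have "even ((2 * a') choose (2 * c'))" by (simp add: choose_double_parity)
    moreover have "a choose c = ((2 * a') choose (2 * c')) + ((2 * a') choose (2 * c'' + 1))"
      unfolding a c c'' by simp
    ultimately show ?thesis using even_choose_double[of a' c''] by simp
  qed
qed simp

definition lin :: "nat set \<Rightarrow> poly2" where "lin S = (\<Sum>l\<in>S. var l)"

text \<open>Over F_2 a linear form is determined by its finite set of variables. Singular
  substitutions are included, since restriction to a hyperplane is one.\<close>

definition linear_subst :: "(nat \<Rightarrow> poly2) \<Rightarrow> bool" where
  "linear_subst A \<longleftrightarrow> (\<forall>i. \<exists>S. finite S \<and> A i = lin S)"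

definition spike :: "mono \<Rightarrow> bool" where
  "spike s \<longleftrightarrow> (\<forall>i. \<exists>b. lkp s i = 2 ^ b - 1)"

lemma lin_singleton [simp]: "lin {i} = var i"
  by (simp add: lin_def)

lemma total_Sq_lin: "total_Sq (lin S) = [:lin S, lin S ^ 2:]"
  by (induction S rule: infinite_finite_induct) (auto simp: lin_def total_Sq_add poly2_square_add)

text \<open>Both sides are ring homomorphisms. They agree on variables because squaring is additive,
  so a linear form u has total square u + u^2 t just as a variable has.\<close>

lemma total_Sq_ev:
  assumes "linear_subst A"
  shows "total_Sq (ev A f) = map_poly (ev A) (total_Sq f)"
proof (rule hom_unique[of "\<lambda>f. total_Sq (ev A f)"])
  have cm: "coeff (map_poly (ev A) p) n = ev A (coeff p n)" for p n
    by (simp add: coeff_map_poly)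
  show "map_poly (ev A) (total_Sq (f * g)) = map_poly (ev A) (total_Sq f) * map_poly (ev A) (total_Sq g)" for f g
    by (rule poly_eqI) (simp add: cm coeff_mult total_Sq_mult ev_sum ev_mult)
  show "map_poly (ev A) (total_Sq (f + g)) = map_poly (ev A) (total_Sq f) + map_poly (ev A) (total_Sq g)" for f g
    by (rule poly_eqI) (simp add: cm total_Sq_add ev_add)
  show "map_poly (ev A) (total_Sq 1) = 1" by (simp add: map_poly_1')
  show "total_Sq (ev A (var i)) = map_poly (ev A) (total_Sq (var i))" for i
  proof -
    obtain S where "A i = lin S" using assms by (auto simp: linear_subst_def)
    then show ?thesis by (simp add: total_Sq_lin map_poly_pCons ev_pow)
  qed
qed (auto simp: ev_add ev_mult total_Sq_add total_Sq_mult)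

lemma Sq_ev: "linear_subst A \<Longrightarrow> Sq i (ev A f) = ev A (Sq i f)"
  by (simp add: Sq_eq_coeff_total_Sq total_Sq_ev coeff_map_poly)

text \<open>If m + e = s with \<open>e\<close> nonzero, some variable has a positive exponent in
  \<open>e\<close>, and there the exponents of \<open>m\<close> and \<open>e\<close> add up to 2^b -
  1. Its binomial coefficient is even and the summand vanishes.\<close>

lemma spike_coeff_Sq:
  assumes "spike s" "i > 0"
  shows "lkp (Sq i f) s = 0"
proof (induction f rule: poly2_induct)
  case (mon m)
  have "lkp (Poly_Mapping.single (m + e) (\<Prod>j\<in>supp m. of_nat (lkp m j choose lkp e j) :: bit)) s = 0"
    if e: "supp e \<subseteq> supp m" "mdeg e = i" for e
  proof (cases "m + e = s")
    case True
    have "e \<noteq> 0" using e(2) assms(2) by auto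
    then obtain j where j: "j \<in> supp e" by (metis all_not_in_conv keys_eq_empty)
    obtain b where "lkp s j = 2 ^ b - 1" using assms(1) by (auto simp: spike_def)
    then have "even (lkp m j choose lkp e j)"
      using j True by (intro even_choose_spike) (auto simp: in_keys_iff lookup_add)
    then have "(of_nat (lkp m j choose lkp e j) :: bit) = 0" by (auto elim!: evenE)
    then have "(\<Prod>j\<in>supp m. of_nat (lkp m j choose lkp e j) :: bit) = 0"
      using j e(1) by (intro prod_zero) auto
    then show ?thesis unfolding lookup_single by (simp only: zero_when)
  qed (simp add: lookup_single)
  then show ?case
    unfolding Sq_mon Sq_mono_def lookup_sum by (intro sum.neutral) blast
qed (auto simp: Sq_add lookup_add)

lemma spike_functional_hit:
  assumes "linear_subst A" "spike s" "f \<in> hit k"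
  shows "lkp (ev A f) s = 0"
proof -
  let ?S = "{f. lkp (ev A f) s = 0}"
  have "hit k \<subseteq> ?S"
    unfolding hit_def
  proof (rule v2.span_minimal)
    show "v2.subspace ?S" by (rule subspace2I) (auto simp: ev_add lookup_add)
    show "{Sq i f | i f. 0 < i \<and> f \<in> Pk k} \<subseteq> ?S"
      using assms by (auto simp: spike_coeff_Sq simp flip: Sq_ev)
  qed
  then show ?thesis using assms(3) by blast
qed

text \<open>This is \<open>QP_dim_ge\<close> for the family enlarged by \<open>c\<close>; the index
  \<open>None\<close> stands for \<open>c\<close>.\<close>

lemma QP_dim_gt:
  assumes "finite A" "\<And>a. a \<in> A \<Longrightarrow> e a \<in> Pk_deg k n" "c \<in> Pk_deg k n"
    and "\<And>T. T \<subseteq> A \<Longrightarrow> T \<noteq> {} \<Longrightarrow> (\<Sum>a\<in>T. e a) \<notin> hit k"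
    and "\<And>T. T \<subseteq> A \<Longrightarrow> c + (\<Sum>a\<in>T. e a) \<notin> hit k"
  shows "card A < QP_dim k n"
proof -
  let ?A = "insert None (Some ` A)" and ?e = "case_option c e"
  have "card ?A \<le> QP_dim k n"
  proof (rule QP_dim_ge)
    show "finite ?A" using assms(1) by simp
    show "?e a \<in> Pk_deg k n" if "a \<in> ?A" for a using that assms(2,3) by auto
    show "(\<Sum>a\<in>T. ?e a) \<notin> hit k" if T: "T \<subseteq> ?A" "T \<noteq> {}" for T
    proof -
      define T' where "T' = {a. Some a \<in> T}"
      have T': "T' \<subseteq> A" using T by (auto simp: T'_def)
      then have fin: "finite T'" using assms(1) finite_subset by blast
      have s: "(\<Sum>a\<in>Some ` T'. ?e a) = (\<Sum>a\<in>T'. e a)" by (subst sum.reindex) auto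
      show ?thesis
      proof (cases "None \<in> T")
        case True
        then have "T = insert None (Some ` T')" using T by (auto simp: T'_def)
        then have "(\<Sum>a\<in>T. ?e a) = c + (\<Sum>a\<in>T'. e a)" using fin s by simp
        then show ?thesis using assms(5)[OF T'] by simp
      next
        case False
        then have Ts: "T = Some ` T'" using T by (auto simp: T'_def)
        then have "T' \<noteq> {}" using T(2) by auto
        then show ?thesis using assms(4)[OF T'] Ts s by simp
      qed
    qed
  qed
  then show ?thesis using assms(1) by (simp add: card_image)
qed

section \<open>Square-free coefficients\<close>

definition ones :: "nat set \<Rightarrow> mono" where "ones S = (\<Sum>i\<in>S. Poly_Mapping.single i 1)"

lemma lookup_ones: "finite S \<Longrightarrow> lkp (ones S) i = of_bool (i \<in> S)"
  by (simp add: ones_def lookup_sum lookup_single when_def sum.delta)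

lemma vprod_ones: "finite S \<Longrightarrow> vprod S = mon (ones S)"
  by (simp add: vprod_eq_mon ones_def)

lemma supp_ones: "finite S \<Longrightarrow> supp (ones S) = S"
  by (auto simp: in_keys_iff lookup_ones)

text \<open>Differs from \<open>Pk_deg\<close> in allowing any set of variables: restriction to a
  hyperplane removes \<open>Min I\<close>, which may be any of the first k variables.\<close>

definition homog_in :: "nat set \<Rightarrow> nat \<Rightarrow> poly2 set" where
  "homog_in H n = {f. \<forall>m\<in>supp f. supp m \<subseteq> H \<and> mdeg m = n}"

lemma homog_in_zero [simp]: "0 \<in> homog_in H n" and homog_in_one [simp]: "1 \<in> homog_in H 0"
  by (auto simp: homog_in_def)

lemma homog_in_add: "f \<in> homog_in H n \<Longrightarrow> g \<in> homog_in H n \<Longrightarrow> f + g \<in> homog_in H n"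
  using keys_add[of f g] by (auto simp: homog_in_def)

lemma homog_in_sum: "(\<And>i. i \<in> F \<Longrightarrow> g i \<in> homog_in H n) \<Longrightarrow> (\<Sum>i\<in>F. g i) \<in> homog_in H n"
  by (induction F rule: infinite_finite_induct) (auto intro: homog_in_add)

lemma homog_in_mult:
  assumes "f \<in> homog_in H a" "g \<in> homog_in H b"
  shows "f * g \<in> homog_in H (a + b)"
  unfolding homog_in_def
proof (rule CollectI, rule ballI)
  fix m assume "m \<in> supp (f * g)"
  then obtain p q where "m = p + q" "p \<in> supp f" "q \<in> supp g"
    using keys_mult[of f g] by blast
  then show "supp m \<subseteq> H \<and> mdeg m = a + b"
    using assms keys_add[of p q] by (fastforce simp: homog_in_def mdeg_add)
qed

lemma homog_in_prod: "(\<And>i. i \<in> S \<Longrightarrow> f i \<in> homog_in H 1) \<Longrightarrow> finite S \<Longrightarrow> (\<Prod>i\<in>S. f i) \<in> homog_in H (card S)"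
proof (induction S rule: infinite_finite_induct)
  case (insert x S)
  then have "f x * prod f S \<in> homog_in H (1 + card S)" by (intro homog_in_mult) auto
  then show ?case using insert.hyps by simp
qed auto

lemma homog_in_lin: "S \<subseteq> H \<Longrightarrow> lin S \<in> homog_in H 1"
  unfolding lin_def by (rule homog_in_sum) (auto simp: homog_in_def var_def split: if_splits)

lemma homog_in_induct [consumes 1, case_names zero mon add]:
  assumes "f \<in> homog_in H n" "P 0"
    and "\<And>m. supp m \<subseteq> H \<Longrightarrow> mdeg m = n \<Longrightarrow> P (mon m)"
    and "\<And>f g. P f \<Longrightarrow> P g \<Longrightarrow> P (f + g)"
  shows "P f"
proof -
  have *: "P (\<Sum>m\<in>F. mon m)" if "finite F" "\<forall>m\<in>F. supp m \<subseteq> H \<and> mdeg m = n" for F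
    using that by induction (auto intro!: assms)
  have "P (\<Sum>m\<in>supp f. mon m)" by (rule *) (use assms(1) in \<open>auto simp: homog_in_def\<close>)
  then show ?thesis by (simp only: poly2_as_sum[symmetric])
qed

lemma eq_ones_if_positive:
  assumes "finite H" "supp m \<subseteq> H" "mdeg m = card H" "\<And>i. i \<in> H \<Longrightarrow> lkp m i \<ge> 1"
  shows "m = ones H"
proof (rule poly_mapping_eqI, rule ccontr)
  fix i assume ne: "lkp m i \<noteq> lkp (ones H) i"
  have i: "i \<in> H"
  proof (rule ccontr)
    assume "i \<notin> H"
    then have "lkp m i = 0" "lkp (ones H) i = 0"
      using assms(1,2) by (auto simp: lookup_ones in_keys_iff subset_iff)
    then show False using ne by simp
  qed
  have "(\<Sum>j\<in>H. 1) < (\<Sum>j\<in>H. lkp m j)"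
    using assms(1,4) i ne by (intro sum_strict_mono_ex1) (auto simp: lookup_ones intro!: bexI[of _ i] le_neq_implies_less)
  then show False using assms mdeg_superset[of H m] by simp
qed

text \<open>Every variable of \<open>H\<close> has an odd exponent in the target, so the monomial
  taken from \<open>u\<close> must contain each of them, and its degree leaves only
  \<open>ones H\<close>.\<close>

lemma coeff_mult_square:
  assumes "finite H" "u \<in> homog_in H (card H)"
  shows "lkp (u * v ^ 2) (ones H + (m + m)) = lkp u (ones H) * lkp v m"
  using assms(2)
proof (induction rule: homog_in_induct)
  case (mon a)
  show ?case
  proof (induction v rule: poly2_induct)
    case (mon b)
    have "a + (b + b) = ones H + (m + m) \<longleftrightarrow> a = ones H \<and> b = m"
    proof
      assume e: "a + (b + b) = ones H + (m + m)"
      have l: "lkp a i + 2 * lkp b i = of_bool (i \<in> H) + 2 * lkp m i" for i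
        using arg_cong[OF e, of "\<lambda>p. lkp p i"] assms(1) by (simp add: lookup_add lookup_ones)
      have "lkp a i \<ge> 1" if "i \<in> H" for i using l[of i] that by (cases "lkp a i") (auto, presburger)
      then have a: "a = ones H" using \<open>supp a \<subseteq> H\<close> \<open>mdeg a = card H\<close> assms(1) by (intro eq_ones_if_positive) auto
      have "b = m" by (rule poly_mapping_eqI) (use l a assms(1) in \<open>simp add: lookup_ones\<close>)
      then show "a = ones H \<and> b = m" using a by blast
    qed auto
    then show ?case by (simp add: power2_eq_square mon_mult lookup_single when_def)
  qed (auto simp: poly2_square_add lookup_add ring_distribs)
qed (auto simp: lookup_add ring_distribs)

lemma coeff_ones_square_mult:
  assumes "finite H"
  shows "lkp (lin S ^ 2 * v) (ones H) = 0"
proof -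
  have "lkp (var l ^ 2 * v) (ones H) = 0" for l
  proof (induction v rule: poly2_induct)
    case (mon b)
    have "lkp (Poly_Mapping.single l 2 + b) l \<noteq> lkp (ones H) l"
      using assms by (simp add: lookup_add lookup_single lookup_ones)
    then show ?case by (auto simp: var_pow mon_mult lookup_single when_def)
  qed (auto simp: lookup_add ring_distribs)
  then show ?thesis
    by (simp add: lin_def poly2_square_sum sum_distrib_right lookup_sum)
qed

lemma coeff_ones_ev_square_mult:
  assumes "finite H" "linear_subst A"
  shows "lkp (ev A (var a ^ 2 * v)) (ones H) = 0"
proof -
  obtain S where "A a = lin S" using assms by (auto simp: linear_subst_def)
  then show ?thesis using coeff_ones_square_mult[OF assms(1)] by (simp add: ev_mult ev_pow)
qed

text \<open>The exponent pattern matching a word of length \<open>r\<close>: for each variable in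
  \<open>H\<close> the lowest r binary digits are 1, and above them stands the exponent in
  \<open>m\<close>.\<close>

fun spike_exp :: "nat set \<Rightarrow> nat \<Rightarrow> mono \<Rightarrow> mono" where
  "spike_exp H 0 m = m"
| "spike_exp H (Suc r) m = ones H + (spike_exp H r m + spike_exp H r m)"

lemma spike_exp_Suc_right: "spike_exp H (Suc r) m = spike_exp H r (ones H + (m + m))"
  by (induction r) auto

lemma spike_exp_spike:
  assumes "finite H" "spike m" "supp m \<subseteq> H"
  shows "spike (spike_exp H r m)"
proof -
  have "spike (spike_exp H r m) \<and> supp (spike_exp H r m) \<subseteq> H"
  proof (induction r)
    case (Suc r)
    have "\<exists>b. lkp (spike_exp H (Suc r) m) i = 2 ^ b - 1" for i
    proof (cases "i \<in> H")
      case True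
      obtain b where b: "lkp (spike_exp H r m) i = 2 ^ b - 1" using Suc by (auto simp: spike_def)
      have "lkp (spike_exp H (Suc r) m) i = 2 ^ Suc b - 1"
        unfolding two_power_Suc_minus_one using b True assms(1) by (simp add: lookup_add lookup_ones)
      then show ?thesis by blast
    next
      case False
      then have "lkp (spike_exp H r m) i = 0" using Suc by (auto simp: in_keys_iff)
      then have "lkp (spike_exp H (Suc r) m) i = 2 ^ 0 - 1" using False assms(1) by (simp add: lookup_add lookup_ones)
      then show ?thesis by blast
    qed
    moreover have "supp (spike_exp H (Suc r) m) \<subseteq> H"
      using Suc keys_add[of "ones H" "spike_exp H r m + spike_exp H r m"] keys_add[of "spike_exp H r m" "spike_exp H r m"]
        supp_ones[OF assms(1)] by auto
    ultimately show ?case by (auto simp: spike_def)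
  qed (use assms in auto)
  then show ?thesis by blast
qed

text \<open>Each letter \<open>j\<close> consumes one binary digit of the target and contributes the
  factor [j \<in> I]. The product of these factors tests whether all letters lie in
  \<open>I\<close>.\<close>

lemma coeff_ev_kameko_word:
  assumes "finite H" "\<And>j. j \<in> set w \<Longrightarrow> ev A (vprod ({..<k} - {j})) \<in> homog_in H (card H)"
    and "\<And>j. j \<in> set w \<Longrightarrow> lkp (ev A (vprod ({..<k} - {j}))) (ones H) = of_bool (j \<in> I)"
  shows "lkp (ev A (kameko_word k w y)) (spike_exp H (length w) m) = of_bool (set w \<subseteq> I) * lkp (ev A y) m"
  using assms(2,3)
proof (induction w)
  case (Cons i w)
  then show ?case
    using coeff_mult_square[OF assms(1), of "ev A (vprod ({..<k} - {i}))" "ev A (kameko_word k w y)" "spike_exp H (length w) m"]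
    by (simp add: kameko_up_def ev_mult ev_pow del: bit_not_zero_iff)
qed simp

text \<open>Restriction to the hyperplane where the variables in I add up to zero.\<close>

definition hyp_subst :: "nat set \<Rightarrow> nat \<Rightarrow> poly2" where
  "hyp_subst I i = (if i = Min I then lin (I - {Min I}) else var i)"

lemma linear_hyp_subst: "finite I \<Longrightarrow> linear_subst (hyp_subst I)"
  unfolding linear_subst_def hyp_subst_def by (metis finite.emptyI finite.insertI finite_Diff lin_singleton)

lemma ev_hyp_subst_vprod: "finite S \<Longrightarrow> Min I \<notin> S \<Longrightarrow> ev (hyp_subst I) (vprod S) = vprod S"
  unfolding vprod_def ev_prod[OF poly2_two] by (intro prod.cong) (auto simp: hyp_subst_def)

lemma ev_hyp_subst_lin:
  assumes "finite I" "I \<noteq> {}"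
  shows "ev (hyp_subst I) (lin I) = 0"
proof -
  have "lin I = var (Min I) + lin (I - {Min I})"
    unfolding lin_def using assms by (intro sum.remove) auto
  moreover have "ev (hyp_subst I) (lin (I - {Min I})) = lin (I - {Min I})"
    unfolding lin_def ev_sum[OF poly2_two] by (intro sum.cong) (auto simp: hyp_subst_def)
  ultimately show ?thesis by (simp add: ev_add) (simp add: hyp_subst_def)
qed

lemma homog_in_ev_hyp_subst_vprod:
  assumes "I \<subseteq> {..<k}" "I \<noteq> {}" "j < k"
  shows "ev (hyp_subst I) (vprod ({..<k} - {j})) \<in> homog_in ({..<k} - {Min I}) (card ({..<k} - {Min I}))"
proof -
  have fI: "finite I" using assms finite_subset by blast
  have M: "Min I < k" using assms fI Min_in by blast
  have "(\<Prod>i\<in>{..<k} - {j}. hyp_subst I i) \<in> homog_in ({..<k} - {Min I}) (card ({..<k} - {j}))"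
  proof (rule homog_in_prod)
    fix i assume "i \<in> {..<k} - {j}"
    then show "hyp_subst I i \<in> homog_in ({..<k} - {Min I}) 1"
      using homog_in_lin[of "{i}" "{..<k} - {Min I}"] homog_in_lin[of "I - {Min I}" "{..<k} - {Min I}"] assms(1)
      by (auto simp: hyp_subst_def)
  qed auto
  moreover have "ev (hyp_subst I) (vprod ({..<k} - {j})) = (\<Prod>i\<in>{..<k} - {j}. hyp_subst I i)"
    by (simp add: vprod_def ev_prod)
  moreover have "card ({..<k} - {j}) = card ({..<k} - {Min I})" using assms(3) M by simp
  ultimately show ?thesis by metis
qed

text \<open>For \<open>j = Min I\<close> the product is already \<open>ones\<close> of the remaining
  variables. Otherwise \<open>Min I\<close> is replaced by the sum of the other variables in
  \<open>I\<close>, and only the summand \<open>j\<close> restores the missing variable without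
  creating a square.\<close>

lemma coeff_ev_hyp_subst_vprod:
  assumes "I \<subseteq> {..<k}" "I \<noteq> {}" "j < k"
  shows "lkp (ev (hyp_subst I) (vprod ({..<k} - {j}))) (ones ({..<k} - {Min I})) = of_bool (j \<in> I)"
proof -
  let ?i = "Min I" and ?H = "{..<k} - {Min I}"
  have fI: "finite I" using assms finite_subset by blast
  have M: "?i < k" "?i \<in> I" using assms fI Min_in by blast+
  show ?thesis
  proof (cases "j = ?i")
    case True
    then show ?thesis using M by (simp add: ev_hyp_subst_vprod) (simp add: vprod_ones)
  next
    case False
    have e: "{..<k} - {j} - {?i} = ?H - {j}" by blast
    have "vprod ({..<k} - {j}) = var ?i * vprod (?H - {j})"
      using vprod_remove[of "{..<k} - {j}" ?i] M False unfolding e by simp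
    then have "ev (hyp_subst I) (vprod ({..<k} - {j})) = lin (I - {?i}) * vprod (?H - {j})"
      by (simp add: ev_mult ev_hyp_subst_vprod) (simp add: hyp_subst_def)
    also have "\<dots> = (\<Sum>l\<in>I - {?i}. mon (Poly_Mapping.single l 1 + ones (?H - {j})))"
      by (simp add: lin_def sum_distrib_right vprod_ones var_def mon_mult)
    finally have "lkp (ev (hyp_subst I) (vprod ({..<k} - {j}))) (ones ?H) =
        (\<Sum>l\<in>I - {?i}. of_bool (l = j))"
    proof (simp add: lookup_sum, intro sum.cong refl)
      fix l assume l: "l \<in> I - {?i}"
      have "Poly_Mapping.single l 1 + ones (?H - {j}) = ones ?H \<longleftrightarrow> l = j"
      proof
        assume "Poly_Mapping.single l 1 + ones (?H - {j}) = ones ?H"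
        then have "lkp (Poly_Mapping.single l 1 + ones (?H - {j})) j = lkp (ones ?H) j" by simp
        then show "l = j" using False assms(3) by (auto simp: lookup_add lookup_ones lookup_single when_def split: if_splits)
      next
        assume "l = j"
        then show "Poly_Mapping.single l 1 + ones (?H - {j}) = ones ?H"
          using False assms(3) by (intro poly_mapping_eqI) (auto simp: lookup_add lookup_ones lookup_single when_def)
      qed
      then show "lkp (mon (Poly_Mapping.single l (Suc 0) + ones (?H - {j}))) (ones ?H) = of_bool (l = j)"
        by (simp add: lookup_single when_def)
    qed
    then show ?thesis using fI False by (simp add: of_bool_def sum.delta)
  qed
qed

text \<open>A transvection instead of the outright identification of q with a, which would
  annihilate the coefficient of \<open>ones H\<close> needed at the lower binary digits. Against a
  target without q both have the same effect.\<close>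

definition transv :: "nat \<Rightarrow> nat \<Rightarrow> nat \<Rightarrow> poly2" where
  "transv q a i = (if i = q then var a + var q else var i)"

lemma transv_lin: "a \<noteq> q \<Longrightarrow> transv q a i = lin (if i = q then {a, q} else {i})"
  by (simp add: transv_def lin_def)

lemma linear_transv: "a \<noteq> q \<Longrightarrow> linear_subst (transv q a)"
  unfolding linear_subst_def by (metis transv_lin finite.emptyI finite.insertI)

text \<open>The sum of two linear forms belongs to the symmetric difference of their variable sets,
  since common variables cancel.\<close>

lemma linear_ev:
  assumes "linear_subst g" "linear_subst A"
  shows "linear_subst (\<lambda>i. ev g (A i))"
  unfolding linear_subst_def
proof
  fix i
  obtain S where S: "finite S" "A i = lin S" using assms(2) by (auto simp: linear_subst_def)
  have "\<exists>T. finite T \<and> (\<Sum>l\<in>S. g l) = lin T"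
    using S(1)
  proof (induction S rule: finite_induct)
    case empty
    then show ?case by (intro exI[of _ "{}"]) (simp add: lin_def)
  next
    case (insert x F)
    then obtain T where T: "finite T" "(\<Sum>l\<in>F. g l) = lin T" by blast
    obtain U where U: "finite U" "g x = lin U"
      using assms(1) by (auto simp: linear_subst_def)
    have l: "lin V = lin (V - W) + lin (V \<inter> W)" if "finite V" for V W
      unfolding lin_def using that sum.Int_Diff[of V var W] by (simp add: add.commute)
    have "lin U + lin T = lin (U - T) + lin (T - U)"
      using l[OF U(1), of T] l[OF T(1), of U] by (simp add: Int_commute algebra_simps)
    also have "\<dots> = lin ((U - T) \<union> (T - U))"
      unfolding lin_def using T(1) U(1) by (intro sum.union_disjoint[symmetric]) auto
    finally show ?case using insert.hyps T U by (intro exI[of _ "(U - T) \<union> (T - U)"]) auto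
  qed
  then show "\<exists>T. finite T \<and> ev g (A i) = lin T"
    unfolding S(2) by (simp add: lin_def ev_sum)
qed

lemma homog_in_ev_transv:
  assumes "finite H" "a \<in> H" "q \<in> H" "a \<noteq> q" "u \<in> homog_in H n"
  shows "ev (transv q a) u \<in> homog_in H n"
  using assms(5)
proof (induction rule: homog_in_induct)
  case (mon m)
  have g: "transv q a i \<in> homog_in H 1" if "i \<in> H" for i
    unfolding transv_lin[OF assms(4)] using assms that by (intro homog_in_lin) auto
  have pw: "transv q a i ^ e \<in> homog_in H e" if "i \<in> H" for i e
    using homog_in_mult[OF g[OF that]] by (induction e) auto
  have "(\<Prod>i\<in>F. transv q a i ^ lkp m i) \<in> homog_in H (\<Sum>i\<in>F. lkp m i)" if "finite F" "F \<subseteq> H" for F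
    using that by (induction F rule: finite_induct) (auto intro!: homog_in_mult pw)
  from this[of "supp m"] show ?case using mon by (simp add: evm_def mdeg_def)
qed (auto simp: ev_add intro: homog_in_add)

text \<open>On the square-free monomial, (x_a + x_q) x_a adds only a term with a square factor. Any
  other monomial of this degree has a repeated variable, and its image keeps a square
  factor.\<close>

lemma coeff_ones_ev_transv:
  assumes "finite H" "a \<in> H" "q \<in> H" "a \<noteq> q" "u \<in> homog_in H (card H)"
  shows "lkp (ev (transv q a) u) (ones H) = lkp u (ones H)"
  using assms(5)
proof (induction rule: homog_in_induct)
  case (mon m)
  show ?case
  proof (cases "m = ones H")
    case True
    let ?R = "H - {q} - {a}"
    have m: "mon m = var q * (var a * vprod ?R)"
      using vprod_remove[of H q] vprod_remove[of "H - {q}" a] assms True by (simp add: vprod_ones)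
    have "ev (transv q a) (vprod ?R) = vprod ?R"
      unfolding vprod_def ev_prod[OF poly2_two] by (intro prod.cong) (auto simp: transv_def)
    then have "ev (transv q a) (mon m) = (var a + var q) * (var a * vprod ?R)"
      using assms(4) unfolding m ev_mult[OF poly2_two] ev_var by (simp add: transv_def)
    also have "\<dots> = lin {a} ^ 2 * vprod ?R + mon m" 
      unfolding m by (simp add: algebra_simps power2_eq_square)
    finally show ?thesis
      by (simp only: lookup_add coeff_ones_square_mult[OF assms(1)] add_0_left)
  next
    case False
    obtain i where i: "lkp m i \<ge> 2"
    proof (rule ccontr)
      assume "\<not> thesis"
      then have le: "lkp m i \<le> 1" for i using that[of i] by linarith
      have "supp m = H"
      proof (rule card_subset_eq[OF assms(1)])
        have "mdeg m = (\<Sum>i\<in>supp m. 1)"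
          unfolding mdeg_def
        proof (rule sum.cong[OF refl])
          fix i assume "i \<in> supp m"
          then have "lkp m i \<noteq> 0" by (simp add: in_keys_iff)
          then show "lkp m i = 1" using le[of i] by linarith
        qed
        then show "card (supp m) = card H" using mon by simp
      qed (use mon in auto)
      then have "m = ones H" using mon assms(1)
        by (intro eq_ones_if_positive) (auto simp: in_keys_iff Suc_le_eq)
      then show False using False by blast
    qed
    define m' where "m' = m - Poly_Mapping.single i 2"
    have "m = Poly_Mapping.single i 2 + m'"
      using i by (intro poly_mapping_eqI) (auto simp: m'_def lookup_add lookup_minus lookup_single when_def)
    then have e: "mon m = var i ^ 2 * mon m'" by (simp add: var_pow mon_mult)
    have "lkp (ev (transv q a) (mon m)) (ones H) = 0"
      unfolding e by (rule coeff_ones_ev_square_mult[OF assms(1) linear_transv[OF assms(4)]])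
    then show ?thesis using False by (simp add: lookup_single)
  qed
qed (auto simp: ev_add lookup_add)

section \<open>A triangular family\<close>

definition hyp_vars :: "nat \<Rightarrow> nat set \<Rightarrow> nat set" where "hyp_vars k I = {..<k} - {Min I}"

text \<open>
  The functional for (S, a) with a in S reads off the coefficient of the spike a^3 times the
  rest of S; for a outside S the variables Min and a are first identified, which turns the
  monomials of both a and Min into such a spike.
\<close>

definition target_mono :: "nat set \<times> nat \<Rightarrow> mono" where
  "target_mono p = (case p of (S, a) \<Rightarrow>
     Poly_Mapping.single a 3 + ones (S - {if a \<in> S then a else Min (insert a S)}))"

definition target_subst :: "nat set \<Rightarrow> nat set \<times> nat \<Rightarrow> nat \<Rightarrow> poly2" where
  "target_subst I p = (case p of (S, a) \<Rightarrow>
     if a \<in> S then hyp_subst I else (\<lambda>i. ev (transv (Min (insert a S)) a) (hyp_subst I i)))"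

text \<open>The spike in question has exponent 2^d - 1 in each of the k - 1 variables left on the
  hyperplane, and so has the full degree \<open>ndeg k d\<close>.\<close>

definition top_functional :: "nat \<Rightarrow> nat \<Rightarrow> nat set \<Rightarrow> poly2 \<Rightarrow> bit" where
  "top_functional k d I f = lkp (ev (hyp_subst I) f) (spike_exp (hyp_vars k I) d 0)"

definition low_functional :: "nat \<Rightarrow> nat \<Rightarrow> nat set \<Rightarrow> nat set \<times> nat \<Rightarrow> poly2 \<Rightarrow> bit" where
  "low_functional k d I p f = lkp (ev (target_subst I p) f) (spike_exp (hyp_vars k I) (d - 1) (target_mono p))"

lemma finite_hyp_vars [simp]: "finite (hyp_vars k I)"
  by (simp add: hyp_vars_def)

lemma low_index_D:
  assumes "(S, a) \<in> low_index H" "finite H"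
  shows "S \<subseteq> H" "a \<in> H" "finite S"
    and "a \<notin> S \<Longrightarrow> Min (insert a S) \<in> S" "a \<notin> S \<Longrightarrow> Min (insert a S) \<noteq> a"
proof -
  show s: "S \<subseteq> H" "a \<in> H" and f: "finite S"
    using assms finite_subset by (auto simp: low_index_def)
  assume a: "a \<notin> S"
  then show n: "Min (insert a S) \<noteq> a" using assms(1) by (auto simp: low_index_def)
  have "Min (insert a S) \<in> insert a S" using f by (intro Min_in) auto
  then show "Min (insert a S) \<in> S" using n by blast
qed

lemma lookup_target_mono:
  assumes "finite S"
  shows "lkp (target_mono (S, a)) i = (if i = a then 3 else 0) +
    of_bool (i \<in> S - {if a \<in> S then a else Min (insert a S)})"
  using assms by (simp add: target_mono_def lookup_add lookup_ones lookup_single when_def)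

lemma spike_target_mono:
  assumes "finite S" shows "spike (target_mono (S, a))"
  unfolding spike_def
proof
  fix i
  have "lkp (target_mono (S, a)) i \<in> {0, 1, 3}" unfolding lookup_target_mono[OF assms] by auto
  moreover have "(0::nat) = 2 ^ 0 - 1" "(1::nat) = 2 ^ 1 - 1" "(3::nat) = 2 ^ 2 - 1" by auto
  ultimately show "\<exists>b. lkp (target_mono (S, a)) i = 2 ^ b - 1" by (metis insertE empty_iff)
qed

lemma supp_target_mono:
  assumes "(S, a) \<in> low_index H" "finite H" shows "supp (target_mono (S, a)) \<subseteq> H"
  using low_index_D[OF assms] by (auto simp: in_keys_iff lookup_target_mono split: if_splits)

lemma Min_lessThan: "I \<subseteq> {..<k} \<Longrightarrow> I \<noteq> {} \<Longrightarrow> Min I \<in> I" for I :: "nat set"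
  by (rule Min_in) (auto intro: finite_subset)

lemma card_hyp_vars: "I \<subseteq> {..<k} \<Longrightarrow> I \<noteq> {} \<Longrightarrow> card (hyp_vars k I) = k - 1"
  using Min_lessThan[of I k] by (auto simp: hyp_vars_def)

lemma linear_target_subst:
  assumes "p \<in> low_index (hyp_vars k I)" "finite I"
  shows "linear_subst (target_subst I p)"
proof -
  obtain S a where p: "p = (S, a)" by fastforce
  show ?thesis
    using low_index_D(5)[of S a "hyp_vars k I"] assms
    by (auto simp: p target_subst_def intro!: linear_hyp_subst linear_ev linear_transv)
qed

lemma target_subst_ev:
  "ev (target_subst I (S, a)) f = (if a \<in> S then ev (hyp_subst I) f else ev (transv (Min (insert a S)) a) (ev (hyp_subst I) f))"
  by (simp add: target_subst_def ev_ev)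

lemma top_functional_hit:
  assumes "finite I" "f \<in> hit k" shows "top_functional k d I f = 0"
  unfolding top_functional_def
  by (rule spike_functional_hit[OF linear_hyp_subst[OF assms(1)] spike_exp_spike assms(2)])
    (auto simp: spike_def intro: exI[of _ 0])

lemma low_functional_hit:
  assumes "finite I" "p \<in> low_index (hyp_vars k I)" "f \<in> hit k" shows "low_functional k d I p f = 0"
proof -
  obtain S a where p: "p = (S, a)" by fastforce
  show ?thesis
    unfolding low_functional_def
    using assms low_index_D(3)[of S a "hyp_vars k I"] supp_target_mono[of S a "hyp_vars k I"] unfolding p
    by (intro spike_functional_hit[OF linear_target_subst spike_exp_spike, of _ k] spike_target_mono) auto
qed

lemma top_functional_kameko_word:
  assumes "I \<subseteq> {..<k}" "I \<noteq> {}" "set w \<subseteq> {..<k}"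
  shows "lkp (ev (hyp_subst I) (kameko_word k w y)) (spike_exp (hyp_vars k I) (length w) m) = of_bool (set w \<subseteq> I) * lkp (ev (hyp_subst I) y) m"
  by (rule coeff_ev_kameko_word)
    (use assms homog_in_ev_hyp_subst_vprod[OF assms(1,2)] coeff_ev_hyp_subst_vprod[OF assms(1,2)] in \<open>auto simp: hyp_vars_def\<close>)

text \<open>The transvection preserves the coefficient of \<open>ones\<close>, so the d - 1 letters
  contribute the same factors as without it. It matters only for \<open>y\<close>, which is compared
  with the target monomial.\<close>

lemma low_functional_kameko_word:
  assumes "I \<subseteq> {..<k}" "I \<noteq> {}" "set w \<subseteq> {..<k}" "p \<in> low_index (hyp_vars k I)" "length w = d - 1"
  shows "low_functional k d I p (kameko_word k w y) = of_bool (set w \<subseteq> I) * lkp (ev (target_subst I p) y) (target_mono p)"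
proof -
  obtain S a where p: "p = (S, a)" by fastforce
  note D = low_index_D[OF assms(4)[unfolded p] finite_hyp_vars]
  have P: "ev (hyp_subst I) (vprod ({..<k} - {j})) \<in> homog_in (hyp_vars k I) (card (hyp_vars k I))"
    and c: "lkp (ev (hyp_subst I) (vprod ({..<k} - {j}))) (ones (hyp_vars k I)) = of_bool (j \<in> I)" if "j < k" for j
    unfolding hyp_vars_def using homog_in_ev_hyp_subst_vprod[OF assms(1,2) that] coeff_ev_hyp_subst_vprod[OF assms(1,2) that] by auto
  show ?thesis
    unfolding low_functional_def assms(5)[symmetric]
  proof (rule coeff_ev_kameko_word)
    fix j assume "j \<in> set w"
    then have j: "j < k" using assms(3) by auto
    show "ev (target_subst I p) (vprod ({..<k} - {j})) \<in> homog_in (hyp_vars k I) (card (hyp_vars k I))"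
      unfolding p target_subst_ev using P[OF j] D by (auto intro!: homog_in_ev_transv)
    show "lkp (ev (target_subst I p) (vprod ({..<k} - {j}))) (ones (hyp_vars k I)) = of_bool (j \<in> I)"
    proof (cases "a \<in> S")
      case True
      then show ?thesis unfolding p target_subst_ev using c[OF j] by simp
    next
      case False
      then have "Min (insert a S) \<in> hyp_vars k I" "a \<in> hyp_vars k I" "a \<noteq> Min (insert a S)"
        using D by (auto dest!: D(4,5))
      then have "lkp (ev (transv (Min (insert a S)) a) (ev (hyp_subst I) (vprod ({..<k} - {j})))) (ones (hyp_vars k I)) = of_bool (j \<in> I)"
        using coeff_ones_ev_transv[OF finite_hyp_vars _ _ _ P[OF j]] c[OF j] by simp
      then show ?thesis unfolding p target_subst_ev using False by simp
    qed
  qed simp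
qed

lemma low_mono_mon: "finite S \<Longrightarrow> low_mono (S, a) = mon (Poly_Mapping.single a 2 + ones S)"
  by (simp add: low_mono_def vprod_ones var_pow mon_mult)

lemma lookup_low_mono:
  "finite S \<Longrightarrow> lkp (Poly_Mapping.single a 2 + ones S) i = (if i = a then 2 else 0) + of_bool (i \<in> S)"
  by (simp add: lookup_add lookup_ones lookup_single when_def)

lemma ev_hyp_subst_low_mono:
  assumes "(S, a) \<in> low_index (hyp_vars k I)"
  shows "ev (hyp_subst I) (low_mono (S, a)) = low_mono (S, a)"
proof -
  note D = low_index_D[OF assms finite_hyp_vars]
  have "a \<noteq> Min I" "Min I \<notin> S" using D by (auto simp: hyp_vars_def)
  then show ?thesis
    using D by (simp add: low_mono_def ev_mult ev_pow ev_hyp_subst_vprod) (simp add: hyp_subst_def)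
qed

lemma coeff_low_mono_repeated:
  assumes "finite S" "finite S'" "a \<in> S"
  shows "lkp (low_mono (S', a')) (target_mono (S, a)) = of_bool ((S', a') = (S, a))"
proof -
  have "Poly_Mapping.single a' 2 + ones S' = target_mono (S, a) \<longleftrightarrow> (S', a') = (S, a)"
  proof
    assume e: "Poly_Mapping.single a' 2 + ones S' = target_mono (S, a)"
    have l: "(if i = a' then 2 else 0) + of_bool (i \<in> S') = (if i = a then 2 else 0) + (of_bool (i \<in> S) :: nat)" for i
      using arg_cong[OF e, of "\<lambda>m. lkp m i"] assms(3)
      unfolding lookup_low_mono[OF assms(2)] lookup_target_mono[OF assms(1)] by (auto simp: of_bool_def split: if_splits)
    have "a' = a" using l[of a] by (auto simp: of_bool_def split: if_splits)
    moreover have "i \<in> S' \<longleftrightarrow> i \<in> S" for i using l[of i] \<open>a' = a\<close> by (auto simp: of_bool_def split: if_splits)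
    ultimately show "(S', a') = (S, a)" by auto
  next
    assume "(S', a') = (S, a)"
    then show "Poly_Mapping.single a' 2 + ones S' = target_mono (S, a)"
      using assms by (intro poly_mapping_eqI) (auto simp: lookup_low_mono lookup_target_mono)
  qed
  then show ?thesis by (simp add: low_mono_mon[OF assms(2)] lookup_single when_def)
qed

text \<open>With q = Min (insert a S) the target is a^3 times the product over S - {q}. Among
  indices whose squared variable lies outside the set, x_q \<mapsto> x_a + x_q can produce it only
  from a^2 times the product over S, or from q^2 times the product over insert a S - {q}. The latter
  squares the minimum and is excluded from \<open>low_index\<close>.\<close>

lemma coeff_low_mono_outside:
  assumes "(S, a) \<in> low_index H" "(S', a') \<in> low_index H" "finite H" "a \<notin> S" "a' \<notin> S'"
  shows "lkp (ev (transv (Min (insert a S)) a) (low_mono (S', a'))) (target_mono (S, a)) = of_bool ((S', a') = (S, a))"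
proof -
  define q where "q = Min (insert a S)"
  note D = low_index_D[OF assms(1,3)] and D' = low_index_D[OF assms(2,3)]
  have q: "q \<in> S" "q \<noteq> a" using D(4,5) assms(4) by (auto simp: q_def)
  have t: "lkp (target_mono (S, a)) i = (if i = a then 3 else 0) + of_bool (i \<in> S - {q})" for i
    using assms(4) by (simp add: lookup_target_mono[OF D(3)] q_def)
  have gfix: "ev (transv q a) (vprod R) = vprod R" if "q \<notin> R" for R
    unfolding vprod_def ev_prod[OF poly2_two] using that by (intro prod.cong) (auto simp: transv_def)
  have "lkp (ev (transv q a) (low_mono (S', a'))) (target_mono (S, a)) = of_bool ((S', a') = (S, a))"
  proof (cases "q \<in> S'")
    case False
    have ne: "(S', a') \<noteq> (S, a)" using False q by auto
    have e: "ev (transv q a) (low_mono (S', a')) = transv q a a' ^ 2 * vprod S'"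
      using gfix[OF False] by (simp add: low_mono_def ev_mult ev_pow)
    have z: "lkp (mon (Poly_Mapping.single b 2 + ones S')) (target_mono (S, a)) = 0"
      if b: "b \<notin> S'" for b
    proof -
      have "lkp (Poly_Mapping.single b 2 + ones S') b \<noteq> lkp (target_mono (S, a)) b"
        unfolding lookup_low_mono[OF D'(3)] t using b assms(4) by (auto simp: of_bool_def split: if_splits)
      then show ?thesis by (auto simp: lookup_single when_def)
    qed
    have "lkp (transv q a a' ^ 2 * vprod S') (target_mono (S, a)) = 0"
    proof (cases "a' = q")
      case False
      then show ?thesis using z[OF assms(5)]
        by (simp add: transv_def vprod_ones[OF D'(3)] var_pow mon_mult)
    next
      case True
      have "Poly_Mapping.single a 2 + ones S' \<noteq> target_mono (S, a)"
      proof
        assume e: "Poly_Mapping.single a 2 + ones S' = target_mono (S, a)"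
        have l: "(if i = a then 2 else 0) + of_bool (i \<in> S') = (if i = a then 3 else 0) + (of_bool (i \<in> S - {q}) :: nat)" for i
          using arg_cong[OF e, of "\<lambda>m. lkp m i"] unfolding lookup_low_mono[OF D'(3)] t .
        have "i \<in> S' \<longleftrightarrow> i \<in> insert a (S - {q})" for i using l[of i] by (auto simp: of_bool_def split: if_splits)
        then have "S' = insert a (S - {q})" by blast
        then have "insert a' S' = insert a S" using True q by auto
        then show False using D'(5)[OF assms(5)] True by (simp add: q_def)
      qed
      then have "lkp (mon (Poly_Mapping.single a 2 + ones S')) (target_mono (S, a)) = 0"
        by (simp add: lookup_single when_def)
      moreover have "transv q a a' ^ 2 * vprod S' = mon (Poly_Mapping.single a 2 + ones S') + mon (Poly_Mapping.single q 2 + ones S')"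
        using True by (simp add: transv_def poly2_square_add ring_distribs vprod_ones[OF D'(3)] var_pow mon_mult)
      ultimately show ?thesis using z[OF False] by (simp add: lookup_add)
    qed
    then show ?thesis unfolding e using ne by simp
  next
    case True
    have a'q: "a' \<noteq> q" using True assms(5) by auto
    have "vprod S' = var q * vprod (S' - {q})" using vprod_remove[OF D'(3) True] .
    then have "ev (transv q a) (low_mono (S', a')) = var a' ^ 2 * ((var a + var q) * vprod (S' - {q}))"
      using a'q gfix[of "S' - {q}"] by (simp add: low_mono_def ev_mult ev_pow) (simp add: transv_def)
    also have "\<dots> = var a' ^ 2 * (var a * vprod (S' - {q})) + var a' ^ 2 * (var q * vprod (S' - {q}))"
      by (simp add: ring_distribs)
    also have "var a' ^ 2 * (var a * vprod (S' - {q})) = mon (Poly_Mapping.single a' 2 + (Poly_Mapping.single a 1 + ones (S' - {q})))"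
      by (simp only: vprod_ones[OF finite_Diff[OF D'(3)]] var_pow) (simp only: var_def mon_mult)
    also have "var a' ^ 2 * (var q * vprod (S' - {q})) = mon (Poly_Mapping.single a' 2 + ones S')"
      using vprod_remove[OF D'(3) True] low_mono_mon[OF D'(3), of a'] by (simp add: low_mono_def)
    finally have e: "ev (transv q a) (low_mono (S', a')) =
      mon (Poly_Mapping.single a' 2 + (Poly_Mapping.single a 1 + ones (S' - {q}))) + mon (Poly_Mapping.single a' 2 + ones S')" .
    have "lkp (Poly_Mapping.single a' 2 + ones S') q \<noteq> lkp (target_mono (S, a)) q"
      unfolding lookup_low_mono[OF D'(3)] t using True q by auto
    then have z: "lkp (mon (Poly_Mapping.single a' 2 + ones S')) (target_mono (S, a)) = 0"
      by (auto simp: lookup_single when_def)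
    have lk: "lkp (Poly_Mapping.single a' 2 + (Poly_Mapping.single a 1 + ones (S' - {q}))) i =
      (if i = a' then 2 else 0) + ((if i = a then 1 else 0) + of_bool (i \<in> S' - {q}))" for i
      using D'(3) by (simp add: lookup_add lookup_ones lookup_single when_def)
    have "Poly_Mapping.single a' 2 + (Poly_Mapping.single a 1 + ones (S' - {q})) = target_mono (S, a) \<longleftrightarrow> (S', a') = (S, a)"
    proof
      assume eq: "Poly_Mapping.single a' 2 + (Poly_Mapping.single a 1 + ones (S' - {q})) = target_mono (S, a)"
      have l: "(if i = a' then 2 else 0) + ((if i = a then 1 else 0) + of_bool (i \<in> S' - {q})) =
          (if i = a then 3 else 0) + (of_bool (i \<in> S - {q}) :: nat)" for i
        using arg_cong[OF eq, of "\<lambda>m. lkp m i"] unfolding lk t .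
      have a: "a' = a" using l[of a'] assms(5) by (auto simp: of_bool_def split: if_splits)
      have "i \<in> S' \<longleftrightarrow> i \<in> S" for i
        using l[of i] a True q assms(4,5) by (cases "i = q"; cases "i = a") (auto simp: of_bool_def split: if_splits)
      then show "(S', a') = (S, a)" using a by auto
    next
      assume "(S', a') = (S, a)"
      then show "Poly_Mapping.single a' 2 + (Poly_Mapping.single a 1 + ones (S' - {q})) = target_mono (S, a)"
        by (intro poly_mapping_eqI, unfold lk t) (use q in auto)
    qed
    then show ?thesis unfolding e lookup_add z by (simp add: lookup_single when_def)
  qed
  then show ?thesis by (simp add: q_def)
qed

text \<open>The third hypothesis rules out an outside \<open>p\<close> against a repeated
  \<open>p'\<close>: there the value can be 1 for \<open>p' \<noteq> p\<close>, namely for the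
  monomial equal to the target of \<open>p\<close>. The remaining pairs still give a triangular
  system.\<close>

lemma coeff_target_subst_low_mono:
  assumes "p \<in> low_index (hyp_vars k I)" "p' \<in> low_index (hyp_vars k I)" "snd p \<in> fst p \<or> snd p' \<notin> fst p'"
  shows "lkp (ev (target_subst I p) (low_mono p')) (target_mono p) = of_bool (p' = p)"
proof -
  obtain S a S' a' where p: "p = (S, a)" "p' = (S', a')" by fastforce
  show ?thesis
    using assms coeff_low_mono_outside[of S a "hyp_vars k I" S' a'] coeff_low_mono_repeated[of S S' a a']
      low_index_D(3)[of S a "hyp_vars k I"] low_index_D(3)[of S' a' "hyp_vars k I"]
    unfolding p target_subst_ev by (cases "a \<in> S") (auto simp: ev_hyp_subst_low_mono simp del: bit_not_zero_iff)
qed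

section \<open>The family of words and its dual functionals\<close>

definition family_index :: "nat \<Rightarrow> nat \<Rightarrow> (nat set \<times> (nat set \<times> nat) option) set" where
  "family_index k d = {J. J \<subseteq> {..<k} \<and> J \<noteq> {} \<and> card J \<le> min k d} \<times> {None} \<union>
     (SIGMA J:{J. J \<subseteq> {..<k} \<and> J \<noteq> {} \<and> card J \<le> min k (d - 1)}. Some ` low_index (hyp_vars k J))"

text \<open>The two word lengths \<open>d\<close> and \<open>d - 1\<close> are the source of the two
  bounds on the number of letters in \<open>family_index\<close>, and thereby of the two sums in
  \<open>cKD\<close>.\<close>

fun family_elem :: "nat \<Rightarrow> nat \<Rightarrow> nat set \<times> (nat set \<times> nat) option \<Rightarrow> poly2" where
  "family_elem k d (J, None) = kameko_word k (canonical_word d J) 1"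
| "family_elem k d (J, Some p) = kameko_word k (canonical_word (d - 1) J) (low_mono p)"

definition functionals :: "nat \<Rightarrow> nat \<Rightarrow> (poly2 \<Rightarrow> bit) set" where
  "functionals k d = {top_functional k d I | I. I \<subseteq> {..<k} \<and> I \<noteq> {} \<and> card I \<le> d} \<union>
     {low_functional k d I p | I p. I \<subseteq> {..<k} \<and> I \<noteq> {} \<and> card I \<le> d - 1 \<and> p \<in> low_index (hyp_vars k I)}"

lemma finite_subsets_card: "finite {J. J \<subseteq> {..<k::nat} \<and> J \<noteq> {} \<and> card J \<le> t}"
  by (rule finite_subset[of _ "Pow {..<k}"]) auto

lemma finite_family_index: "finite (family_index k d)"
  unfolding family_index_def by (intro finite_UnI finite_SigmaI finite_imageI finite_low_index finite_subsets_card finite_hyp_vars) auto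

lemma card_family_index:
  assumes "k \<ge> 3" shows "card (family_index k d) = cKD k d"
proof -
  let ?J = "\<lambda>t. {J. J \<subseteq> {..<k} \<and> J \<noteq> {} \<and> card J \<le> min k t}"
  have c: "card (?J t) = (\<Sum>u=1..min k t. k choose u)" for t
    using card_nonempty_subsets[of "{..<k}" "min k t"] by simp
  have y: "card (Some ` low_index (hyp_vars k J)) = (k - 3) * (k choose 2)" if "J \<in> ?J t" for J t
  proof -
    have "card (Some ` low_index (hyp_vars k J)) = card (low_index (hyp_vars k J))" by (rule card_image) auto
    also have "\<dots> = (k - 3) * (k choose 2)"
      using card_low_index[OF finite_hyp_vars card_hyp_vars, of J k] that assms by simp
    finally show ?thesis .
  qed
  have "card (family_index k d) = card (?J d \<times> {None :: (nat set \<times> nat) option}) + card (SIGMA J:?J (d - 1). Some ` low_index (hyp_vars k J))"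
    unfolding family_index_def
    by (intro card_Un_disjoint finite_SigmaI finite_imageI finite_low_index finite_subsets_card finite_hyp_vars) auto
  also have "card (SIGMA J:?J (d - 1). Some ` low_index (hyp_vars k J)) = (\<Sum>J\<in>?J (d - 1). card (Some ` low_index (hyp_vars k J)))"
    by (intro card_SigmaI finite_subsets_card) (auto simp: finite_low_index)
  also have "\<dots> = (\<Sum>J\<in>?J (d - 1). (k - 3) * (k choose 2))"
    by (rule sum.cong[OF refl]) (rule y)
  also have "card (?J d \<times> {None :: (nat set \<times> nat) option}) = card (?J d)" by simp
  finally show ?thesis by (simp only: c cKD_def sum_constant of_nat_id mult.commute)
qed

lemma family_index_None: "(J, None) \<in> family_index k d \<Longrightarrow> J \<subseteq> {..<k} \<and> J \<noteq> {} \<and> card J \<le> d"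
  and family_index_Some: "(J, Some p) \<in> family_index k d \<Longrightarrow> J \<subseteq> {..<k} \<and> J \<noteq> {} \<and> card J \<le> d - 1 \<and> p \<in> low_index (hyp_vars k J)"
  by (auto simp: family_index_def)

lemma canonical_word_subset:
  assumes "J \<subseteq> {..<k}" "J \<noteq> {}" "card J \<le> r"
  shows "set (canonical_word r J) = J" "length (canonical_word r J) = r"
  using canonical_word[OF finite_subset[OF assms(1) finite_lessThan] assms(2,3)] by auto

lemma Pk_deg_low_mono:
  assumes "p \<in> low_index H" "H \<subseteq> {..<k}" "card H = k - 1" "k \<ge> 3"
  shows "low_mono p \<in> Pk_deg k (ndeg k 1)"
proof -
  obtain S a where p: "p = (S, a)" by fastforce
  have S: "S \<subseteq> {..<k}" "a < k" "card S = k - 3" using assms by (auto simp: p low_index_def)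
  have "var a ^ 2 * vprod S \<in> Pk_deg k (2 * 1 + card S)"
    using S by (intro Pk_deg_mult Pk_deg_pow Pk_deg_vprod Pk_deg_var) auto
  moreover have "2 * 1 + card S = ndeg k 1" using S(3) assms(4) by (simp add: ndeg_def)
  ultimately show ?thesis by (simp add: p low_mono_def)
qed

lemma Pk_deg_family_elem:
  assumes "k \<ge> 3" "d \<ge> 1" "x \<in> family_index k d"
  shows "family_elem k d x \<in> Pk_deg k (ndeg k d)"
proof -
  obtain J o' where x: "x = (J, o')" by fastforce
  show ?thesis
  proof (cases o')
    case None
    then have J: "J \<subseteq> {..<k}" "J \<noteq> {}" "card J \<le> d" using assms x family_index_None by blast+
    show ?thesis
      using Pk_deg_kameko_word[of "canonical_word d J" k 1 0] canonical_word_subset[OF J] J by (simp add: x None)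
  next
    case (Some p)
    then have J: "J \<subseteq> {..<k}" "J \<noteq> {}" "card J \<le> d - 1" "p \<in> low_index (hyp_vars k J)" using assms x family_index_Some by blast+
    have "low_mono p \<in> Pk_deg k (ndeg k 1)"
      using card_hyp_vars[OF J(1,2)] assms(1) by (intro Pk_deg_low_mono[OF J(4)]) (auto simp: hyp_vars_def)
    then show ?thesis
      using Pk_deg_kameko_word[of "canonical_word (d - 1) J" k "low_mono p" 1] canonical_word_subset[OF J(1-3)] J assms(2)
      by (simp add: x Some)
  qed
qed

lemma functionals_add:
  assumes "\<phi> \<in> functionals k d" shows "\<phi> (f + g) = \<phi> f + \<phi> g" "\<phi> 0 = 0"
  using assms by (auto simp: functionals_def top_functional_def low_functional_def ev_add lookup_add)

lemma functionals_sum: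
  assumes "\<phi> \<in> functionals k d" shows "\<phi> (\<Sum>i\<in>F. g i) = (\<Sum>i\<in>F. \<phi> (g i))"
  by (induction F rule: infinite_finite_induct) (auto simp: functionals_add[OF assms])

lemma functionals_hit:
  assumes "\<phi> \<in> functionals k d" "f \<in> hit k" shows "\<phi> f = 0"
proof -
  have "finite I" if "I \<subseteq> {..<k}" for I :: "nat set" using that finite_subset by blast
  then show ?thesis using assms unfolding functionals_def by (auto simp: top_functional_hit low_functional_hit)
qed

lemma top_functional_family_elem:
  assumes "I \<subseteq> {..<k}" "I \<noteq> {}" "(J, None) \<in> family_index k d"
  shows "top_functional k d I (family_elem k d (J, None)) = of_bool (J \<subseteq> I)"
proof -
  have J: "J \<subseteq> {..<k}" "J \<noteq> {}" "card J \<le> d" using assms family_index_None by blast+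
  show ?thesis
    using top_functional_kameko_word[OF assms(1,2), of "canonical_word d J" 1 0] canonical_word_subset[OF J] J(1) by (simp add: top_functional_def)
qed

text \<open>After d - 1 letters the part of the spike still to be matched is square-free, while a
  linear substitution keeps the square factor.\<close>

lemma top_functional_short_square:
  assumes "I \<subseteq> {..<k}" "I \<noteq> {}" "set w \<subseteq> {..<k}" "Suc (length w) = d"
  shows "top_functional k d I (kameko_word k w (var a ^ 2 * v)) = 0"
proof -
  have f: "finite I" using assms(1) finite_subset by blast
  have "top_functional k d I (kameko_word k w (var a ^ 2 * v)) =
      of_bool (set w \<subseteq> I) * lkp (ev (hyp_subst I) (var a ^ 2 * v)) (ones (hyp_vars k I))"
    using top_functional_kameko_word[OF assms(1-3), of "var a ^ 2 * v" "ones (hyp_vars k I) + (0 + 0)"]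
    unfolding top_functional_def assms(4)[symmetric] spike_exp_Suc_right by simp
  then show ?thesis using coeff_ones_ev_square_mult[OF finite_hyp_vars linear_hyp_subst[OF f]] by simp
qed

lemma top_functional_family_elem_Some:
  assumes "I \<subseteq> {..<k}" "I \<noteq> {}" "(J, Some p) \<in> family_index k d" "d \<ge> 1"
  shows "top_functional k d I (family_elem k d (J, Some p)) = 0"
proof -
  have J: "J \<subseteq> {..<k}" "J \<noteq> {}" "card J \<le> d - 1" using assms family_index_Some by blast+
  show ?thesis
    using top_functional_short_square[OF assms(1,2), of "canonical_word (d - 1) J"] canonical_word_subset[OF J] J(1) assms(4) by (simp add: low_mono_def)
qed

lemma low_functional_family_elem_Some:
  assumes "I \<subseteq> {..<k}" "I \<noteq> {}" "(J, Some p') \<in> family_index k d" "p \<in> low_index (hyp_vars k I)"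
    and "card I \<le> card J" "J = I \<Longrightarrow> snd p \<in> fst p \<or> snd p' \<notin> fst p'"
  shows "low_functional k d I p (family_elem k d (J, Some p')) = of_bool (J = I \<and> p' = p)"
proof -
  have J: "J \<subseteq> {..<k}" "J \<noteq> {}" "card J \<le> d - 1" "p' \<in> low_index (hyp_vars k J)" using assms family_index_Some by blast+
  have fI: "finite I" using assms(1) finite_subset by blast
  have "low_functional k d I p (family_elem k d (J, Some p')) = of_bool (J \<subseteq> I) * lkp (ev (target_subst I p) (low_mono p')) (target_mono p)"
    using low_functional_kameko_word[OF assms(1,2) _ assms(4), of "canonical_word (d - 1) J" d "low_mono p'"] canonical_word_subset[OF J(1-3)] J(1) by simp
  moreover have "J \<subseteq> I \<Longrightarrow> J = I" using assms(5) fI card_seteq by blast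
  ultimately show ?thesis
    using coeff_target_subst_low_mono[OF assms(4), of p'] J(4) assms(6)
    by (cases "J = I") (auto simp del: bit_not_zero_iff)
qed

lemma sum_single_nonzero:
  assumes "finite T" "x \<in> T" "\<And>y. y \<in> T \<Longrightarrow> f y = of_bool (y = x)"
  shows "(\<Sum>y\<in>T. f y) = (1 :: bit)"
proof -
  have "(\<Sum>y\<in>T. f y) = (\<Sum>y\<in>T. if y = x then 1 else 0)"
    using assms(3) by (intro sum.cong) auto
  then show ?thesis using assms(1,2) by (simp add: sum.delta)
qed

text \<open>
  Triangularity: on a word with letters J the functionals for I carry the factor [J <= I].
\<close>

lemma exists_fun:
  assumes "T \<subseteq> family_index k d" "T \<noteq> {}" "d \<ge> 1"
  shows "\<exists>\<phi>\<in>functionals k d. \<phi> (\<Sum>x\<in>T. family_elem k d x) = 1"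
proof -
  have fT: "finite T" using assms(1) finite_family_index finite_subset by blast
  show ?thesis
  proof (cases "\<exists>J. (J, None) \<in> T")
    case True
    \<comment> \<open>With \<open>I\<close> of least size, a letter set of another
      \<open>None\<close> index in \<open>T\<close> cannot lie properly inside \<open>I\<close>. The
      \<open>Some\<close> indices are killed by all top functionals, so they do not
      interfere.\<close>
    then obtain I where I: "(I, None) \<in> T" and min: "\<And>J. (J, None) \<in> T \<Longrightarrow> card I \<le> card J"
      using ex_has_least_nat[of "\<lambda>J. (J, None) \<in> T" _ card] by blast
    have Ik: "I \<subseteq> {..<k}" "I \<noteq> {}" "card I \<le> d" using I assms(1) family_index_None by blast+
    have fI: "finite I" using Ik(1) finite_subset by blast
    have \<phi>: "top_functional k d I \<in> functionals k d" using Ik by (auto simp: functionals_def)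
    have "(\<Sum>x\<in>T. top_functional k d I (family_elem k d x)) = 1"
    proof (rule sum_single_nonzero[OF fT I])
      fix x assume x: "x \<in> T"
      obtain J o' where xo: "x = (J, o')" by fastforce
      show "top_functional k d I (family_elem k d x) = of_bool (x = (I, None))"
      proof (cases o')
        case None
        then have "J \<subseteq> I \<longleftrightarrow> J = I" using min[of J] x xo fI card_seteq[of I J] by blast
        then show ?thesis using top_functional_family_elem[OF Ik(1,2), of J d] x xo None assms(1) by auto
      next
        case (Some p)
        then show ?thesis using top_functional_family_elem_Some[OF Ik(1,2) _ assms(3), of J p] x xo assms(1) by auto
      qed
    qed
    then show ?thesis using \<phi> functionals_sum[OF \<phi>] by metis
  next
    case False
    then obtain J0 p0 where "(J0, Some p0) \<in> T" using assms(2) by (metis ex_in_conv option.exhaust surj_pair)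
    then obtain I where I: "\<exists>p. (I, Some p) \<in> T" and min: "\<And>J. \<exists>p. (J, Some p) \<in> T \<Longrightarrow> card I \<le> card J"
      using ex_has_least_nat[of "\<lambda>J. \<exists>p. (J, Some p) \<in> T" _ card] by blast
    \<comment> \<open>A \<open>p\<close> whose squared variable is repeated is preferred if
      \<open>T\<close> contains one for this \<open>I\<close>; otherwise no repeated index is left
      to disturb an outside \<open>p\<close>.\<close>
    obtain p where p: "(I, Some p) \<in> T" and pp: "\<And>p'. (I, Some p') \<in> T \<Longrightarrow> snd p \<in> fst p \<or> snd p' \<notin> fst p'"
      using I by blast
    have Ik: "I \<subseteq> {..<k}" "I \<noteq> {}" "card I \<le> d - 1" "p \<in> low_index (hyp_vars k I)" using p assms(1) family_index_Some by blast+
    have \<phi>: "low_functional k d I p \<in> functionals k d" using Ik unfolding functionals_def by blast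
    have "(\<Sum>x\<in>T. low_functional k d I p (family_elem k d x)) = 1"
    proof (rule sum_single_nonzero[OF fT p])
      fix x assume x: "x \<in> T"
      then obtain J p' where xo: "x = (J, Some p')" using False by (metis option.exhaust surj_pair)
      have "low_functional k d I p (family_elem k d (J, Some p')) = of_bool (J = I \<and> p' = p)"
      proof (rule low_functional_family_elem_Some[OF Ik(1,2) _ Ik(4)])
        show "card I \<le> card J" using min x xo by blast
      qed (use x xo assms(1) pp in auto)
      then show "low_functional k d I p (family_elem k d x) = of_bool (x = (I, Some p))" unfolding xo by simp
    qed
    then show ?thesis using \<phi> functionals_sum[OF \<phi>] by metis
  qed
qed

lemma QP_dim_lower:
  assumes "k \<ge> 3" "d \<ge> 1"
  shows "cKD k d \<le> QP_dim k (ndeg k d)"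
proof -
  have "card (family_index k d) \<le> QP_dim k (ndeg k d)"
  proof (rule QP_dim_ge[OF finite_family_index Pk_deg_family_elem[OF assms]])
    fix T assume T: "T \<subseteq> family_index k d" "T \<noteq> {}"
    obtain \<phi> where "\<phi> \<in> functionals k d" "\<phi> (\<Sum>x\<in>T. family_elem k d x) = 1"
      using exists_fun[OF T assms(2)] by blast
    then show "(\<Sum>x\<in>T. family_elem k d x) \<notin> hit k" using functionals_hit by fastforce
  qed
  then show ?thesis using card_family_index[OF assms(1)] by simp
qed

section \<open>Strictness\<close>

lemma supp_vprod_mult_square:
  assumes "finite S" "t \<in> supp (vprod S * v ^ 2)"
  obtains t' where "t' \<in> supp v" "t = ones S + (t' + t')"
proof -
  obtain p u where p: "t = p + u" "p \<in> supp (vprod S)" "u \<in> supp (v ^ 2)"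
    using keys_mult[of "vprod S" "v ^ 2"] assms(2) by blast
  have "v ^ 2 = (\<Sum>m\<in>supp v. mon m) ^ 2"
    by (simp only: poly2_as_sum[symmetric])
  also have "\<dots> = (\<Sum>m\<in>supp v. mon m ^ 2)" by (rule poly2_square_sum)
  also have "\<dots> = (\<Sum>m\<in>supp v. mon (m + m))" by (simp add: power2_eq_square mon_mult)
  finally have "supp (v ^ 2) \<subseteq> (\<Union>m\<in>supp v. {m + m})"
    using keys_sum[of "\<lambda>m. mon (m + m)" "supp v"] by simp
  moreover have "p = ones S" using p(2) assms(1) by (simp add: vprod_ones)
  ultimately show ?thesis using that p by blast
qed

text \<open>Letter number \<open>r\<close>, counted from 0, puts a 1 into binary digit
  \<open>r\<close> of every exponent except that of the variable it omits.\<close>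

lemma supp_kameko_word_bit:
  assumes "r < length w" "t \<in> supp (kameko_word k w y)"
  shows "\<exists>i. \<forall>j<k. j \<noteq> i \<longrightarrow> odd (lkp t j div 2 ^ r)"
  using assms
proof (induction w arbitrary: r t)
  case (Cons a w)
  obtain t' where t': "t' \<in> supp (kameko_word k w y)" "t = ones ({..<k} - {a}) + (t' + t')"
    using supp_vprod_mult_square[of "{..<k} - {a}" t "kameko_word k w y"] Cons.prems(2) by (auto simp: kameko_up_def)
  have l: "lkp t j = of_bool (j < k \<and> j \<noteq> a) + 2 * lkp t' j" for j
    by (simp add: t'(2) lookup_add lookup_ones)
  show ?case
  proof (cases r)
    case 0
    then show ?thesis by (intro exI[of _ a]) (simp add: l)
  next
    case (Suc r')
    then obtain i where i: "\<forall>j<k. j \<noteq> i \<longrightarrow> odd (lkp t' j div 2 ^ r')"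
      using Cons.IH[OF _ t'(1), of r'] Cons.prems(1) by auto
    have "lkp t j div 2 ^ r = lkp t' j div 2 ^ r'" for j
    proof -
      have "lkp t j div 2 ^ r = lkp t j div 2 div 2 ^ r'" by (simp add: Suc div_mult2_eq)
      also have "lkp t j div 2 = lkp t' j" by (simp add: l)
      finally show ?thesis .
    qed
    then show ?thesis using i by auto
  qed
qed simp

text \<open>Two exponents with digit \<open>r\<close> equal to 0 keep \<open>s\<close> out of every
  word longer than \<open>r\<close>. So the coefficient of \<open>s\<close> vanishes on the family
  and on hit polynomials, but not on \<open>s\<close> itself. For d = 1 only words of length d
  occur, which is why r < d suffices there.\<close>

lemma QP_dim_strict_spike:
  assumes "k \<ge> 3" "d \<ge> 1" "spike s" "supp s \<subseteq> {..<k}" "mdeg s = ndeg k d"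
    and "r < d" "d = 1 \<or> r < d - 1"
    and ij: "i < k" "j < k" "i \<noteq> j" "even (lkp s i div 2 ^ r)" "even (lkp s j div 2 ^ r)"
  shows "cKD k d < QP_dim k (ndeg k d)"
proof -
  have z: "lkp (family_elem k d x) s = 0" if x: "x \<in> family_index k d" for x
  proof -
    obtain J o' where xo: "x = (J, o')" by fastforce
    obtain w y where w: "family_elem k d x = kameko_word k w y" "r < length w"
    proof (cases o')
      case None
      then show ?thesis
        using that[of "canonical_word d J" 1] x xo canonical_word_subset(2)[of J k d] family_index_None[of J k d] assms(6) by auto
    next
      case (Some p)
      then have J: "J \<subseteq> {..<k}" "J \<noteq> {}" "card J \<le> d - 1" using x xo family_index_Some by blast+
      then have "card J > 0" using finite_subset[of J "{..<k}"] by (auto simp: card_gt_0_iff)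
      then show ?thesis
        using that[of "canonical_word (d - 1) J" "low_mono p"] J canonical_word_subset(2)[OF J] assms(7) xo Some by auto
    qed
    have "s \<notin> supp (family_elem k d x)"
      using supp_kameko_word_bit[OF w(2), of s k y] ij unfolding w(1) by metis
    then show ?thesis by (simp add: in_keys_iff)
  qed
  have h: "lkp f s = 0" if "f \<in> hit k" for f
  proof -
    have "linear_subst var" unfolding linear_subst_def by (metis lin_singleton finite.emptyI finite.insertI)
    then show ?thesis using spike_functional_hit[OF _ assms(3) that, of var] by simp
  qed
  have "card (family_index k d) < QP_dim k (ndeg k d)"
  proof (rule QP_dim_gt[OF finite_family_index Pk_deg_family_elem[OF assms(1,2)], where c = "mon s"])
    show "mon s \<in> Pk_deg k (ndeg k d)" using assms by simp
    show "(\<Sum>x\<in>T. family_elem k d x) \<notin> hit k" if T: "T \<subseteq> family_index k d" "T \<noteq> {}" for T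
      using exists_fun[OF T assms(2)] functionals_hit by fastforce
    show "mon s + (\<Sum>x\<in>T. family_elem k d x) \<notin> hit k" if T: "T \<subseteq> family_index k d" for T
    proof -
      have "(\<Sum>x\<in>T. lkp (family_elem k d x) s) = 0" using z T by (intro sum.neutral) blast
      then have "lkp (mon s + (\<Sum>x\<in>T. family_elem k d x)) s = 1"
        by (simp add: lookup_add lookup_sum)
      then show ?thesis using h by fastforce
    qed
  qed
  then show ?thesis using card_family_index[OF assms(1)] by simp
qed

lemma mdeg_lessThan: "supp m \<subseteq> {..<k} \<Longrightarrow> mdeg m = (\<Sum>i<k. lkp m i)"
  by (rule mdeg_superset) auto

lemma mono_of_fun:
  fixes f :: "nat \<Rightarrow> nat"
  obtains s :: mono where "supp s \<subseteq> {..<k}" "\<forall>i. lkp s i = (if i < k then f i else 0)" "mdeg s = (\<Sum>i<k. f i)"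
proof -
  let ?s = "\<Sum>i<k. Poly_Mapping.single i (f i)"
  have l: "lkp ?s i = (if i < k then f i else 0)" for i
    by (simp add: lookup_sum lookup_single when_def sum.delta)
  then have s: "supp ?s \<subseteq> {..<k}" by (auto simp: in_keys_iff split: if_splits)
  show ?thesis by (rule that[OF s]) (simp_all add: mdeg_lessThan[OF s] l)
qed

lemma QP_dim_strict_d1:
  assumes "k \<ge> 4"
  shows "cKD k 1 < QP_dim k (ndeg k 1)"
proof -
  obtain h where h: "k = h + 4" using assms by (metis add.commute le_Suc_ex)
  \<comment> \<open>One exponent 3 saves variables: degree k - 1 = h + 3 is reached with h + 1 of
    them, so h + 1 and h + 2 are absent.\<close>
  let ?f = "\<lambda>i. if i = 0 then 3 else if i \<le> h then 1 else (0::nat)"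
  obtain s :: mono where s: "supp s \<subseteq> {..<k}" "\<forall>i. lkp s i = (if i < k then ?f i else 0)" "mdeg s = (\<Sum>i<k. ?f i)"
    by (rule mono_of_fun[of k ?f])
  have "(\<Sum>i<k. ?f i) = (\<Sum>i<Suc h. ?f i)"
    unfolding h by (rule sum.mono_neutral_right) auto
  also have "\<dots> = 3 + h" by (subst sum.lessThan_Suc_shift) simp
  finally have m: "mdeg s = ndeg k 1" using s(3) by (simp add: ndeg_def h)
  have sp: "spike s"
    unfolding spike_def
  proof
    fix i
    have "lkp s i \<in> {0, 1, 3}" using s(2)[rule_format, of i] by auto
    moreover have "(0::nat) = 2 ^ 0 - 1" "(1::nat) = 2 ^ 1 - 1" "(3::nat) = 2 ^ 2 - 1" by auto
    ultimately show "\<exists>b. lkp s i = 2 ^ b - 1" by (metis insertE empty_iff)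
  qed
  show ?thesis
    using s(2)[rule_format, of "h + 1"] s(2)[rule_format, of "h + 2"]
    by (intro QP_dim_strict_spike[OF _ _ sp s(1) m, of 0 "h + 1" "h + 2"]) (auto simp: h)
qed

lemma QP_dim_strict_6:
  assumes "k \<ge> 6" "d \<ge> 2"
  shows "cKD k d < QP_dim k (ndeg k d)"
proof -
  obtain h where h: "k = h + 6" using assms by (metis add.commute le_Suc_ex)
  obtain r where d: "d = Suc (Suc r)" using assms(2) by (metis add_2_eq_Suc le_Suc_ex)
  \<comment> \<open>In units of 2^(d-2): 20 = 4 + 4 + 4 + 4 + 4 = 8 + 8 + 2 + 1 + 1.\<close>
  let ?b = "\<lambda>i. if i < 2 then Suc d else if i = 2 then Suc r else if i < 5 then r else if i < h + 5 then d else 0"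
  let ?f = "\<lambda>i::nat. (2::nat) ^ ?b i - 1"
  obtain s :: mono where s: "supp s \<subseteq> {..<k}" "\<forall>i. lkp s i = (if i < k then ?f i else 0)" "mdeg s = (\<Sum>i<k. ?f i)"
    by (rule mono_of_fun[of k ?f])
  have split: "(\<Sum>i<5 + t. g i) = (\<Sum>i<5. g i) + (\<Sum>i<t. g (5 + i))" for t and g :: "nat \<Rightarrow> nat"
    by (induction t) (simp_all only: add_0_right add_Suc_right sum.lessThan_Suc lessThan_0 sum.empty add.assoc)
  have "(\<Sum>i<k. ?f i) = (\<Sum>i<5 + h. ?f i)"
    unfolding h by (rule sum.mono_neutral_right) auto
  also have "\<dots> = (\<Sum>i<5. ?f i) + (\<Sum>i<h. ?f (5 + i))"
    by (rule split)
  also have "(\<Sum>i<h. ?f (5 + i)) = h * (2 ^ d - 1)" by simp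
  also have "(\<Sum>i<5. ?f i) = 5 * (2 ^ d - 1)"
  proof -
    obtain x where x: "(2::nat) ^ r = Suc x" by (metis not0_implies_Suc power_not_zero zero_neq_numeral)
    have "{..<5::nat} = {0, 1, 2, 3, 4}" by auto
    then show ?thesis by (simp add: d x)
  qed
  also have "5 * (2 ^ d - 1) + h * (2 ^ d - 1) = ndeg k d"
    by (simp add: ndeg_def h algebra_simps)
  finally have m: "mdeg s = ndeg k d" using s(3) by simp
  have sp: "spike s"
    unfolding spike_def
  proof
    fix i
    show "\<exists>b. lkp s i = 2 ^ b - 1"
      unfolding s(2)[rule_format] by (rule exI[of _ "if i < k then ?b i else 0"]) simp
  qed
  \<comment> \<open>Variables 3 and 4 have exponent 2^r - 1 with r = d - 2, so digit
    \<open>r\<close> is 0 in both.\<close>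
  have z: "((2::nat) ^ r - 1) div 2 ^ r = 0" by simp
  show ?thesis
    using s(2)[rule_format, of 3] s(2)[rule_format, of 4] z assms
    by (intro QP_dim_strict_spike[OF _ _ sp s(1) m, of r 3 4]) (auto simp: h d)
qed

text \<open>For d \<le> k there is a set \<open>?I\<close> of \<open>d\<close> letters, too large
  for the second kind of family functionals, whose own functional of that kind still vanishes on hit
  polynomials. The letters \<open>?J\<close> of the new element are one short of \<open>?I\<close>,
  and its factor \<open>lin ?J\<close> vanishes on the hyperplane of \<open>?J\<close> but not on
  that of \<open>?I\<close>.\<close>

lemma QP_dim_strict_small:
  assumes "k \<ge> 4" "2 \<le> d" "d \<le> k"
  shows "cKD k d < QP_dim k (ndeg k d)"
proof -
  define l where "l = d - 1"
  let ?J = "{..<l}" and ?I = "{..<Suc l}"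
  have l: "1 \<le> l" "l < k" "Suc l = d" using assms by (auto simp: l_def)
  \<comment> \<open>Together with \<open>var l ^ 2\<close> and the linear form these k - 4 variables
    fill degree k - 1. They avoid 0 = Min ?I and \<open>l\<close>, so that the final monomial is a
    spike on the hyperplane.\<close>
  obtain R where R: "R \<subseteq> {1..<k} - {l}" "card R = k - 4" "finite R"
  proof -
    have "k - 4 \<le> card ({1..<k} - {l})" using l by simp
    then show thesis using obtain_subset_with_card_n that by metis
  qed
  define w where "w = canonical_word l ?J"
  define y where "y = var l ^ 2 * (lin ?J * vprod R)"
  \<comment> \<open>All functionals of the family kill c: those of the first kind because y has a square factor,
    those of the second kind because the only I with J <= I and card I < d is J, where lin J = 0.\<close>
  define c where "c = kameko_word k w y"
  have w: "set w = ?J" "length w = l" using canonical_word_subset[of ?J k l] l lessThan_empty_iff[of l] unfolding w_def by auto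
  have lw: "length w = d - 1" using w(2) by (simp add: l_def)
  have wk: "set w \<subseteq> {..<k}" using w l by auto
  have "lin ?J \<in> Pk_deg k 1"
    unfolding lin_def using l by (intro Pk_deg_sum Pk_deg_var) auto
  then have "y \<in> Pk_deg k (2 * 1 + (1 + card R))"
    unfolding y_def using R l by (intro Pk_deg_mult Pk_deg_pow Pk_deg_var Pk_deg_vprod) auto
  moreover have "2 * 1 + (1 + card R) = ndeg k 1" using R(2) assms(1) by (simp add: ndeg_def)
  ultimately have yk: "y \<in> Pk_deg k (ndeg k 1)" by simp
  have cdeg: "c \<in> Pk_deg k (ndeg k d)"
    unfolding c_def using Pk_deg_kameko_word[OF wk yk] w l by simp
  have kill: "\<phi> c = 0" if "\<phi> \<in> functionals k d" for \<phi>
    using that unfolding functionals_def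
  proof (elim UnE CollectE exE conjE)
    fix I assume "\<phi> = top_functional k d I" "I \<subseteq> {..<k}" "I \<noteq> {}"
    then show ?thesis
      unfolding c_def y_def using wk w l by (auto intro!: top_functional_short_square)
  next
    fix I p assume A: "\<phi> = low_functional k d I p" "I \<subseteq> {..<k}" "I \<noteq> {}" "card I \<le> d - 1" "p \<in> low_index (hyp_vars k I)"
    have fI: "finite I" using A(2) finite_subset by blast
    have v: "low_functional k d I p c = of_bool (?J \<subseteq> I) * lkp (ev (target_subst I p) y) (target_mono p)"
      unfolding c_def using low_functional_kameko_word[OF A(2,3) wk A(5) lw, of y] unfolding w(1) .
    show ?thesis
    proof (cases "?J \<subseteq> I")
      case True
      then have "?J = I" using A(4) fI l by (intro card_seteq) auto
      obtain S a where p: "p = (S, a)" by fastforce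
      have "ev (hyp_subst I) (lin ?J) = 0" using ev_hyp_subst_lin[OF fI A(3)] \<open>?J = I\<close> by simp
      then have "ev (target_subst I p) (lin ?J) = 0" unfolding p target_subst_ev by simp
      then have "ev (target_subst I p) y = 0" by (simp add: y_def ev_mult)
      then show ?thesis using v A(1) by simp
    next
      case False
      then show ?thesis using v A(1) by simp
    qed
  qed
  have MI: "Min ?I = 0" by (rule Min_eqI) auto
  define m where "m = Poly_Mapping.single l 3 + ones R"
  define \<psi> where "\<psi> f = lkp (ev (hyp_subst ?I) f) (spike_exp (hyp_vars k ?I) l m)" for f
  have Ik: "?I \<subseteq> {..<k}" "?I \<noteq> {}" using l by auto
  have lR: "l \<notin> R" "0 \<notin> R" using R by auto
  have lm: "lkp m i = (if i = l then 3 else 0) + of_bool (i \<in> R)" for i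
    using R(3) by (simp add: m_def lookup_add lookup_ones lookup_single when_def)
  have hit: "\<psi> f = 0" if "f \<in> hit k" for f
    unfolding \<psi>_def
  proof (rule spike_functional_hit[OF linear_hyp_subst spike_exp_spike that])
    show "spike m"
      unfolding spike_def
    proof
      fix i
      have "lkp m i \<in> {0, 1, 3}" using lm[of i] lR by auto
      moreover have "(0::nat) = 2 ^ 0 - 1" "(1::nat) = 2 ^ 1 - 1" "(3::nat) = 2 ^ 2 - 1" by auto
      ultimately show "\<exists>b. lkp m i = 2 ^ b - 1" by (metis insertE empty_iff)
    qed
    show "supp m \<subseteq> hyp_vars k ?I"
      using lR R l unfolding hyp_vars_def MI by (auto simp: in_keys_iff lm split: if_splits)
  qed auto
  have "\<psi> c = of_bool (set w \<subseteq> ?I) * lkp (ev (hyp_subst ?I) y) m"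
    using top_functional_kameko_word[OF Ik wk, of y m] unfolding w(2) \<psi>_def c_def .
  \<comment> \<open>On the hyperplane of \<open>?I\<close> the variables of \<open>?I\<close> add up
    to zero, so \<open>lin ?J\<close> becomes \<open>var l\<close>, which raises the exponent 2 of
    \<open>l\<close> to 3.\<close>
  also have "ev (hyp_subst ?I) y = mon m"
  proof -
    have "0 \<in> ?J" using l by auto
    then have "lin ?J = var 0 + lin (?J - {0})" "lin (?I - {0}) = var l + lin (?J - {0})"
    proof -
      show "lin ?J = var 0 + lin (?J - {0})" unfolding lin_def using \<open>0 \<in> ?J\<close> by (intro sum.remove) auto
      have "?I - {0} = insert l (?J - {0})" using l by auto
      then show "lin (?I - {0}) = var l + lin (?J - {0})" unfolding lin_def by simp
    qed
    moreover have "ev (hyp_subst ?I) (lin (?J - {0})) = lin (?J - {0})"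
      unfolding lin_def ev_sum[OF poly2_two] by (intro sum.cong) (auto simp: hyp_subst_def MI)
    moreover have "hyp_subst ?I 0 = lin (?I - {0})" by (simp add: hyp_subst_def MI)
    ultimately have "ev (hyp_subst ?I) (lin ?J) = var l" by (simp add: ev_add add.assoc)
    moreover have "hyp_subst ?I l = var l" unfolding hyp_subst_def MI using l by simp
    moreover have "ev (hyp_subst ?I) (vprod R) = vprod R" using lR R(3) by (intro ev_hyp_subst_vprod) (auto simp: MI)
    ultimately have "ev (hyp_subst ?I) y = var l ^ 3 * vprod R"
      by (simp add: y_def ev_mult ev_pow power3_eq_cube power2_eq_square mult.assoc)
    then show ?thesis by (simp add: m_def vprod_ones[OF R(3)] var_pow mon_mult)
  qed
  finally have \<psi>c: "\<psi> c = 1" using w by auto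
  have "card (family_index k d) < QP_dim k (ndeg k d)"
  proof (rule QP_dim_gt[OF finite_family_index Pk_deg_family_elem cdeg])
    show "(\<Sum>x\<in>T. family_elem k d x) \<notin> hit k" if T: "T \<subseteq> family_index k d" "T \<noteq> {}" for T
      using exists_fun[OF T] functionals_hit assms(2) by fastforce
    show "c + (\<Sum>x\<in>T. family_elem k d x) \<notin> hit k" if T: "T \<subseteq> family_index k d" for T
    \<comment> \<open>\<open>\<psi>\<close> serves for \<open>c\<close> alone. For nonempty
      \<open>T\<close> a family functional detects the sum over \<open>T\<close> and is blind to
      \<open>c\<close>.\<close>
    proof (cases "T = {}")
      case True
      then show ?thesis using hit \<psi>c by fastforce
    next
      case False
      then obtain \<phi> where \<phi>: "\<phi> \<in> functionals k d" "\<phi> (\<Sum>x\<in>T. family_elem k d x) = 1"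
        using exists_fun[OF T] assms(2) by auto
      then have "\<phi> (c + (\<Sum>x\<in>T. family_elem k d x)) = 1" using kill functionals_add(1)[OF \<phi>(1)] by simp
      then show ?thesis using functionals_hit[OF \<phi>(1)] by fastforce
    qed
  qed (use assms in auto)
  then show ?thesis using card_family_index[of k d] assms(1) by simp
qed

theorem mainTheorem1:
  fixes k d n :: nat
  assumes "k \<ge> 3" and "d \<ge> 1" and "n = (k - 1) * (2 ^ d - 1)"
  shows "QP_dim k n \<ge> cKD k d \<and>
         (QP_dim k n = cKD k d \<longleftrightarrow> k = 3 \<or> (k = 4 \<and> d \<ge> 5) \<or> (k = 5 \<and> d \<ge> 6))"
proof
  have n: "n = ndeg k d" using assms(3) by (simp add: ndeg_def)
  show ge: "QP_dim k n \<ge> cKD k d" unfolding n by (rule QP_dim_lower[OF assms(1,2)])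
  show "QP_dim k n = cKD k d \<longleftrightarrow> k = 3 \<or> (k = 4 \<and> d \<ge> 5) \<or> (k = 5 \<and> d \<ge> 6)"
  proof
    assume eq: "QP_dim k n = cKD k d"
    show "k = 3 \<or> (k = 4 \<and> d \<ge> 5) \<or> (k = 5 \<and> d \<ge> 6)"
    proof (rule ccontr)
      assume "\<not> ?thesis"
      then consider "k \<ge> 4" "d = 1" | "k \<ge> 6" "d \<ge> 2" | "k \<ge> 4" "2 \<le> d" "d \<le> k"
        using assms(1,2) by linarith
      then have "cKD k d < QP_dim k n"
        unfolding n using QP_dim_strict_d1 QP_dim_strict_6 QP_dim_strict_small by cases auto
      then show False using eq by simp
    qed
  next
    assume "k = 3 \<or> (k = 4 \<and> d \<ge> 5) \<or> (k = 5 \<and> d \<ge> 6)"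
    then consider "k = 3" | "k \<in> {4, 5}" "d > k" by fastforce
    then have "QP_dim k n \<le> cKD k d"
    proof cases
      case 1
      then show ?thesis using QP_dim_upper_3[OF assms(2)] by (simp add: n cKD_def)
    next
      case 2
      \<comment> \<open>Both sums in \<open>cKD\<close> now run up to k, so it factors like the
        upper bound.\<close>
      then have "min k d = k" "min k (d - 1) = k" by auto
      then show ?thesis using QP_dim_upper[OF 2]
        by (simp only: n cKD_def) (simp add: algebra_simps)
    qed
    then show "QP_dim k n = cKD k d" using ge by simp
  qed
qed

end
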